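(* Let $r$ be a rank array that can occur. The map $\Psi_r$ taking each $D_r$-peelable tableau $Q\in\mathrm{Peel}(D_r)$ to the list $\Psi_r(Q)=(W_1,\dots,W_n)$ of tableaux obtained by deleting $D_{\mathit{Hom}}$ from $Q$ is a bijection from the set of $D_r$-peelable tableaux to the set of $r$-factor sequences.
   Context: Rank arrays. Let $k$ be a field, $n\ge1$, $r_0,\dots,r_n$ nonnegative integers, $d=r_0+\cdots+r_n$, $\mathit{Hom}=\prod_{i=1}^nM_{r_{i-1}\times r_i}(k)$. The rank array of $\phi\in\mathit{Hom}$ is $r_{ij}(\phi)=\operatorname{rank}(\phi_{i+1}\cdots\phi_j)$ for $i<j$, $r_{ii}(\phi)=r_i$. A rank array can occur if it is $r(\phi)$ for some $\phi\in\mathit{Hom}$. Zelevinsky permutation and its diagram. Put $s_{ij}=r_{ij}-r_{i-1,j}-r_{i,j+1}+r_{i-1,j+1}$ for $0\le i\le j\le n$, where $r_{ab}=0$ unless $0\le a,b\le n$. Divide the $d\times d$ grid into block rows $0,\dots,n$ from top to bottom of heights $r_0,\dots,r_n$ and block columns labelled $n,\dots,0$ from left to right, block column $i$ having width $r_i$. The matrix of a permutation $v$ has its $1$'s at $(q,v(q))$. $v(r)\in S_d$ is the unique permutation such that the block in block column $i$ and block row $j$ contains exactly $s_{ij}$ ones if $i\le j$, $r_{j,j+1}$ ones if $i=j+1$, none if $i\ge j+2$, and such that within every block row and block column the $1$'s proceed from northwest to southeast. $D_r$ is the set of boxes $(q,p)$ with $p<v(r)(q)$ and $q<v(r)^{-1}(p)$.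 $D_{\mathit{Hom}}$ is the set of all boxes in blocks (block row $j$, block column $i$) with $i\ge j+2$, and $D(\Omega_0)$ the set of all boxes in blocks with $i\ge j+1$; both are Young diagrams of partitions, and $D_{\mathit{Hom}}\subseteq D_r$. Inside any block with $i\le j+1$, the boxes of $D_r$ form a (possibly empty) rectangle. Tableaux. Tableaux are semistandard (English convention: rows weakly increase, columns strictly increase downward) and are identified with their column reading words: columns from left to right, each read from bottom to top; the same reading is used for skew tableaux. $[u]$ is the unique tableau Knuth-equivalent to the word $u$ (relations $acb\sim cab$ for $a\le b<c$, $bac\sim bca$ for $a<b\le c$); $[uv]$ uses concatenation. Peelable tableaux. A diagram is a finite set of boxes (row, column). It is northwest if $(i_1,j_2),(i_2,j_1)\in D$ with $i_1<i_2$, $j_1<j_2$ implies $(i_1,j_1)\in D$; permutation diagrams are northwest. A column of a diagram is identified with the one-column tableau whose entries are the row indices of its boxes. For $D$ northwest, a tableau $Q$ is $D$-peelable if $D$ and $Q$ are both empty, or $D\ne\varnothing$, $Q$ contains $C$ in its northwest corner, and $[Q-C]$ is $(D-C)$-peelable, where $C$ is the first nonempty column of $D$ and $Q-C$ is the skew tableau obtained by removing the subtableau $C$ from $Q$. $\mathrm{Peel}(D)$ is the set of $D$-peelable tableaux. Deleting $D_{\mathit{Hom}}$. Every $Q\in\mathrm{Peel}(D_r)$ has shape $\lambda$ with $D_{\mathit{Hom}}\subseteq\lambda\subseteq D(\Omega_0)$ and contains in its northwest corner the tableau $\mathrm{key}(D_{\mathit{Hom}})$ of shape $D_{\mathit{Hom}}$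 whose $q$-th row has all entries $q$. $D(\Omega_0)/D_{\mathit{Hom}}$ is the disjoint union of the $r_{i-1}\times r_i$ rectangles in block row $i-1$ and block column $i$, $1\le i\le n$. $\Psi_r(Q)=(W_1,\dots,W_n)$, where $W_i$ is the subtableau of the skew tableau $Q-\mathrm{key}(D_{\mathit{Hom}})$ sitting inside the $r_{i-1}\times r_i$ rectangle (regarded as a tableau of partition shape). Factor sequences. Let $T_{ij}$ ($1\le i\le j+1\le n$) be the rectangular tableau formed by the boxes of $D_r$ in block column $i$ and block row $j$, each box in row $q$ of the grid being filled with $q$. For a triangular array $T=(T_{ij})_{1\le i\le j+1\le n}$ of tableaux, define factor sequences of $T$ recursively: if $n=1$ the only one is $(T_{10})$. If $n\ge2$, a factor sequence is a list $(W_1,\dots,W_n)$ of tableaux for which there exist a factor sequence $(U_1,\dots,U_{n-1})$ of the array $\hat T$ with $\hat T_{ij}=T_{i,j+1}$ ($1\le i\le j+1\le n-1$), and tableaux $P_i,Q_i$ with $U_i=[P_iQ_i]$ for $1\le i\le n-1$, such that $W_i=[Q_i\,T_{i,i-1}\,P_{i-1}]$ for $1\le i\le n$, where $Q_n=P_0=\varnothing$. The $r$-factor sequences are the factor sequences of this array $T=T(r)$. *)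

theory Defs
  imports Jordan_Normal_Form.DL_Rank "HOL-Combinatorics.Permutations"
begin

section \<open>Rank arrays\<close>

text \<open>A representation consists of matrices \<open>\<phi> 1, \<dots>, \<phi> n\<close>, where \<open>\<phi> i\<close> has \<open>dims (i - 1)\<close> rows
  and \<open>dims i\<close> columns.\<close>

definition Hom :: "nat \<Rightarrow> (nat \<Rightarrow> nat) \<Rightarrow> (nat \<Rightarrow> 'k::field mat) set" where
  "Hom n dims = {\<phi>. \<forall>i\<in>{1..n}. \<phi> i \<in> carrier_mat (dims (i - 1)) (dims i)}"

definition path_prod :: "(nat \<Rightarrow> nat) \<Rightarrow> (nat \<Rightarrow> 'k::field mat) \<Rightarrow> nat \<Rightarrow> nat \<Rightarrow> 'k mat" where
  "path_prod dims \<phi> i j = foldr (\<lambda>l A. \<phi> l * A) [i+1..<j+1] (1\<^sub>m (dims j))"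

definition rank_array :: "(nat \<Rightarrow> nat) \<Rightarrow> (nat \<Rightarrow> 'k::field mat) \<Rightarrow> nat \<Rightarrow> nat \<Rightarrow> nat" where
  "rank_array dims \<phi> i j =
     (if i < j then vec_space.rank (dims i) (path_prod dims \<phi> i j) else dims i)"

text \<open>Only the entries \<open>r i j\<close> with \<open>i \<le> j \<le> n\<close> of an array are meaningful; the dimension \<open>r\<^sub>i\<close> is
  the diagonal entry \<open>r i i\<close>.\<close>

definition can_occur :: "'k::field itself \<Rightarrow> nat \<Rightarrow> (nat \<Rightarrow> nat \<Rightarrow> nat) \<Rightarrow> bool" where
  "can_occur _ n r \<longleftrightarrow>
     (\<exists>\<phi>::nat \<Rightarrow> 'k mat. \<phi> \<in> Hom n (\<lambda>i. r i i) \<and>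
        (\<forall>i j. i \<le> j \<and> j \<le> n \<longrightarrow> r i j = rank_array (\<lambda>i. r i i) \<phi> i j))"


section \<open>The Zelevinsky permutation and its diagram\<close>

text \<open>Rows and columns of the grid, and of all diagrams, are numbered from 1; a box is a pair
  (row, column).\<close>

type_synonym box = "nat \<times> nat"

definition grid_size :: "nat \<Rightarrow> (nat \<Rightarrow> nat \<Rightarrow> nat) \<Rightarrow> nat" where
  "grid_size n r = (\<Sum>i\<le>n. r i i)"

definition row_offset :: "(nat \<Rightarrow> nat \<Rightarrow> nat) \<Rightarrow> nat \<Rightarrow> nat" where
  "row_offset r j = (\<Sum>l<j. r l l)"

text \<open>Block columns are labelled \<open>n, \<dots>, 0\<close> from left to right.\<close>

definition col_offset :: "nat \<Rightarrow> (nat \<Rightarrow> nat \<Rightarrow> nat) \<Rightarrow> nat \<Rightarrow> nat" where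
  "col_offset n r i = (\<Sum>l\<in>{i<..n}. r l l)"

definition block_row :: "(nat \<Rightarrow> nat \<Rightarrow> nat) \<Rightarrow> nat \<Rightarrow> nat set" where
  "block_row r j = {row_offset r j + 1 .. row_offset r j + r j j}"

definition block_col :: "nat \<Rightarrow> (nat \<Rightarrow> nat \<Rightarrow> nat) \<Rightarrow> nat \<Rightarrow> nat set" where
  "block_col n r i = {col_offset n r i + 1 .. col_offset n r i + r i i}"

definition rank_ext :: "nat \<Rightarrow> (nat \<Rightarrow> nat \<Rightarrow> nat) \<Rightarrow> int \<Rightarrow> int \<Rightarrow> int" where
  "rank_ext n r a b =
     (if a \<in> {0..int n} \<and> b \<in> {0..int n} then int (r (nat a) (nat b)) else 0)"

definition lace_count :: "nat \<Rightarrow> (nat \<Rightarrow> nat \<Rightarrow> nat) \<Rightarrow> nat \<Rightarrow> nat \<Rightarrow> int" where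
  "lace_count n r i j =
     rank_ext n r (int i) (int j) - rank_ext n r (int i - 1) (int j)
     - rank_ext n r (int i) (int j + 1) + rank_ext n r (int i - 1) (int j + 1)"

definition is_zelevinsky :: "nat \<Rightarrow> (nat \<Rightarrow> nat \<Rightarrow> nat) \<Rightarrow> (nat \<Rightarrow> nat) \<Rightarrow> bool" where
  "is_zelevinsky n r v \<longleftrightarrow>
     v permutes {1..grid_size n r} \<and>
     (\<forall>i\<le>n. \<forall>j\<le>n.
        int (card {q \<in> block_row r j. v q \<in> block_col n r i}) =
          (if i \<le> j then lace_count n r i j
           else if i = j + 1 then int (r j (j + 1))
           else 0)) \<and>
     (\<forall>j\<le>n. \<forall>q\<in>block_row r j. \<forall>q'\<in>block_row r j. q < q' \<longrightarrow> v q < v q') \<and>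
     (\<forall>i\<le>n. \<forall>p\<in>block_col n r i. \<forall>p'\<in>block_col n r i. p < p' \<longrightarrow> inv_into UNIV v p < inv_into UNIV v p')"

definition zelevinsky :: "nat \<Rightarrow> (nat \<Rightarrow> nat \<Rightarrow> nat) \<Rightarrow> nat \<Rightarrow> nat" where
  "zelevinsky n r = (THE v. is_zelevinsky n r v)"

definition perm_diagram :: "nat \<Rightarrow> (nat \<Rightarrow> nat) \<Rightarrow> box set" where
  "perm_diagram d v = {(q, p). q \<in> {1..d} \<and> p \<in> {1..d} \<and> p < v q \<and> q < inv_into UNIV v p}"

definition D_rank :: "nat \<Rightarrow> (nat \<Rightarrow> nat \<Rightarrow> nat) \<Rightarrow> box set" where
  "D_rank n r = perm_diagram (grid_size n r) (zelevinsky n r)"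

definition D_Hom :: "nat \<Rightarrow> (nat \<Rightarrow> nat \<Rightarrow> nat) \<Rightarrow> box set" where
  "D_Hom n r = (\<Union>j\<le>n. \<Union>i\<in>{j+2..n}. block_row r j \<times> block_col n r i)"


section \<open>Tableaux and Knuth equivalence\<close>

text \<open>A (straight or skew) tableau is the partial map sending each of its boxes to its entry.\<close>

type_synonym filling = "box \<Rightarrow> nat option"

definition young_diagram :: "box set \<Rightarrow> bool" where
  "young_diagram L \<longleftrightarrow> finite L \<and> L \<subseteq> {1..} \<times> {1..} \<and>
     (\<forall>a b a' b'. (a, b) \<in> L \<and> a' \<in> {1..a} \<and> b' \<in> {1..b} \<longrightarrow> (a', b') \<in> L)"

definition semistandard :: "filling \<Rightarrow> bool" where
  "semistandard F \<longleftrightarrow>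
     (\<forall>a b b' x y. b < b' \<and> F (a, b) = Some x \<and> F (a, b') = Some y \<longrightarrow> x \<le> y) \<and>
     (\<forall>a a' b x y. a < a' \<and> F (a, b) = Some x \<and> F (a', b) = Some y \<longrightarrow> x < y)"

definition tableau :: "filling \<Rightarrow> bool" where
  "tableau F \<longleftrightarrow> young_diagram (dom F) \<and> semistandard F"

text \<open>Column reading word: columns from left to right, each read from bottom to top.\<close>

definition column_word :: "filling \<Rightarrow> nat list" where
  "column_word F =
     concat (map (\<lambda>c. map (\<lambda>a. the (F (a, c))) (rev (sorted_list_of_set {a. (a, c) \<in> dom F})))
                 (sorted_list_of_set (snd ` dom F)))"

inductive knuth_step :: "nat list \<Rightarrow> nat list \<Rightarrow> bool" where
  "a \<le> b \<Longrightarrow> b < c \<Longrightarrow> knuth_step (us @ [a, c, b] @ vs) (us @ [c, a, b] @ vs)"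
| "a < b \<Longrightarrow> b \<le> c \<Longrightarrow> knuth_step (us @ [b, a, c] @ vs) (us @ [b, c, a] @ vs)"

definition knuth_equiv :: "nat list \<Rightarrow> nat list \<Rightarrow> bool" where
  "knuth_equiv = equivclp knuth_step"

definition tableau_of :: "nat list \<Rightarrow> filling" where
  "tableau_of u = (THE F. tableau F \<and> knuth_equiv (column_word F) u)"

definition remove_sub :: "filling \<Rightarrow> filling \<Rightarrow> filling" where
  "remove_sub F G = F |` (- dom G)"

text \<open>The box at position \<open>(a0 + 1, b0 + 1)\<close> is moved to the northwest corner \<open>(1, 1)\<close>.\<close>

definition shift_nw :: "nat \<Rightarrow> nat \<Rightarrow> filling \<Rightarrow> filling" where
  "shift_nw a0 b0 F = (\<lambda>(a, b). if 1 \<le> a \<and> 1 \<le> b then F (a0 + a, b0 + b) else None)"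

text \<open>Each box is filled with its row index.\<close>

definition row_filling :: "box set \<Rightarrow> filling" where
  "row_filling B = (\<lambda>(q, p). if (q, p) \<in> B then Some q else None)"


section \<open>Peelable tableaux\<close>

definition northwest :: "box set \<Rightarrow> bool" where
  "northwest D \<longleftrightarrow>
     (\<forall>i1 i2 j1 j2. (i1, j2) \<in> D \<and> (i2, j1) \<in> D \<and> i1 < i2 \<and> j1 < j2 \<longrightarrow> (i1, j1) \<in> D)"

lemma northwest_perm_diagram: "northwest (perm_diagram d v)"
  unfolding northwest_def perm_diagram_def by auto

definition first_column :: "box set \<Rightarrow> box set" where
  "first_column D = {(q, p) \<in> D. p = Min (snd ` D)}"

text \<open>A set of boxes in one column, identified with the one-column tableau (in column 1) whose
  entries are the row indices of the boxes.\<close>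

definition column_tableau :: "box set \<Rightarrow> filling" where
  "column_tableau C =
     (\<lambda>(a, b). if b = 1 \<and> a \<in> {1..card C} then Some (sorted_list_of_set (fst ` C) ! (a - 1))
               else None)"

text \<open>This is only meant to be applied to northwest diagrams, such as permutation diagrams; removing
  the first column of a northwest diagram leaves a northwest diagram.\<close>

inductive peelable :: "box set \<Rightarrow> filling \<Rightarrow> bool" where
  peelable_empty: "peelable {} Map.empty"
| peelable_step:
    "\<lbrakk> finite D; D \<noteq> {}; tableau Q; column_tableau (first_column D) \<subseteq>\<^sub>m Q;
       peelable (D - first_column D)
         (tableau_of (column_word (remove_sub Q (column_tableau (first_column D))))) \<rbrakk>
     \<Longrightarrow> peelable D Q"

definition Peel :: "box set \<Rightarrow> filling set" where
  "Peel D = {Q. peelable D Q}"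


section \<open>Deleting the diagram of Hom\<close>

definition key_Hom :: "nat \<Rightarrow> (nat \<Rightarrow> nat \<Rightarrow> nat) \<Rightarrow> filling" where
  "key_Hom n r = row_filling (D_Hom n r)"

text \<open>The list \<open>W\<^sub>1, \<dots>, W\<^sub>n\<close>; here \<open>W\<^sub>i\<close> has list index \<open>i - 1\<close>.\<close>

definition Psi :: "nat \<Rightarrow> (nat \<Rightarrow> nat \<Rightarrow> nat) \<Rightarrow> filling \<Rightarrow> filling list" where
  "Psi n r Q =
     map (\<lambda>i. shift_nw (row_offset r (i - 1)) (col_offset n r i)
                (remove_sub Q (key_Hom n r) |` (block_row r (i - 1) \<times> block_col n r i)))
         [1..<n+1]"


section \<open>Factor sequences\<close>

text \<open>The boxes of a rectangle are shifted so that its northwest corner, which need not be the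
  northwest corner of the surrounding block, becomes \<open>(1, 1)\<close>.\<close>

definition T_rank :: "nat \<Rightarrow> (nat \<Rightarrow> nat \<Rightarrow> nat) \<Rightarrow> nat \<Rightarrow> nat \<Rightarrow> filling" where
  "T_rank n r i j =
     (let B = D_rank n r \<inter> (block_row r j \<times> block_col n r i)
      in shift_nw (Min (fst ` B) - 1) (Min (snd ` B) - 1) (row_filling B))"

text \<open>\<open>factor_sequence n T W\<close> only depends on the entries \<open>T i j\<close> with \<open>1 \<le> i \<le> j + 1 \<le> n\<close>.\<close>

inductive factor_sequence :: "nat \<Rightarrow> (nat \<Rightarrow> nat \<Rightarrow> filling) \<Rightarrow> filling list \<Rightarrow> bool" where
  factor_sequence_base: "factor_sequence 1 T [T 1 0]"
| factor_sequence_step: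
    "\<lbrakk> n \<ge> 2;
       factor_sequence (n - 1) (\<lambda>i j. T i (j + 1)) U;
       \<forall>i\<in>{1..n-1}. tableau (P i) \<and> tableau (Q i) \<and>
          U ! (i - 1) = tableau_of (column_word (P i) @ column_word (Q i));
       P 0 = Map.empty; Q n = Map.empty;
       length W = n;
       \<forall>i\<in>{1..n}. W ! (i - 1) =
          tableau_of (column_word (Q i) @ column_word (T i (i - 1)) @ column_word (P (i - 1))) \<rbrakk>
     \<Longrightarrow> factor_sequence n T W"

definition rank_factor_sequences :: "nat \<Rightarrow> (nat \<Rightarrow> nat \<Rightarrow> nat) \<Rightarrow> filling list set" where
  "rank_factor_sequences n r = {W. factor_sequence n (T_rank n r) W}"

end

theory Submission
  imports Defs "HOL-Library.Sublist"
begin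

text \<open>The idea.  Words are taken up to Knuth equivalence.  In the part of the diagram that is left after
  the block columns \<open>n, \<dots>, m + 1\<close> have been peeled, every column \<open>C\<close> of block column \<open>m\<close> is an
  initial segment of the set of rows that still occur.  For such \<open>C\<close>, column insertion shows that a
  word peels to \<open>Y\<close> iff it is equivalent to some \<open>q C p\<close> with all letters of \<open>q\<close> larger than \<open>C\<close> and
  \<open>q p\<close> equivalent to \<open>Y\<close>.  Consequently, if \<open>S\<close> is a column of letters smaller than those of \<open>X\<close>,
  then peeling \<open>w\<close> columns \<open>S \<union> c\<close> from \<open>X S\<^sup>w P\<close> is the same as peeling the columns \<open>c\<close> from \<open>X\<close>
  and appending \<open>P\<close>.  Applied to the full rows of a block column this removes \<open>D\<^sub>H\<^sub>o\<^sub>m\<close>; applied to the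
  uppermost rectangle \<open>T\<^sub>m\<^sub>,\<^sub>m\<^sub>-\<^sub>1\<close> of each block column, with \<open>W\<^sub>m \<sim> Q\<^sub>m T\<^sub>m\<^sub>,\<^sub>m\<^sub>-\<^sub>1 P\<^sub>m\<^sub>-\<^sub>1\<close>, it
  turns peelability of \<open>W\<close> into peelability of the list of all \<open>P\<^sub>i Q\<^sub>i\<close>, which is the recursion for
  factor sequences.\<close>

section \<open>Ranks of matrix products\<close>

text \<open>Peeling runs through the block columns from \<open>n\<close> down to \<open>1\<close>
  and couples them: letters left over from one are read together with the next piece.
  \<open>good\<close> records these leftovers as existentially quantified words, so that one layer
  can be removed from all block columns at once.

  A row meets only block columns to the left of the one holding its 1. So the letters alive at block
  column \<open>m\<close> have their 1 in a block column labelled below \<open>m\<close>, and among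
  these the diagram column \<open>p\<close> selects the rows in block rows before that of the 1 in
  column \<open>p\<close>. This is the source of the initial segments; for them, standing at the top
  of the first column is a matter of subsequences.

  The tableaux of a factor sequence come with no bound on their shape. That \<open>W i\<close> fits
  into its rectangle is proved separately: heights by counting available letters, widths by weakly
  increasing subsequences. Injectivity then follows because \<open>Q\<close> is recovered by putting
  the columns of \<open>D_Hom\<close> back on top. Occurrence of \<open>r\<close> enters through
  Frobenius' inequality, which makes the prescribed numbers of ones nonnegative, so that the
  permutation exists.\<close>

definition subdim :: "nat \<Rightarrow> 'k::field vec set \<Rightarrow> nat" where
  "subdim m S = vectorspace.dim class_ring ((module_vec TYPE('k) m)\<lparr>carrier := S\<rparr>)"

definition image_space :: "'k::field mat \<Rightarrow> 'k vec set" where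
  "image_space A = {A *\<^sub>v x | x. x \<in> carrier_vec (dim_col A)}"

lemma vec_subspace_iff:
  "subspace class_ring S (module_vec TYPE('k::field) m) \<longleftrightarrow>
    S \<subseteq> carrier_vec m \<and> 0\<^sub>v m \<in> S \<and> (\<forall>x\<in>S. \<forall>y\<in>S. x + y \<in> S) \<and> (\<forall>c. \<forall>x\<in>S. c \<cdot>\<^sub>v x \<in> S)"
proof -
  interpret V: vec_space "TYPE('k)" m .
  show ?thesis
    unfolding subspace_def submodule_def
    by (auto simp: module_vec_simps class_ring_simps intro: vec_vs V.module_axioms)
qed

lemma image_space_iff: "A \<in> carrier_mat a b \<Longrightarrow> y \<in> image_space A \<longleftrightarrow> (\<exists>x\<in>carrier_vec b. y = A *\<^sub>v x)"
  by (auto simp: image_space_def)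

lemma subspace_image_space:
  fixes A :: "'k::field mat"
  assumes A: "A \<in> carrier_mat a b"
  shows "subspace class_ring (image_space A) (module_vec TYPE('k) a)"
  unfolding vec_subspace_iff
proof (intro conjI ballI allI)
  show "image_space A \<subseteq> carrier_vec a" using A by (auto simp: image_space_iff[OF A])
  show "0\<^sub>v a \<in> image_space A" unfolding image_space_iff[OF A]
    by (rule bexI[of _ "0\<^sub>v b"]) (use A in auto)
  fix x y c assume "x \<in> image_space A"
  then obtain u where u: "u \<in> carrier_vec b" "x = A *\<^sub>v u" by (auto simp: image_space_iff[OF A])
  show "c \<cdot>\<^sub>v x \<in> image_space A" unfolding image_space_iff[OF A]
    by (rule bexI[of _ "c \<cdot>\<^sub>v u"]) (use A u in \<open>auto simp: mult_mat_vec\<close>)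
  assume "y \<in> image_space A"
  then obtain w where w: "w \<in> carrier_vec b" "y = A *\<^sub>v w" by (auto simp: image_space_iff[OF A])
  show "x + y \<in> image_space A" unfolding image_space_iff[OF A]
    by (rule bexI[of _ "u + w"]) (use A u w in \<open>auto simp: mult_add_distrib_mat_vec\<close>)
qed

lemma rank_eq_subdim:
  fixes A :: "'k::field mat"
  assumes A: "A \<in> carrier_mat a b"
  shows "vec_space.rank a A = subdim a (image_space A)"
proof -
  interpret V: vec_space "TYPE('k)" a .
  have "image_space A = V.span (set (cols A))"
    using V.col_space_eq[OF A] A by (auto simp: V.col_space_def image_space_def)
  then show ?thesis by (simp add: V.rank_def subdim_def)
qed

text \<open>A set that is independent in \<open>S\<close> is independent in the ambient space, which
  bounds its size; a maximal one is then a finite basis.\<close>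

lemma fin_dim_subspace:
  assumes S: "subspace class_ring S (module_vec TYPE('k::field) m)"
  shows "vectorspace class_ring ((module_vec TYPE('k) m)\<lparr>carrier := S\<rparr>)"
    "vectorspace.fin_dim class_ring ((module_vec TYPE('k) m)\<lparr>carrier := S\<rparr>)"
proof -
  interpret V: vec_space "TYPE('k)" m .
  show vs: "vectorspace class_ring (V.vs S)" using V.subspace_is_vs[OF S] .
  interpret S: vectorspace class_ring "V.vs S" by (rule vs)
  have SV: "S \<subseteq> carrier_vec m" using S by (simp add: vec_subspace_iff)
  have sub: "submodule class_ring S V.V" using S by (simp add: subspace_def)
  have "finite T \<and> card T \<le> V.dim" if "T \<subseteq> S \<and> S.lin_indpt T" for T
  proof -
    have "V.lin_indpt T" using V.span_li_not_depend(2)[of T S] sub that by auto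
    then show ?thesis using V.li_le_dim[of T] that SV by auto
  qed
  moreover have "{} \<subseteq> S \<and> S.lin_indpt {}" by (auto simp: S.lin_dep_def)
  ultimately obtain T where T: "finite T" "maximal T (\<lambda>T. T \<subseteq> S \<and> S.lin_indpt T)"
    using maximal_exists[of "\<lambda>T. T \<subseteq> S \<and> S.lin_indpt T" V.dim "{}"] by blast
  then have "S.basis T" by (intro S.max_li_is_basis) simp
  then show "S.fin_dim" unfolding S.fin_dim_def S.basis_def using T(1) by auto
qed

lemma subdim_mono:
  assumes S: "subspace class_ring S (module_vec TYPE('k::field) m)"
    and T: "subspace class_ring T (module_vec TYPE('k) m)" and "S \<subseteq> T"
  shows "subdim m S \<le> subdim m T"
proof -
  interpret V: vec_space "TYPE('k)" m .
  interpret T: vectorspace class_ring "V.vs T" by (rule fin_dim_subspace(1)[OF T])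
  have "subspace class_ring S (V.vs T)" using V.nested_subspaces[OF T S] assms(3) by simp
  from T.subspace_dim[OF this fin_dim_subspace(2)[OF T]] fin_dim_subspace(2)[OF S]
  show ?thesis by (simp add: subdim_def)
qed

text \<open>Rank-nullity for the restriction of \<open>A\<close> to \<open>W\<close>, with
  \<open>W\<close> taken as a vector space in its own right.\<close>

lemma subdim_image_kernel:
  fixes A :: "'k::field mat"
  assumes A: "A \<in> carrier_mat a b" and W: "subspace class_ring W (module_vec TYPE('k) b)"
  shows "subdim a ((*\<^sub>v) A ` W) + subdim b {v \<in> W. A *\<^sub>v v = 0\<^sub>v a} = subdim b W"
proof -
  let ?V = "(module_vec TYPE('k) b)\<lparr>carrier := W\<rparr>"
  have WV: "W \<subseteq> carrier_vec b" using W by (simp add: vec_subspace_iff)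
  have vs: "vectorspace class_ring ?V" by (rule fin_dim_subspace(1)[OF W])
  have hom: "(*\<^sub>v) A \<in> LinearCombinations.module_hom class_ring ?V (module_vec TYPE('k) a)"
    using A WV by (auto simp: LinearCombinations.module_hom_def module_vec_simps class_ring_simps mult_mat_vec
      intro!: mult_add_distrib_mat_vec)
  interpret L: linear_map class_ring ?V "module_vec TYPE('k) a" "(*\<^sub>v) A"
  proof -
    have "vectorspace class_ring (module_vec TYPE('k) a)" by (rule vec_vs)
    then show "linear_map class_ring ?V (module_vec TYPE('k) a) ((*\<^sub>v) A)"
      using vs hom unfolding linear_map_def mod_hom_def mod_hom_axioms_def vectorspace_def by blast
  qed
  have "L.imT = (*\<^sub>v) A ` W" by (simp add: L.im_def)
  moreover have "L.kerT = {v \<in> W. A *\<^sub>v v = 0\<^sub>v a}" by (auto simp: L.ker_def module_vec_simps)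
  ultimately show ?thesis
    using L.rank_nullity[OF fin_dim_subspace(2)[OF W]] by (simp add: subdim_def)
qed

lemma image_space_mult:
  fixes A :: "'k::field mat"
  assumes "A \<in> carrier_mat a b" "B \<in> carrier_mat b c"
  shows "image_space (A * B) = (*\<^sub>v) A ` image_space B"
proof -
  have AB: "A * B \<in> carrier_mat a c" using assms by simp
  have "y \<in> image_space (A * B) \<longleftrightarrow> y \<in> (*\<^sub>v) A ` image_space B" for y
    unfolding image_space_iff[OF AB] image_iff Bex_def image_space_iff[OF assms(2)]
    using assoc_mult_mat_vec[OF assms] by metis
  then show ?thesis by blast
qed

lemma image_space_mult_subset:
  fixes A :: "'k::field mat"
  assumes "A \<in> carrier_mat a b" "B \<in> carrier_mat b c"
  shows "image_space (A * B) \<subseteq> image_space A"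
  unfolding image_space_mult[OF assms] using assms by (auto simp: image_space_def)

lemma rank_one: "vec_space.rank m (1\<^sub>m m :: 'k::field mat) = m"
proof -
  interpret V: vec_space "TYPE('k)" m .
  have "image_space (1\<^sub>m m :: 'k mat) = carrier_vec m"
    by (auto simp: image_space_def) (metis one_mult_mat_vec)
  then show ?thesis
    using V.dim_is_n by (simp add: rank_eq_subdim[OF one_carrier_mat] subdim_def module_vec_def)
qed

lemma rank_mult_le_left:
  fixes A :: "'k::field mat"
  assumes "A \<in> carrier_mat a b" "B \<in> carrier_mat b c"
  shows "vec_space.rank a (A * B) \<le> vec_space.rank a A"
proof -
  have AB: "A * B \<in> carrier_mat a c" using assms by simp
  show ?thesis
    unfolding rank_eq_subdim[OF assms(1)] rank_eq_subdim[OF AB]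
    by (rule subdim_mono[OF subspace_image_space[OF AB] subspace_image_space[OF assms(1)] image_space_mult_subset[OF assms]])
qed

text \<open>This turns rank inequalities into statements on kernels: a left factor cannot raise the
  rank because the kernel term is nonnegative, and Frobenius' inequality compares two such
  kernels.\<close>

lemma rank_mult_kernel:
  fixes A :: "'k::field mat"
  assumes "A \<in> carrier_mat a b" "B \<in> carrier_mat b c"
  shows "vec_space.rank a (A * B) + subdim b {v \<in> image_space B. A *\<^sub>v v = 0\<^sub>v a} = vec_space.rank b B"
  using subdim_image_kernel[OF assms(1) subspace_image_space[OF assms(2)]] assms
  by (simp add: rank_eq_subdim[of "A * B" a c] rank_eq_subdim[of B b c] image_space_mult[of A a b B c])

text \<open>Frobenius' inequality: the kernel of \<open>A\<close> on the image of \<open>B * C\<close> is contained in its kernel on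
  the image of \<open>B\<close>.\<close>

lemma rank_frobenius:
  fixes A :: "'k::field mat"
  assumes A: "A \<in> carrier_mat a b" and B: "B \<in> carrier_mat b c" and C: "C \<in> carrier_mat c e"
  shows "vec_space.rank a (A * B) + vec_space.rank b (B * C) \<le> vec_space.rank b B + vec_space.rank a (A * (B * C))"
proof -
  have BC: "B * C \<in> carrier_mat b e" using B C by simp
  let ?K = "\<lambda>B. {v \<in> image_space B. A *\<^sub>v v = 0\<^sub>v a}"
  have sub: "subspace class_ring (?K D) (module_vec TYPE('k) b)" if D: "D \<in> carrier_mat b f" for D f
    using subspace_image_space[OF D] A unfolding vec_subspace_iff
    by (auto simp: mult_add_distrib_mat_vec[OF A] mult_mat_vec[OF A] subset_iff)
  have "subdim b (?K (B * C)) \<le> subdim b (?K B)"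
    using image_space_mult_subset[OF B C] by (intro subdim_mono sub[OF B] sub[OF BC]) auto
  then show ?thesis using rank_mult_kernel[OF A B] rank_mult_kernel[OF A BC] by simp
qed

section \<open>Rank arrays of representations and their lace counts\<close>

lemma path_prod_carrier:
  assumes "\<phi> \<in> Hom n dims" "i \<le> j" "j \<le> n"
  shows "path_prod dims \<phi> i j \<in> carrier_mat (dims i) (dims j)"
  using assms(2)
proof (induction rule: inc_induct)
  case base
  show ?case by (simp add: path_prod_def)
next
  case (step k)
  have "\<phi> (Suc k) \<in> carrier_mat (dims k) (dims (Suc k))" using assms step by (force simp: Hom_def)
  moreover have "[k + 1..<j + 1] = Suc k # [Suc k + 1..<j + 1]" using step by (simp add: upt_conv_Cons)
  ultimately show ?case using step by (simp add: path_prod_def)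
qed

lemma path_prod_Cons: "i < j \<Longrightarrow> path_prod dims \<phi> i j = \<phi> (Suc i) * path_prod dims \<phi> (Suc i) j"
  by (simp add: path_prod_def upt_conv_Cons del: upt_Suc)

lemma path_prod_snoc:
  assumes "\<phi> \<in> Hom n dims" "i \<le> j" "Suc j \<le> n"
  shows "path_prod dims \<phi> i (Suc j) = path_prod dims \<phi> i j * \<phi> (Suc j)"
  using assms(2)
proof (induction rule: inc_induct)
  case base
  have "\<phi> (Suc j) \<in> carrier_mat (dims j) (dims (Suc j))" using assms by (force simp: Hom_def)
  then show ?case by (simp add: path_prod_def)
next
  case (step k)
  have 1: "\<phi> (Suc k) \<in> carrier_mat (dims k) (dims (Suc k))" "\<phi> (Suc j) \<in> carrier_mat (dims j) (dims (Suc j))"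
    using assms step by (force simp: Hom_def)+
  have 2: "path_prod dims \<phi> (Suc k) j \<in> carrier_mat (dims (Suc k)) (dims j)"
    using assms step by (intro path_prod_carrier) auto
  show ?case using step 1 2 by (simp add: path_prod_Cons[of k] assoc_mult_mat[OF 1(1) 2 1(2)])
qed

text \<open>\<open>rank_ext\<close> vanishes outside \<open>0..n\<close>, so the alternating sum has
  one term if \<open>i = 0\<close> and \<open>j = n\<close>, two if just one of these holds, and
  four otherwise. The two-term cases are monotonicity of the rank under products, the four-term case
  is Frobenius' inequality.\<close>

lemma can_occur_lace_count:
  assumes "can_occur TYPE('k::field) n r" "i \<le> j" "j \<le> n"
  shows "0 \<le> lace_count n r i j"
proof -
  define dims where "dims = (\<lambda>i. r i i)"
  obtain \<phi> :: "nat \<Rightarrow> 'k mat" where \<phi>: "\<phi> \<in> Hom n dims" "\<And>i j. i \<le> j \<Longrightarrow> j \<le> n \<Longrightarrow> r i j = rank_array dims \<phi> i j"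
    using assms(1) by (auto simp: can_occur_def dims_def)
  \<comment> \<open>Diagonal entries are ranks too, since the empty product is an identity
    matrix.\<close>
  have r: "r i j = vec_space.rank (dims i) (path_prod dims \<phi> i j)" if "i \<le> j" "j \<le> n" for i j
    using \<phi>(2)[OF that] that by (cases "i = j") (auto simp: rank_array_def path_prod_def rank_one)
  have C: "path_prod dims \<phi> i j \<in> carrier_mat (dims i) (dims j)" if "i \<le> j" "j \<le> n" for i j
    by (rule path_prod_carrier[OF \<phi>(1) that])
  have F: "\<phi> (Suc i) \<in> carrier_mat (dims i) (dims (Suc i))" if "Suc i \<le> n" for i
    using \<phi>(1) that by (force simp: Hom_def)
  have right: "r i (Suc j) \<le> r i j" if "i \<le> j" "Suc j \<le> n" for i j
    using that rank_mult_le_left[OF C F, of i j] by (simp add: r path_prod_snoc[OF \<phi>(1)])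
  have left: "r i j \<le> r (Suc i) j" if "Suc i \<le> j" "j \<le> n" for i j
    using that rank_mult_kernel[OF F C, of i j] by (simp add: r path_prod_Cons)
  have both: "r i j + r (Suc i) (Suc j) \<le> r (Suc i) j + r i (Suc j)" if "Suc i \<le> j" "Suc j \<le> n" for i j
    using that rank_frobenius[OF F C F, of i j]
    by (simp add: r path_prod_Cons[of i] path_prod_snoc[OF \<phi>(1), of "Suc i"])
  show ?thesis
  proof (cases i)
    case 0
    show ?thesis
    proof (cases "j = n")
      case False
      then have "j < n" using assms(3) by simp
      then show ?thesis using 0 right[of 0 j] assms
        by (simp add: lace_count_def rank_ext_def nat_add_distrib)
    qed (use 0 in \<open>simp add: lace_count_def rank_ext_def\<close>)
  next
    case (Suc i')
    show ?thesis
    proof (cases "j = n")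
      case True
      then show ?thesis using Suc left[of i' j] assms
        by (simp add: lace_count_def rank_ext_def nat_add_distrib)
    next
      case False
      then have "j < n" using assms(3) by simp
      then show ?thesis using Suc both[of i' j] assms
        by (simp add: lace_count_def rank_ext_def nat_add_distrib)
    qed
  qed
qed

section \<open>Knuth equivalence and column insertion\<close>

notation knuth_equiv (infix "\<sim>" 50)

lemma knuth_refl [simp]: "u \<sim> u"
  by (simp add: knuth_equiv_def)

lemma knuth_sym: "u \<sim> v \<Longrightarrow> v \<sim> u"
  by (simp add: knuth_equiv_def equivclp_sym)

lemma knuth_trans [trans]: "u \<sim> v \<Longrightarrow> v \<sim> w \<Longrightarrow> u \<sim> w"
  unfolding knuth_equiv_def by (rule equivclp_trans)

lemma knuth_invariant_rel:
  assumes "u \<sim> v" and "\<And>u v. knuth_step u v \<Longrightarrow> R u v" and "equivp R"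
  shows "R u v"
  using assms(1) unfolding knuth_equiv_def
proof (induction rule: equivclp_induct)
  case base
  show ?case using assms(3) by (rule equivp_reflp)
next
  case (step y z)
  then show ?case using assms(2,3) by (meson equivp_symp equivp_transp)
qed

lemma knuth_invariant:
  assumes "u \<sim> v" and "\<And>u v. knuth_step u v \<Longrightarrow> g u = g v"
  shows "g u = g v"
  by (rule knuth_invariant_rel[OF assms(1), where R = "\<lambda>u v. g u = g v"])
     (auto simp: assms(2) intro!: equivpI reflpI sympI transpI)

lemma knuth_step_cong: "knuth_step u v \<Longrightarrow> knuth_step (x @ u @ y) (x @ v @ y)"
proof (induction rule: knuth_step.induct)
  case (1 a b c us vs)
  then show ?case using knuth_step.intros(1)[of a b c "x @ us" "vs @ y"] by simp
next
  case (2 a b c us vs)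
  then show ?case using knuth_step.intros(2)[of a b c "x @ us" "vs @ y"] by simp
qed

lemma knuth_step_imp: "knuth_step u v \<Longrightarrow> u \<sim> v"
  by (simp add: knuth_equiv_def r_into_equivclp)

lemma knuth_cong1: "u \<sim> v \<Longrightarrow> x @ u @ y \<sim> x @ v @ y"
  by (rule knuth_invariant_rel[where R = "\<lambda>u v. x @ u @ y \<sim> x @ v @ y"])
     (auto intro: knuth_step_imp knuth_step_cong knuth_sym
        intro!: equivpI reflpI sympI transpI dest: knuth_trans)

lemma knuth_cong: "u \<sim> u' \<Longrightarrow> v \<sim> v' \<Longrightarrow> u @ v \<sim> u' @ v'"
  using knuth_cong1[of u u' "[]" v] knuth_cong1[of v v' u' "[]"] by (simp, blast dest: knuth_trans)

lemma knuth_cong_Cons: "u \<sim> v \<Longrightarrow> c # u \<sim> c # v"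
  using knuth_cong[of "[c]" "[c]" u v] by simp

lemma knuth1: "a \<le> b \<Longrightarrow> b < c \<Longrightarrow> a # c # b # vs \<sim> c # a # b # vs"
  using knuth_step.intros(1)[of a b c "[]" vs] by (simp add: knuth_step_imp)

lemma knuth2: "a < b \<Longrightarrow> b \<le> c \<Longrightarrow> b # a # c # vs \<sim> b # c # a # vs"
  using knuth_step.intros(2)[of a b c "[]" vs] by (simp add: knuth_step_imp)

lemma knuth_mset: "u \<sim> v \<Longrightarrow> mset u = mset v"
  by (rule knuth_invariant) (auto elim!: knuth_step.cases)

lemma knuth_set: "u \<sim> v \<Longrightarrow> set u = set v"
  by (drule knuth_mset, drule arg_cong[where f = set_mset]) simp

lemma knuth_Nil [simp]: "u \<sim> [] \<longleftrightarrow> u = []" "[] \<sim> u \<longleftrightarrow> u = []"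
  using knuth_mset by fastforce+

section \<open>Column insertion into a single column\<close>

fun ins :: "nat \<Rightarrow> nat list \<Rightarrow> nat list \<times> nat list" where
  "ins c [] = ([c], [])"
| "ins c (d # ds) = (if c \<le> d then (c # ds, [d]) else (case ins c ds of (e, b) \<Rightarrow> (d # e, b)))"

text \<open>Letters enter from the right end of the word, and each bumps a list of at most one
  letter. Letters bumped later are written further left; in this order the output stands to the
  right of the new column in a word equivalent to the original one
  (\<open>ins_word_knuth\<close>).\<close>

fun ins_word :: "nat list \<Rightarrow> nat list \<Rightarrow> nat list \<times> nat list" where
  "ins_word [] y = (y, [])"
| "ins_word (c # u) y = (case ins_word u y of (y1, b1) \<Rightarrow> case ins c y1 of (y2, b2) \<Rightarrow> (y2, b2 @ b1))"

lemma ins_word_append: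
  "ins_word (u @ v) y = (case ins_word v y of (y1, b1) \<Rightarrow> case ins_word u y1 of (y2, b2) \<Rightarrow> (y2, b2 @ b1))"
  by (induction u) (auto split: prod.splits)

lemma ins_props:
  assumes "sorted_wrt (<) y" "ins c y = (e, b)"
  shows "sorted_wrt (<) e" "set e \<subseteq> insert c (set y)" "c \<in> set e"
    "b = [] \<or> (\<exists>f. b = [f] \<and> f \<in> set y \<and> c \<le> f)"
proof -
  have "sorted_wrt (<) e \<and> set e \<subseteq> insert c (set y) \<and> c \<in> set e \<and>
    (b = [] \<or> (\<exists>f. b = [f] \<and> f \<in> set y \<and> c \<le> f))"
    using assms
  proof (induction y arbitrary: e b)
    case (Cons d ds)
    show ?case
    proof (cases "c \<le> d")
      case False
      then obtain e' where "ins c ds = (e', b)" "e = d # e'"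
        using Cons.prems by (auto split: prod.splits)
      then show ?thesis using Cons.IH[of e' b] Cons.prems False by auto
    qed (use Cons.prems in fastforce)
  qed auto
  then show "sorted_wrt (<) e" "set e \<subseteq> insert c (set y)" "c \<in> set e"
    "b = [] \<or> (\<exists>f. b = [f] \<and> f \<in> set y \<and> c \<le> f)" by auto
qed

text \<open>The first Knuth relation carries \<open>c\<close> past the letters of \<open>ds\<close>
  one at a time, the next smaller column entry serving as the middle value.\<close>

lemma ins_knuth_le:
  assumes "sorted_wrt (<) (d # ds)" "c \<le> d"
  shows "c # rev ds @ [d] \<sim> rev ds @ [c, d]"
  using assms
proof (induction ds rule: rev_induct)
  case (snoc e ds)
  obtain z zs where z: "rev ds @ [d] = z # zs" by (cases "rev ds @ [d]") auto
  have "z \<in> set (d # ds)" using z by (metis list.set_intros(1) set_rev rev.simps(2))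
  hence "c \<le> z" "z < e" using snoc.prems by (auto simp: sorted_wrt_append)
  hence "c # e # z # zs \<sim> e # c # z # zs" by (rule knuth1)
  also have "e # c # z # zs \<sim> e # (rev ds @ [c, d])"
    using snoc z by (intro knuth_cong_Cons) (auto simp: sorted_wrt_append)
  finally show ?case by (simp flip: z)
qed simp

lemma ins_knuth:
  assumes "sorted_wrt (<) y" "ins c y = (e, b)"
  shows "c # rev y \<sim> rev e @ b"
  using assms
proof (induction y arbitrary: e b)
  case (Cons d ds)
  show ?case
  proof (cases "c \<le> d")
    case True
    then show ?thesis using Cons.prems ins_knuth_le[of d ds c] by auto
  next
    case False
    then obtain e' where e': "ins c ds = (e', b)" "e = d # e'"
      using Cons.prems by (auto split: prod.splits)
    have srt: "sorted_wrt (<) ds" using Cons.prems by simp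
    have 1: "c # rev ds @ [d] \<sim> rev e' @ b @ [d]"
      using knuth_cong[OF Cons.IH[OF srt e'(1)], of "[d]" "[d]"] by simp
    note p = ins_props[OF srt e'(1)]
    obtain z zs where z: "e' = z # zs" using p(3) by (cases e') auto
    have "d < z" using p(2) z False Cons.prems(1) by auto
    moreover have "z \<le> c" using p(1,3) z by auto
    \<comment> \<open>A bumped letter is at least \<open>c\<close>, so with
      \<open>d < z \<le> c\<close> the second Knuth relation moves \<open>d\<close> in front of it;
      if nothing was bumped both words coincide.\<close>
    ultimately have "z # b @ [d] \<sim> z # d # b"
      using p(4) knuth2[of d z _ "[]", THEN knuth_sym] by auto
    hence "rev zs @ z # b @ [d] \<sim> rev zs @ z # d # b" by (rule knuth_cong[OF knuth_refl])
    hence "rev e' @ b @ [d] \<sim> rev e @ b" using z e'(2) by simp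
    from knuth_trans[OF 1 this] show ?thesis using e' by simp
  qed
qed simp

text \<open>The larger letter \<open>c\<close> enters strictly below the place taken by
  \<open>b\<close>, in a part of the column that \<open>b\<close> has not changed.\<close>

lemma ins_inc:
  assumes "sorted_wrt (<) y" "b < c" "ins b y = (e, B)" "ins c e = (g, C)"
  shows "(B = [] \<longrightarrow> C = []) \<and> (\<forall>f x. B = [f] \<longrightarrow> C = [x] \<longrightarrow> f < x)"
  using assms
proof (induction y arbitrary: e B g C)
  case (Cons d ds)
  show ?case
  proof (cases "b \<le> d")
    case True
    then have "e = b # ds" "B = [d]" using Cons.prems by auto
    moreover obtain g' where "ins c ds = (g', C)" using Cons.prems calculation by (auto split: prod.splits)
    ultimately show ?thesis using ins_props(4)[of ds c g' C] Cons.prems by auto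
  next
    case False
    then show ?thesis using Cons by (auto split: prod.splits if_splits)
  qed
qed auto

text \<open>When \<open>b\<close> enters, \<open>c\<close> already stands in the column, so
  \<open>b\<close> stops at \<open>c\<close> or above it. Thus it always bumps something, and
  nothing larger than \<open>c\<close>.\<close>

lemma ins_dec:
  assumes "sorted_wrt (<) y" "b \<le> c" "ins c y = (e, C)" "ins b e = (g, B)"
  shows "B \<noteq> [] \<and> (\<forall>f x. B = [f] \<longrightarrow> C = [x] \<longrightarrow> f \<le> x)"
  using assms
proof (induction y arbitrary: e B g C)
  case (Cons d ds)
  show ?case
  proof (cases "c \<le> d")
    case True
    then show ?thesis using Cons.prems by auto
  next
    case False
    then obtain e' where e': "ins c ds = (e', C)" "e = d # e'"
      using Cons.prems by (auto split: prod.splits)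
    show ?thesis
    proof (cases "b \<le> d")
      case True
      then show ?thesis using e' Cons.prems ins_props(4)[OF _ e'(1)] by auto
    next
      case False
      then obtain g' where "ins b e' = (g', B)" using e' Cons.prems by (auto split: prod.splits)
      then show ?thesis using Cons.IH[OF _ _ e'(1)] Cons.prems by auto
    qed
  qed
qed auto

text \<open>Induction down the column, split by which letters reach the top entry \<open>d\<close>.
  If \<open>d\<close> is smaller than all three, the tail decides; otherwise the bumped words differ
  by at most one use of the first Knuth relation, in which \<open>d\<close> takes part.\<close>

lemma ins_triple1:
  assumes "sorted_wrt (<) y" "a \<le> b" "b < c"
  shows "fst (ins_word [a, c, b] y) = fst (ins_word [c, a, b] y) \<and> snd (ins_word [a, c, b] y) \<sim> snd (ins_word [c, a, b] y)"
  using assms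
proof (induction y)
  case Nil
  then show ?case by auto
next
  case (Cons d ds)
  have srt: "sorted_wrt (<) ds" and dl: "\<And>x. x \<in> set ds \<Longrightarrow> d < x" using Cons.prems by auto
  obtain e1 b1 where e1: "ins b ds = (e1, b1)" by fastforce
  obtain e2 b2 where e2: "ins c e1 = (e2, b2)" by fastforce
  obtain e3 b3 where e3: "ins c ds = (e3, b3)" by fastforce
  note p1 = ins_props[OF srt e1]
  note p2 = ins_props[OF p1(1) e2]
  note p3 = ins_props[OF srt e3]
  consider "b \<le> d" | "a \<le> d" "d < b" | "d < a" by linarith
  then show ?case
  proof cases
    case 1
    have "a # ds = fst (ins a (b # ds))" using Cons.prems by simp
    have *: "b # b3 @ [d] \<sim> b3 @ b # [d]"
      using p3(4) knuth1[of b d _ "[]"] dl 1 by auto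
    show ?thesis using 1 Cons.prems e3 * by simp
  next
    case 2
    have *: "d # b2 @ b1 \<sim> b2 @ d # b1"
    proof (cases "b1 = []")
      case True
      then show ?thesis using ins_inc[OF srt Cons.prems(3) e1 e2] by simp
    next
      case False
      then obtain f where f: "b1 = [f]" "f \<in> set ds" "b \<le> f" using p1(4) by auto
      show ?thesis
      proof (cases "b2 = []")
        case nb: False
        then obtain x where x: "b2 = [x]" using p2(4) by auto
        have "f < x" using ins_inc[OF srt Cons.prems(3) e1 e2] f x by auto
        then show ?thesis using x f knuth1[of d f x "[]"] 2 by auto
      qed simp
    qed
    show ?thesis using 2 Cons.prems e1 e2 * by simp
  next
    case 3
    then show ?thesis using Cons.IH[OF srt Cons.prems(2,3)] Cons.prems e1 e2
      by (auto split: prod.splits)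
  qed
qed

text \<open>The same split. When all three letters compete for the top place, the bumped words are
  linked by the first Knuth relation instead of the second.\<close>

lemma ins_triple2:
  assumes "sorted_wrt (<) y" "a < b" "b \<le> c"
  shows "fst (ins_word [b, a, c] y) = fst (ins_word [b, c, a] y) \<and> snd (ins_word [b, a, c] y) \<sim> snd (ins_word [b, c, a] y)"
  using assms
proof (induction y)
  case Nil
  then show ?case by auto
next
  case (Cons d ds)
  have srt: "sorted_wrt (<) ds" and dl: "\<And>x. x \<in> set ds \<Longrightarrow> d < x" using Cons.prems by auto
  obtain e1 b1 where e1: "ins c ds = (e1, b1)" by fastforce
  obtain e2 b2 where e2: "ins b e1 = (e2, b2)" by fastforce
  note p1 = ins_props[OF srt e1]
  note p2 = ins_props[OF p1(1) e2]
  consider "c \<le> d" | "a \<le> d" "d < c" | "d < a" by linarith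
  then show ?case
  proof cases
    case 1
    show ?thesis
    proof (cases ds)
      case Nil
      then show ?thesis using 1 Cons.prems by simp
    next
      case (Cons x xs)
      hence "d < x" using dl by auto
      then show ?thesis using 1 Cons \<open>a < b\<close> \<open>b \<le> c\<close> knuth1[of c d x "[]"] by (auto intro: knuth_sym)
    qed
  next
    case 2
    obtain f where f: "b2 = [f]" using ins_dec[OF srt Cons.prems(3) e1 e2] p2(4) by auto
    have "f \<in> set e1" using p2(4) f by auto
    hence df: "d < f" using p1(2) dl 2 by auto
    have *: "f # d # b1 \<sim> f # b1 @ [d]"
    proof (cases "b1 = []")
      case False
      then obtain x where x: "b1 = [x]" using p1(4) by auto
      have "f \<le> x" using ins_dec[OF srt Cons.prems(3) e1 e2] f x by auto
      then show ?thesis using x df knuth2[of d f x "[]"] by auto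
    qed simp
    show ?thesis using 2 Cons.prems e1 e2 f * by simp
  next
    case 3
    then show ?thesis using Cons.IH[OF srt Cons.prems(2,3)] Cons.prems e1 e2
      by (auto split: prod.splits)
  qed
qed

lemma ins_word_sorted: "sorted_wrt (<) y \<Longrightarrow> ins_word u y = (e, b) \<Longrightarrow> sorted_wrt (<) e"
  by (induction u arbitrary: e b) (auto split: prod.splits dest: ins_props(1))

lemma ins_word_knuth: "sorted_wrt (<) y \<Longrightarrow> ins_word u y = (e, b) \<Longrightarrow> u @ rev y \<sim> rev e @ b"
proof (induction u arbitrary: e b)
  case (Cons c u)
  obtain y1 b1 where 1: "ins_word u y = (y1, b1)" by fastforce
  obtain y2 b2 where 2: "ins c y1 = (y2, b2)" by fastforce
  have "c # u @ rev y \<sim> c # rev y1 @ b1"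
    using Cons 1 by (intro knuth_cong_Cons) auto
  also have "c # rev y1 @ b1 = (c # rev y1) @ b1" by simp
  also have "(c # rev y1) @ b1 \<sim> (rev y2 @ b2) @ b1"
    by (intro knuth_cong ins_knuth[OF _ 2] ins_word_sorted[OF Cons.prems(1) 1]) auto
  finally have "c # u @ rev y \<sim> rev y2 @ b2 @ b1" by simp
  then show ?case using Cons.prems 1 2 by auto
qed auto

text \<open>The first column of the insertion tableau of \<open>u\<close> and a word for its other
  columns. The former is a Knuth invariant, the latter one up to \<open>\<sim>\<close>, so peeling
  can be followed on words without building the tableau.\<close>

definition first_col :: "nat list \<Rightarrow> nat list" where "first_col u = fst (ins_word u [])"
definition rest_word :: "nat list \<Rightarrow> nat list" where "rest_word u = snd (ins_word u [])"

lemma ins_word_Nil: "ins_word u [] = (first_col u, rest_word u)"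
  by (simp add: first_col_def rest_word_def)

lemma col_sorted: "sorted_wrt (<) (first_col u)"
  using ins_word_sorted[OF _ ins_word_Nil[of u]] by simp

lemma col_rest: "u \<sim> rev (first_col u) @ rest_word u"
  using ins_word_knuth[OF _ ins_word_Nil[of u]] by simp

lemma ins_word_prefix_cong:
  assumes "fst (ins_word u y) = fst (ins_word v y)" "snd (ins_word u y) \<sim> snd (ins_word v y)"
  shows "fst (ins_word (w @ u) y) = fst (ins_word (w @ v) y) \<and> snd (ins_word (w @ u) y) \<sim> snd (ins_word (w @ v) y)"
  using assms by (auto simp: ins_word_append split: prod.splits intro: knuth_cong)

lemma col_rest_step:
  assumes "knuth_step u v"
  shows "first_col u = first_col v \<and> rest_word u \<sim> rest_word v"
  using assms
proof cases
  case (1 a b c us vs)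
  have "fst (ins_word ([a, c, b] @ vs) []) = fst (ins_word ([c, a, b] @ vs) [])
    \<and> snd (ins_word ([a, c, b] @ vs) []) \<sim> snd (ins_word ([c, a, b] @ vs) [])"
    unfolding ins_word_append[of "[_, _, _]"] unfolding ins_word_Nil
    using ins_triple1[OF col_sorted[of vs] 1(3,4)] by (auto simp del: ins_word.simps split: prod.splits intro: knuth_cong)
  from ins_word_prefix_cong[OF conjunct1[OF this] conjunct2[OF this], of us]
  show ?thesis by (simp add: 1(1,2) first_col_def rest_word_def)
next
  case (2 a b c us vs)
  have "fst (ins_word ([b, a, c] @ vs) []) = fst (ins_word ([b, c, a] @ vs) [])
    \<and> snd (ins_word ([b, a, c] @ vs) []) \<sim> snd (ins_word ([b, c, a] @ vs) [])"
    unfolding ins_word_append[of "[_, _, _]"] unfolding ins_word_Nil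
    using ins_triple2[OF col_sorted[of vs] 2(3,4)] by (auto simp del: ins_word.simps split: prod.splits intro: knuth_cong)
  from ins_word_prefix_cong[OF conjunct1[OF this] conjunct2[OF this], of us]
  show ?thesis by (simp add: 2(1,2) first_col_def rest_word_def)
qed

lemma col_rest_cong:
  assumes "u \<sim> v"
  shows "first_col u = first_col v" "rest_word u \<sim> rest_word v"
proof -
  have "first_col u = first_col v \<and> rest_word u \<sim> rest_word v"
    by (rule knuth_invariant_rel[OF assms, where R = "\<lambda>u v. first_col u = first_col v \<and> rest_word u \<sim> rest_word v"])
       (auto simp: col_rest_step intro: knuth_sym dest: knuth_trans intro!: equivpI reflpI sympI transpI)
  then show "first_col u = first_col v" "rest_word u \<sim> rest_word v" by auto
qed

section \<open>Tableaux as lists of columns\<close>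

definition cword :: "nat list list \<Rightarrow> nat list" where "cword ys = concat (map rev ys)"

lemma cword_simps [simp]: "cword [] = []" "cword (y # ys) = rev y @ cword ys" "cword (xs @ ys) = cword xs @ cword ys"
  by (simp_all add: cword_def)

lemma set_cword: "set (cword ys) = (\<Union>y\<in>set ys. set y)"
  by (auto simp: cword_def)

fun col_le :: "nat list \<Rightarrow> nat list \<Rightarrow> bool" where
  "col_le x [] = True"
| "col_le [] (b # y) = False"
| "col_le (a # x) (b # y) = (a \<le> b \<and> col_le x y)"

lemma col_le_iff: "col_le x y \<longleftrightarrow> length y \<le> length x \<and> (\<forall>a<length y. x ! a \<le> y ! a)"
  by (induction x y rule: col_le.induct) (auto simp: less_Suc_eq_0_disj nth_Cons split: nat.splits)

text \<open>Entries are compared only in rows where both columns have one. Unlike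
  \<open>col_le\<close>, this allows the left column to be shorter, as happens when an initial
  segment \<open>C\<close> is inserted into a longer column.\<close>

fun overlap_le :: "nat list \<Rightarrow> nat list \<Rightarrow> bool" where
  "overlap_le (a # x) (b # y) = (a \<le> b \<and> overlap_le x y)"
| "overlap_le _ _ = True"

lemma col_le_overlap_le: "col_le x y \<Longrightarrow> overlap_le x y"
  by (induction x y rule: col_le.induct) auto

lemma col_le_length: "col_le x y \<Longrightarrow> length y \<le> length x"
  by (simp add: col_le_iff)

fun tabl :: "nat list list \<Rightarrow> bool" where
  "tabl [] = True"
| "tabl [x] = sorted_wrt (<) x"
| "tabl (x # y # ys) = (sorted_wrt (<) x \<and> col_le x y \<and> tabl (y # ys))"

lemma tabl_Cons: "tabl (x # ys) \<longleftrightarrow> sorted_wrt (<) x \<and> (ys \<noteq> [] \<longrightarrow> col_le x (hd ys)) \<and> tabl ys"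
  by (cases ys) auto

lemma tabl_appendD: "tabl (xs @ ys) \<Longrightarrow> tabl xs \<and> tabl ys"
  by (induction xs) (auto simp: tabl_Cons hd_append split: if_splits)

lemma tabl_sorted: "tabl ys \<Longrightarrow> y \<in> set ys \<Longrightarrow> sorted_wrt (<) y"
  by (induction ys) (auto simp: tabl_Cons)

text \<open>Lists of columns may end in empty columns. A tableau can thus be brought to a larger
  length, and uniqueness of the list is stated for a fixed length.\<close>

lemma tabl_pad: "tabl ys \<Longrightarrow> tabl (ys @ replicate k [])"
proof (induction ys)
  case Nil
  show ?case by (induction k) (auto simp: tabl_Cons hd_replicate)
next
  case (Cons y ys)
  then show ?case by (auto simp: tabl_Cons hd_append hd_replicate)
qed

lemma ins_word_skip:
  assumes "\<forall>z\<in>set u. \<forall>s\<in>set S. s < z"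
  shows "ins_word u (S @ y) = (S @ fst (ins_word u y), snd (ins_word u y))"
proof -
  have ins: "\<forall>s\<in>set S. s < z \<Longrightarrow> ins z (S @ w) = (S @ fst (ins z w), snd (ins z w))" for z w
    by (induction S) (auto split: prod.splits)
  show ?thesis using assms by (induction u) (auto simp: ins split: prod.splits)
qed

text \<open>The top letter of \<open>x\<close> enters first. As \<open>x\<close> is no larger than
  \<open>y\<close> in every common row, the letter of each row bumps exactly the entry of
  \<open>y\<close> in that row.\<close>

lemma ins_word_over:
  assumes "sorted_wrt (<) x" "sorted_wrt (<) y" "overlap_le x y"
  shows "ins_word (rev x) y = (x @ drop (length x) y, rev (take (length x) y))"
  using assms
proof (induction x arbitrary: y)
  case (Cons a x)
  have sk: "ins_word (rev x) ([a] @ w) = ([a] @ fst (ins_word (rev x) w), snd (ins_word (rev x) w))" for w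
    using Cons.prems by (intro ins_word_skip) auto
  show ?case
  proof (cases y)
    case Nil
    then show ?thesis using Cons sk[of "[]"] by (simp add: ins_word_append)
  next
    case (Cons b y')
    then show ?thesis using Cons.IH[of y'] Cons.prems sk[of y'] by (simp add: ins_word_append)
  qed
qed auto

text \<open>Columns are inserted from right to left, and each one pushes out its right neighbour as
  a whole because it is at least as long.\<close>

lemma tabl_ins_word:
  assumes "tabl ys"
  shows "ins_word (cword ys) [] = (if ys = [] then [] else hd ys, cword (tl ys))"
  using assms
proof (induction ys)
  case (Cons x ys)
  show ?case
  proof (cases ys)
    case Nil
    then show ?thesis using Cons ins_word_over[of x "[]"] by simp
  next
    case (Cons y zs)
    have "col_le x y" "sorted_wrt (<) x" "sorted_wrt (<) y" "tabl ys"
      using Cons.prems Cons tabl_sorted[of "x # ys" y] by auto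
    moreover have "ins_word (cword ys) [] = (y, cword zs)" using Cons.IH Cons.prems Cons by simp
    ultimately show ?thesis
      using ins_word_over[of x y] col_le_overlap_le col_le_length[of x y] Cons by (simp add: ins_word_append)
  qed
qed auto

lemma first_col_tabl: "tabl (x # ys) \<Longrightarrow> first_col (cword (x # ys)) = x"
  using tabl_ins_word[of "x # ys"] by (simp add: first_col_def)

lemma rest_word_tabl: "tabl (x # ys) \<Longrightarrow> rest_word (cword (x # ys)) = cword ys"
  using tabl_ins_word[of "x # ys"] by (simp add: rest_word_def)

text \<open>First column and remaining word are determined by the Knuth class, so the lists agree
  column by column.\<close>

lemma tabl_unique:
  assumes "tabl xs" "tabl ys" "length xs = length ys" "cword xs \<sim> cword ys"
  shows "xs = ys"
  using assms(3,1,2,4)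
proof (induction xs ys rule: list_induct2)
  case (Cons x xs y ys)
  from col_rest_cong[OF Cons.prems(3)] have "x = y" "cword xs \<sim> cword ys"
    using first_col_tabl rest_word_tabl Cons.prems by auto
  then show ?case using Cons by (auto simp: tabl_Cons)
qed auto

section \<open>Column insertion into a tableau\<close>

fun tableau_ins :: "nat \<Rightarrow> nat list list \<Rightarrow> nat list list" where
  "tableau_ins c [] = [[c]]"
| "tableau_ins c (x # ys) = (case ins c x of (x', b) \<Rightarrow> if b = [] then x' # ys else x' # tableau_ins (hd b) ys)"

lemma ins_col_le_left: "col_le x y \<Longrightarrow> ins c x = (x', b) \<Longrightarrow> col_le x' y"
proof (induction x y arbitrary: x' b rule: col_le.induct)
  case (3 a x d y)
  then show ?case by (auto split: if_splits prod.splits)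
qed auto

text \<open>If \<open>d\<close> leaves row \<open>k\<close> of \<open>x\<close>, then
  \<open>y\<close> has no smaller letter in row \<open>k\<close>. Hence \<open>d\<close> enters
  \<open>y\<close> in row \<open>k\<close> or higher, where the new left column has entries at most
  \<open>d\<close>.\<close>

lemma ins_col_le_bump:
  assumes "col_le x y" "sorted_wrt (<) x" "sorted_wrt (<) y" "ins c x = (x', [d])" "ins d y = (y', b)"
  shows "col_le x' y'"
  using assms
proof (induction x y arbitrary: x' y' rule: col_le.induct)
  case (1 x)
  then show ?case using ins_props(4)[of x c x' "[d]"] by (cases x) (auto split: if_splits prod.splits)
next
  case (3 a x e y)
  show ?case
  proof (cases "c \<le> a")
    case True
    then show ?thesis using 3 by auto
  next
    case False
    then obtain x'' where x'': "ins c x = (x'', [d])" "x' = a # x''"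
      using 3 by (auto split: prod.splits)
    have ad: "a < d" using ins_props(4)[OF _ x''(1)] 3 by auto
    show ?thesis
    proof (cases "d \<le> e")
      case True
      then show ?thesis using 3 x'' ad ins_col_le_left[OF _ x''(1)] by auto
    next
      case False
      then obtain y'' where "ins d y = (y'', b)" "y' = e # y''" using 3 by (auto split: prod.splits)
      then show ?thesis using 3 x'' by auto
    qed
  qed
qed auto

lemma tableau_ins_props:
  assumes "tabl ys"
  shows "tabl (tableau_ins c ys) \<and> c # cword ys \<sim> cword (tableau_ins c ys) \<and>
    hd (tableau_ins c ys) = fst (ins c (if ys = [] then [] else hd ys)) \<and> tableau_ins c ys \<noteq> []"
  using assms
proof (induction ys arbitrary: c)
  case (Cons x ys)
  obtain x' b where b: "ins c x = (x', b)" by fastforce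
  have srt: "sorted_wrt (<) x" using Cons.prems by (simp add: tabl_Cons)
  note p = ins_props[OF srt b] ins_knuth[OF srt b]
  have k: "c # cword (x # ys) \<sim> rev x' @ b @ cword ys"
    using knuth_cong[OF p(5), of "cword ys" "cword ys"] by simp
  show ?case
  proof (cases "b = []")
    case True
    then show ?thesis using Cons.prems p k b ins_col_le_left[OF _ b]
      by (auto simp: tabl_Cons)
  next
    case False
    then obtain d where d: "b = [d]" using p(4) by auto
    note IH = Cons.IH[of d]
    obtain y' b' where y': "ins d (if ys = [] then [] else hd ys) = (y', b')" by fastforce
    have "col_le x' y'"
      using ins_col_le_bump[of x "if ys = [] then [] else hd ys" c x' d y' b'] b d y' Cons.prems srt
      by (cases ys) (auto simp: tabl_Cons)
    moreover have "tabl (tableau_ins d ys)" "d # cword ys \<sim> cword (tableau_ins d ys)" "hd (tableau_ins d ys) = y'"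
      using IH Cons.prems y' by (auto simp: tabl_Cons)
    moreover have "c # cword (x # ys) \<sim> rev x' @ cword (tableau_ins d ys)"
      using k d calculation(3) knuth_cong[OF knuth_refl, of "d # cword ys" "cword (tableau_ins d ys)" "rev x'"]
        knuth_trans by auto
    ultimately show ?thesis using b d p(1) by (auto simp: tabl_Cons)
  qed
qed auto

lemma tabl_exists: "\<exists>ys. tabl ys \<and> u \<sim> cword ys"
proof (induction u)
  case Nil
  have "tabl [] \<and> [] \<sim> cword []" by simp
  then show ?case by blast
next
  case (Cons c u)
  then obtain ys where "tabl ys" "u \<sim> cword ys" by blast
  then show ?case using tableau_ins_props[of ys c] knuth_cong_Cons knuth_trans by blast
qed

section \<open>Peeling one column on the level of Knuth classes\<close>

definition init_seg :: "nat list \<Rightarrow> nat set \<Rightarrow> bool" where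
  "init_seg C A \<longleftrightarrow> (\<forall>z\<in>A. \<forall>c\<in>set C. z < c \<longrightarrow> z \<in> set C)"

lemma init_seg_mono: "init_seg C A \<Longrightarrow> B \<subseteq> A \<Longrightarrow> init_seg C B"
  by (auto simp: init_seg_def)

lemma init_seg_prefix: "init_seg (C @ D) A \<Longrightarrow> sorted_wrt (<) (C @ D) \<Longrightarrow> init_seg C A"
  unfolding init_seg_def sorted_wrt_append by (fastforce dest: order.strict_trans)

text \<open>One round of \<open>peelable\<close> for words: the first column of the insertion
  tableau of \<open>X\<close> has \<open>C\<close> at its top, and removing it leaves a skew tableau
  whose reading word is equivalent to \<open>Y\<close>.\<close>

definition step :: "nat list \<Rightarrow> nat list \<Rightarrow> nat list \<Rightarrow> bool" where
  "step C X Y \<longleftrightarrow> (\<exists>x. first_col X = C @ x \<and> Y \<sim> rev x @ rest_word X)"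

lemma step_cong:
  assumes "step C X Y" "X \<sim> X'" "Y \<sim> Y'"
  shows "step C X' Y'"
proof -
  from assms(1) obtain x where x: "first_col X = C @ x" "Y \<sim> rev x @ rest_word X"
    by (auto simp: step_def)
  have "Y' \<sim> rev x @ rest_word X'"
    using knuth_trans[OF knuth_sym[OF assms(3)] knuth_trans[OF x(2) knuth_cong[OF knuth_refl col_rest_cong(2)[OF assms(2)]]]] .
  then show ?thesis using x(1) col_rest_cong(1)[OF assms(2)] by (auto simp: step_def)
qed

lemma step_unique: "step C X Y \<Longrightarrow> step C X Y' \<Longrightarrow> Y \<sim> Y'"
  unfolding step_def using knuth_sym knuth_trans by (metis append_eq_append_conv)

lemma canonical: "\<exists>ys. tabl (first_col u # ys) \<and> rest_word u \<sim> cword ys"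
proof -
  obtain ys where ys: "tabl ys" "u \<sim> cword ys" using tabl_exists by blast
  \<comment> \<open>The extra empty column provides a first column even if \<open>u\<close> is
    empty.\<close>
  define zs where "zs = ys @ [[]]"
  have zs: "tabl zs" "u \<sim> cword zs" "zs \<noteq> []"
    using tabl_pad[OF ys(1), of 1] ys(2) by (auto simp: zs_def)
  then obtain z ws where "zs = z # ws" by (cases zs) auto
  with zs col_rest_cong[OF zs(2)] first_col_tabl rest_word_tabl show ?thesis by auto
qed

lemma step_decomp:
  assumes "step C X Y"
  obtains x ys where "tabl ((C @ x) # ys)" "X \<sim> rev x @ rev C @ cword ys" "Y \<sim> rev x @ cword ys"
proof -
  from assms obtain x where x: "first_col X = C @ x" "Y \<sim> rev x @ rest_word X"
    by (auto simp: step_def)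
  obtain ys where ys: "tabl (first_col X # ys)" "rest_word X \<sim> cword ys" using canonical by blast
  show ?thesis
  proof
    show "tabl ((C @ x) # ys)" using x ys by simp
    show "X \<sim> rev x @ rev C @ cword ys"
      using knuth_trans[OF col_rest[of X] knuth_cong[OF knuth_refl ys(2)]] x(1) by simp
    show "Y \<sim> rev x @ cword ys"
      using knuth_trans[OF x(2) knuth_cong[OF knuth_refl ys(2)]] .
  qed
qed

lemma step_Nil: "step [] X Y \<longleftrightarrow> X \<sim> Y"
  using col_rest[of X] knuth_sym knuth_trans unfolding step_def append_Nil by metis

text \<open>A head of \<open>y\<close> below the head of \<open>C\<close> would have to belong to
  \<open>C\<close>, against minimality of the head. Entries of \<open>C\<close> need not occur in
  \<open>y\<close>.\<close>

lemma init_seg_overlap_le: "sorted_wrt (<) C \<Longrightarrow> sorted_wrt (<) y \<Longrightarrow> init_seg C (set y) \<Longrightarrow> overlap_le C y"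
proof (induction C y rule: overlap_le.induct)
  case (1 a x b y)
  have ax: "\<forall>z\<in>set x. a < z" and "\<forall>z\<in>set y. b < z" using 1(2,3) by auto
  have i: "z \<in> set (a # x)" if "z \<in> set (b # y)" "c \<in> set (a # x)" "z < c" for z c
    using 1(4) that unfolding init_seg_def by blast
  have "a \<le> b"
  proof (rule ccontr)
    assume "\<not> a \<le> b"
    then show False using i[of b a] ax by auto
  qed
  moreover have "init_seg x (set y)"
    unfolding init_seg_def
  proof (intro ballI impI)
    fix z c assume "z \<in> set y" "c \<in> set x" "z < c"
    moreover from this have "a < z" using \<open>a \<le> b\<close> \<open>\<forall>z\<in>set y. b < z\<close> by auto
    ultimately show "z \<in> set x" using i[of z c] by auto
  qed
  ultimately show ?case using 1 by auto
qed auto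

text \<open>The insertion is followed through \<open>p\<close>, \<open>C\<close> and
  \<open>q\<close>: \<open>C\<close> displaces the top entries of the first column of
  \<open>p\<close>, and \<open>q\<close>, being larger, passes below \<open>C\<close>. Without
  \<open>C\<close>, what results is what \<open>q @ p\<close> gives as well.\<close>

lemma step_intro:
  assumes "sorted_wrt (<) C" "init_seg C (set p)" "\<forall>z\<in>set q. \<forall>c\<in>set C. c < z" "X \<sim> q @ rev C @ p"
  shows "step C X (q @ p)"
proof -
  obtain y b where y: "ins_word p [] = (y, b)" by fastforce
  have srt: "sorted_wrt (<) y" using ins_word_sorted[OF _ y] by simp
  have pyb: "p \<sim> rev y @ b" using ins_word_knuth[OF _ y] by simp
  have sety: "set y \<subseteq> set p" using knuth_set[OF pyb] by auto
  let ?h = "length C"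
  have C: "ins_word (rev C) y = (C @ drop ?h y, rev (take ?h y))"
    using ins_word_over[OF assms(1) srt init_seg_overlap_le[OF assms(1) srt]] init_seg_mono[OF assms(2) sety] by blast
  obtain e s where e: "ins_word q (drop ?h y) = (e, s)" by fastforce
  have q: "ins_word q (C @ drop ?h y) = (C @ e, s)"
    using ins_word_skip[of q C "drop ?h y"] assms(3) e by auto
  have "ins_word (q @ rev C @ p) [] = (C @ e, s @ rev (take ?h y) @ b)"
    using y C q by (simp add: ins_word_append)
  hence fc: "first_col (q @ rev C @ p) = C @ e" "rest_word (q @ rev C @ p) = s @ rev (take ?h y) @ b"
    by (auto simp: first_col_def rest_word_def)
  have "q @ rev (drop ?h y) \<sim> rev e @ s" using ins_word_knuth[OF _ e] sorted_wrt_drop[OF srt] by blast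
  from knuth_cong[OF this knuth_refl, of "rev (take ?h y) @ b"]
  have "q @ rev y @ b \<sim> rev e @ s @ rev (take ?h y) @ b"
    by (simp flip: rev_append) (metis append_take_drop_id append.assoc rev_append)
  with knuth_cong[OF knuth_refl pyb, of q] have "q @ p \<sim> rev e @ s @ rev (take ?h y) @ b"
    using knuth_trans by blast
  hence "step C (q @ rev C @ p) (q @ p)" using fc by (auto simp: step_def)
  then show ?thesis using step_cong[OF _ knuth_sym[OF assms(4)] knuth_refl] by blast
qed

lemma ins_keep_prefix:
  assumes "sorted_wrt (<) (C @ x)" "z \<in> set C \<or> (\<forall>c\<in>set C. c < z)"
  shows "\<exists>x'. fst (ins z (C @ x)) = C @ x'"
  using assms
proof (induction C)
  case (Cons c C)
  show ?case
  proof (cases "z \<le> c")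
    case True
    moreover have "z = c \<or> c < z" using Cons.prems by auto
    ultimately have "z = c" by linarith
    then show ?thesis by auto
  next
    case False
    then show ?thesis using Cons by (auto split: prod.splits)
  qed
qed auto

text \<open>Every letter of \<open>u\<close> lies in \<open>C\<close> or above all of
  \<open>C\<close>, so entries of \<open>C\<close> that have reached the top are never displaced.
  With its converse below, this makes the start of the first column a property of
  subsequences.\<close>

lemma subseq_first_col:
  assumes "sorted_wrt (<) C" "init_seg C (set u)" "subseq (rev C) u"
  shows "\<exists>x. first_col u = C @ x"
  using assms
proof (induction u arbitrary: C)
  case Nil
  then have "rev C = []" by (blast dest: list_emb_Nil2)
  then show ?case by simp
next
  case (Cons z u)
  have fc: "first_col (z # u) = fst (ins z (first_col u))"
    by (simp add: first_col_def split: prod.splits)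
  have set: "set (first_col u) \<subseteq> set u" using knuth_set[OF col_rest[of u]] by auto
  have iu: "init_seg C (set u)" using Cons.prems(2) by (rule init_seg_mono) auto
  show ?case
  proof (cases "subseq (rev C) u")
    case True
    then obtain x where x: "first_col u = C @ x" using Cons.IH Cons.prems(1) iu by blast
    have "z \<in> set C \<or> (\<forall>c\<in>set C. c < z)" using Cons.prems(2)
      unfolding init_seg_def by (metis list.set_intros(1) linorder_less_linear)
    with ins_keep_prefix[of C x z] x fc col_sorted[of u] show ?thesis by simp
  next
    case False
    then obtain C' where C: "C = C' @ [z]" and s: "subseq (rev C') u"
      using Cons.prems(3) by (cases C rule: rev_cases) (auto elim: list_emb.cases split: if_splits)
    have "sorted_wrt (<) C'" using Cons.prems(1) C by (simp add: sorted_wrt_append)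
    moreover have "init_seg C' (set u)" using init_seg_prefix[of C' "[z]"] iu Cons.prems(1) C by simp
    ultimately obtain x where x: "first_col u = C' @ x" using Cons.IH s by blast
    have lt: "\<forall>c\<in>set C'. c < z" using Cons.prems(1) C by (simp add: sorted_wrt_append)
    \<comment> \<open>A letter of the column below \<open>C'\<close> that is smaller than
      \<open>z\<close> would lie in \<open>C'\<close> already; so \<open>z\<close> settles directly
      under \<open>C'\<close>.\<close>
    have *: "\<not> w < z" if "w \<in> set x" for w
    proof
      assume "w < z"
      moreover have "w \<in> set u" using that x set by auto
      ultimately have "w \<in> set C" using iu C by (auto simp: init_seg_def)
      hence "w \<in> set C'" using C \<open>w < z\<close> by auto
      then show False using that col_sorted[of u] x by (auto simp: sorted_wrt_append)
    qed
    have "\<exists>x'. fst (ins z x) = z # x'" using * by (cases x) (auto simp: not_less)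
    moreover have "fst (ins z (C' @ x)) = C' @ fst (ins z x)"
      using lt by (induction C') (auto split: prod.splits)
    ultimately show ?thesis using fc x C by auto
  qed
qed

lemma ins_prefix_cases:
  assumes "sorted_wrt (<) f" "fst (ins z f) = C @ x" "init_seg C (set f)"
  shows "(\<exists>x'. f = C @ x') \<or> (\<exists>C' x'. C = C' @ [z] \<and> f = C' @ x')"
  using assms
proof (induction f arbitrary: C)
  case Nil
  then show ?case by (cases C) auto
next
  case (Cons d ds)
  show ?case
  proof (cases C)
    case (Cons c C')
    show ?thesis
    proof (cases "z \<le> d")
      case True
      hence eq: "c = z" "ds = C' @ x" using Cons.prems Cons by auto
      show ?thesis
      proof (cases "z = d \<or> C' = []")
        case True
        then show ?thesis using eq Cons by auto
      next
        case False
        then obtain e where e: "e \<in> set C'" by (cases C') auto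
        have "d < e" using e eq Cons.prems(1) by auto
        hence "d \<in> set C" using Cons.prems(3) e Cons by (auto simp: init_seg_def)
        hence "d \<in> set C'" using Cons eq False by auto
        then show ?thesis using Cons.prems(1) eq by auto
      qed
    next
      case False
      hence eq: "c = d" "fst (ins z ds) = C' @ x" using Cons.prems Cons by (auto split: prod.splits)
      have "init_seg C' (set ds)"
        unfolding init_seg_def
      proof (intro ballI impI)
        fix w e assume w: "w \<in> set ds" "e \<in> set C'" "w < e"
        hence "w \<in> set C" using Cons.prems(3) Cons unfolding init_seg_def by auto
        then show "w \<in> set C'" using w(1) Cons.prems(1) Cons eq by auto
      qed
      from Cons.IH[OF _ eq(2) this] Cons.prems(1) show ?thesis using Cons eq
        by (auto simp: Cons_eq_append_conv)
    qed
  qed auto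
qed

text \<open>The insertions are undone one by one: the last letter inserted either found
  \<open>C\<close> on top or completed it as its last entry.\<close>

lemma first_col_subseq:
  assumes "first_col u = C @ x" "init_seg C (set u)"
  shows "subseq (rev C) u"
  using assms
proof (induction u arbitrary: C x)
  case Nil
  then show ?case by (simp add: first_col_def)
next
  case (Cons z u)
  have fc: "fst (ins z (first_col u)) = C @ x"
    using Cons.prems by (simp add: first_col_def split: prod.splits)
  have set: "set (first_col u) \<subseteq> set u" using knuth_set[OF col_rest[of u]] by auto
  have srt: "sorted_wrt (<) C" using col_sorted[of "z # u"] Cons.prems by (simp add: sorted_wrt_append)
  have iu: "init_seg C (set u)" using Cons.prems(2) by (rule init_seg_mono) auto
  from ins_prefix_cases[OF col_sorted fc init_seg_mono[OF iu set]] show ?case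
  proof (elim disjE exE conjE)
    fix x' assume "first_col u = C @ x'"
    then show ?thesis using Cons.IH iu by auto
  next
    fix C' x' assume C: "C = C' @ [z]" and "first_col u = C' @ x'"
    then show ?thesis using Cons.IH[of C' x'] init_seg_prefix[of C' "[z]"] iu srt by auto
  qed
qed

fun peels :: "nat list list \<Rightarrow> nat list \<Rightarrow> nat list \<Rightarrow> bool" where
  "peels [] X Y \<longleftrightarrow> X \<sim> Y"
| "peels (C # Cs) X Y \<longleftrightarrow> (\<exists>X'. step C X X' \<and> peels Cs X' Y)"

lemma peels_cong: "peels Cs X Y \<Longrightarrow> X \<sim> X' \<Longrightarrow> Y \<sim> Y' \<Longrightarrow> peels Cs X' Y'"
proof (induction Cs arbitrary: X X')
  case Nil
  then show ?case using knuth_sym knuth_trans by (meson peels.simps(1))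
next
  case (Cons C Cs)
  then show ?case using step_cong by (meson knuth_refl peels.simps(2))
qed

lemma peels_append: "peels (As @ Bs) X Y \<longleftrightarrow> (\<exists>Z. peels As X Z \<and> peels Bs Z Y)"
proof (induction As arbitrary: X)
  case Nil
  show ?case using peels_cong[of Bs _ Y X Y] knuth_refl knuth_sym unfolding append_Nil peels.simps by blast
qed auto

lemma peels_replicate_Nil: "peels (replicate k []) X Y \<longleftrightarrow> X \<sim> Y"
proof (induction k arbitrary: X)
  case (Suc k)
  have "(\<exists>X'. X \<sim> X' \<and> X' \<sim> Y) \<longleftrightarrow> X \<sim> Y" using knuth_trans knuth_refl by blast
  then show ?case using Suc by (simp add: step_Nil)
qed auto

lemma step_mset: "step C X Y \<Longrightarrow> mset X = mset C + mset Y"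
  by (elim step_decomp) (auto dest!: knuth_mset simp: ac_simps)

lemma peels_mset: "peels Cs X Y \<Longrightarrow> mset X = mset (concat Cs) + mset Y"
  by (induction Cs arbitrary: X) (auto dest!: step_mset knuth_mset)

lemma peels_set: "peels Cs X Y \<Longrightarrow> set X = set (concat Cs) \<union> set Y"
  using peels_mset by (metis set_append set_mset_mset set_mset_union)

section \<open>Peeling nested columns\<close>

text \<open>Inserting \<open>x\<close> into the column \<open>S @ y\<close> keeps \<open>S\<close>
  on top and pushes out exactly \<open>y\<close>. So \<open>S\<close> moves to the left across one
  column at a time, stopping behind the first.\<close>

lemma tabl_slide:
  assumes "tabl (x # ys)" "sorted_wrt (<) S" "\<forall>s\<in>set S. \<forall>z\<in>set (cword (x # ys)). s < z"
  shows "rev x @ cword ys @ rev S \<sim> rev x @ rev S @ cword ys"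
  using assms
proof (induction ys arbitrary: x)
  case (Cons y ys)
  have srt: "sorted_wrt (<) x" "sorted_wrt (<) y" "col_le x y" "tabl (y # ys)"
    using Cons.prems tabl_sorted[of "x # y # ys"] by auto
  have "ins_word (rev x) (S @ y) = (S @ x, rev y)"
    using ins_word_skip[of "rev x" S y] ins_word_over[OF srt(1,2) col_le_overlap_le] srt(3) col_le_length[of x y] Cons.prems(3)
    by auto
  moreover have "sorted_wrt (<) (S @ y)" using Cons.prems srt by (auto simp: sorted_wrt_append)
  ultimately have "rev x @ rev (S @ y) \<sim> rev (S @ x) @ rev y" using ins_word_knuth by blast
  from knuth_cong[OF this knuth_refl, of "cword ys"]
  have 1: "rev x @ rev y @ rev S @ cword ys \<sim> rev x @ rev S @ rev y @ cword ys" by simp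
  have "rev y @ cword ys @ rev S \<sim> rev y @ rev S @ cword ys"
    using Cons.IH[of y] Cons.prems srt by auto
  from knuth_trans[OF knuth_cong[OF knuth_refl this, of "rev x"]] 1
  show ?case by simp
qed simp

lemma set_subseq: "subseq t u \<Longrightarrow> set t \<subseteq> set u"
  by (induction rule: list_emb.induct) auto

text \<open>One copy of \<open>S\<close> slides left until it stands directly behind
  \<open>c\<close>; then \<open>S @ c\<close> can be peeled, and the remaining word has the same
  form with one copy fewer.\<close>

lemma peels_extend:
  assumes "peels cs X Y" "\<forall>c\<in>set cs. sorted_wrt (<) (S @ c) \<and> init_seg (S @ c) (set S \<union> set X \<union> set P)"
    and "\<forall>s\<in>set S. \<forall>z\<in>set X. s < z"
  shows "peels (map ((@) S) cs) (X @ concat (replicate (length cs) (rev S)) @ P) (Y @ P)"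
  using assms
proof (induction cs arbitrary: X)
  case Nil
  then show ?case using knuth_cong[of X Y P P] by simp
next
  case (Cons c cs)
  then obtain X' where X': "step c X X'" "peels cs X' Y" by auto
  obtain x ys where d: "tabl ((c @ x) # ys)" "X \<sim> rev x @ rev c @ cword ys" "X' \<sim> rev x @ cword ys"
    using step_decomp[OF X'(1)] by blast
  define Z where "Z = concat (replicate (length cs) (rev S)) @ P"
  have setX: "set X = set x \<union> set c \<union> set (cword ys)" using knuth_set[OF d(2)] by auto
  have setX': "set X' = set x \<union> set (cword ys)" using knuth_set[OF d(3)] by auto
  have Sc: "sorted_wrt (<) (S @ c)" "init_seg (S @ c) (set S \<union> set X \<union> set P)" using Cons.prems by auto
  have setZ: "set Z \<subseteq> set S \<union> set P" by (auto simp: Z_def)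
  have "rev (c @ x) @ cword ys @ rev S \<sim> rev (c @ x) @ rev S @ cword ys"
    using tabl_slide[OF d(1), of S] Sc(1) Cons.prems(3) setX by (auto simp: sorted_wrt_append)
  with knuth_cong[OF d(2) knuth_refl, of "rev S"]
  have "X @ rev S \<sim> rev x @ rev (S @ c) @ cword ys" by (simp, meson knuth_trans)
  from knuth_cong[OF this knuth_refl, of Z]
  have XZ: "X @ rev S @ Z \<sim> rev x @ rev (S @ c) @ (cword ys @ Z)" by simp
  have "step (S @ c) (X @ rev S @ Z) (rev x @ (cword ys @ Z))"
  proof (rule step_intro[OF Sc(1) _ _ XZ])
    show "init_seg (S @ c) (set (cword ys @ Z))"
      using setX setZ by (intro init_seg_mono[OF Sc(2)]) auto
    show "\<forall>z\<in>set (rev x). \<forall>s\<in>set (S @ c). s < z"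
      using Cons.prems(3) setX tabl_sorted[OF d(1), of "c @ x"] by (auto simp: sorted_wrt_append)
  qed
  moreover have "(rev x @ cword ys) @ Z \<sim> X' @ Z" using d(3) by (intro knuth_cong knuth_sym[OF d(3)]) auto
  ultimately have "step (S @ c) (X @ rev S @ Z) (X' @ Z)" using step_cong[OF _ knuth_refl] by simp
  moreover have "peels (map ((@) S) cs) (X' @ Z) (Y @ P)"
    unfolding Z_def
  proof (rule Cons.IH[OF X'(2)])
    show "\<forall>c\<in>set cs. sorted_wrt (<) (S @ c) \<and> init_seg (S @ c) (set S \<union> set X' \<union> set P)"
      using Cons.prems(2) setX setX' by (auto intro: init_seg_mono)
    show "\<forall>s\<in>set S. \<forall>z\<in>set X'. s < z" using Cons.prems(3) setX setX' by auto
  qed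
  ultimately show ?case by (auto simp: Z_def)
qed

text \<open>Converse of \<open>peels_extend\<close>, for a word given by a tableau. The letters of
  \<open>S\<close> cannot be taken from \<open>y\<close>, so they already form a subsequence of the
  tableau word and the first column of \<open>V\<close> must begin with \<open>S\<close>. The word
  \<open>y\<close> is carried along because each step leaves letters in front of the remaining
  columns.\<close>

lemma peels_restrict:
  assumes "peels (map ((@) S) cs) (y @ cword (V @ R)) Y" "length V = length cs" "tabl (V @ R)"
    and "\<forall>s\<in>set S. \<forall>z\<in>set y. s < z"
    and "\<forall>c\<in>set cs. sorted_wrt (<) (S @ c) \<and> init_seg (S @ c) (set y \<union> set (cword (V @ R)))"
  shows "\<exists>Q Z. V = map ((@) S) Q \<and> peels cs (y @ cword Q) Z \<and> Y \<sim> Z @ cword R"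
  using assms
proof (induction cs arbitrary: y V)
  case Nil
  then show ?case using knuth_sym by (auto intro!: exI[of _ y])
next
  case (Cons c cs)
  obtain v V' where V: "V = v # V'" using Cons.prems(2) by (cases V) auto
  obtain X' where X': "step (S @ c) (y @ cword (V @ R)) X'" "peels (map ((@) S) cs) X' Y"
    using Cons.prems(1) by auto
  have Sc: "sorted_wrt (<) (S @ c)" "init_seg (S @ c) (set y \<union> set (cword (V @ R)))" using Cons.prems by auto
  have srtv: "sorted_wrt (<) v" using tabl_sorted[OF Cons.prems(3), of v] V by auto
  have "subseq (rev (S @ c)) (y @ cword (V @ R))"
    using X'(1) Sc(2) first_col_subseq[of "y @ cword (V @ R)" "S @ c"] unfolding step_def by auto
  then obtain u1 u2 where u: "rev c @ rev S = u1 @ u2" "subseq u1 y" "subseq u2 (cword (V @ R))"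
    by (auto elim: subseq_appendE)
  have u1: "set u1 \<subseteq> set y" using u(2) by (rule set_subseq)
  \<comment> \<open>The cut between the two parts of the subsequence falls inside
    \<open>rev c\<close>, since \<open>y\<close> has only letters larger than those of
    \<open>S\<close>.\<close>
  obtain c2 where c2: "rev c = u1 @ c2" "u2 = c2 @ rev S"
  proof -
    from u(1) consider us where "rev c @ us = u1" "rev S = us @ u2" | us where "rev c = u1 @ us" "us @ rev S = u2"
      by (auto simp: append_eq_append_conv2)
    then show ?thesis
    proof cases
      case 1
      have "us = []"
      proof (rule ccontr)
        assume "us \<noteq> []"
        then obtain a where "a \<in> set us" by (cases us) auto
        moreover have "set us \<subseteq> set S" using 1(2) by (metis set_append set_rev Un_upper1)
        ultimately show False using u1 1(1) Cons.prems(4) by fastforce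
      qed
      then show ?thesis using 1 that[of "[]"] by auto
    next
      case 2
      then show ?thesis using that[of us] by auto
    qed
  qed
  have c: "c = rev c2 @ rev u1" using c2(1) by (metis rev_append rev_rev_ident)
  have "init_seg (S @ rev c2) (set (cword (V @ R)))"
    using init_seg_mono[OF init_seg_prefix[of "S @ rev c2" "rev u1"]] Sc c by auto
  moreover have "sorted_wrt (<) (S @ rev c2)" using Sc c by (auto simp: sorted_wrt_append)
  ultimately obtain x0 where "first_col (cword (V @ R)) = (S @ rev c2) @ x0"
    using subseq_first_col[of "S @ rev c2" "cword (V @ R)"] u(3) c2(2) by auto
  moreover have "first_col (cword (V @ R)) = v" using first_col_tabl[of v "V' @ R"] Cons.prems(3) V by simp
  ultimately have v: "v = S @ (rev c2 @ x0)" by simp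
  define q where "q = rev c2 @ x0"
  have qS: "\<forall>s\<in>set S. \<forall>z\<in>set q. s < z" using srtv v by (auto simp: sorted_wrt_append q_def)
  have setW: "set (cword (V @ R)) = set S \<union> set q \<union> set (cword (V' @ R))" using V v q_def by auto
  \<comment> \<open>Among letters above \<open>S\<close>, an initial segment \<open>S @ c\<close>
    restricts to an initial segment \<open>c\<close>.\<close>
  have ic: "init_seg c A" if "A \<subseteq> set y \<union> set (cword (V @ R))" "\<forall>s\<in>set S. \<forall>z\<in>A. s < z" for A
    unfolding init_seg_def
  proof (intro ballI impI)
    fix z d assume z: "z \<in> A" "d \<in> set c" "z < d"
    hence "z \<in> set (S @ c)" using Sc(2) that(1) unfolding init_seg_def by auto
    then show "z \<in> set c" using that(2) z(1) by auto
  qed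
  have srtc: "sorted_wrt (<) c" using Sc by (auto simp: sorted_wrt_append)
  have "rev c = u1 @ c2" by fact
  hence "subseq (rev c) (y @ rev q)"
    using list_emb_append_mono[OF u(2), of c2 "rev q"] by (simp add: q_def subseq_drop_many)
  moreover have "init_seg c (set (y @ rev q))" using Cons.prems(4) qS setW by (intro ic) auto
  ultimately obtain x where "first_col (y @ rev q) = c @ x" using subseq_first_col[OF srtc] by blast
  then obtain z where z: "step c (y @ rev q) z" unfolding step_def using knuth_refl by blast
  have setz: "set z \<subseteq> set y \<union> set q" using step_mset[OF z]
    by (metis Un_upper2 set_append set_mset_mset set_mset_union set_rev)
  \<comment> \<open>\<open>peels_extend\<close> for the single column \<open>c\<close> produces one
    possible remainder; uniqueness of a step identifies it with the given \<open>X'\<close>.\<close>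
  have "peels (map ((@) S) [c]) ((y @ rev q) @ concat (replicate (length [c]) (rev S)) @ cword (V' @ R))
      (z @ cword (V' @ R))"
  proof (rule peels_extend)
    show "peels [c] (y @ rev q) z" using z by auto
    have "init_seg (S @ c) (set S \<union> set (y @ rev q) \<union> set (cword (V' @ R)))"
      using setW by (intro init_seg_mono[OF Sc(2)]) auto
    then show "\<forall>c\<in>set [c]. sorted_wrt (<) (S @ c) \<and> init_seg (S @ c) (set S \<union> set (y @ rev q) \<union> set (cword (V' @ R)))"
      using Sc(1) by auto
    show "\<forall>s\<in>set S. \<forall>z\<in>set (y @ rev q). s < z" using qS Cons.prems(4) by auto
  qed
  then obtain X'' where "step (S @ c) (y @ cword (V @ R)) X''" "X'' \<sim> z @ cword (V' @ R)"
    using V v by (auto simp: q_def)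
  hence "X' \<sim> z @ cword (V' @ R)" using step_unique[OF X'(1)] knuth_trans by blast
  hence pz: "peels (map ((@) S) cs) (z @ cword (V' @ R)) Y" using peels_cong[OF X'(2)] knuth_refl by blast
  have "\<exists>Q Z. V' = map ((@) S) Q \<and> peels cs (z @ cword Q) Z \<and> Y \<sim> Z @ cword R"
  proof (rule Cons.IH[OF pz])
    show "length V' = length cs" using Cons.prems V by simp
    show "tabl (V' @ R)" using Cons.prems(3) V by (simp add: tabl_Cons)
    show "\<forall>s\<in>set S. \<forall>z\<in>set z. s < z" using setz qS Cons.prems(4) by auto
    show "\<forall>c\<in>set cs. sorted_wrt (<) (S @ c) \<and> init_seg (S @ c) (set z \<union> set (cword (V' @ R)))"
      using Cons.prems(5) setz setW by (auto intro: init_seg_mono)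
  qed
  then obtain Q Z where Q: "V' = map ((@) S) Q" "peels cs (z @ cword Q) Z" "Y \<sim> Z @ cword R" by blast
  have QS: "\<forall>s\<in>set S. \<forall>z\<in>set (cword Q). s < z"
  proof (intro ballI)
    fix s z assume "s \<in> set S" "z \<in> set (cword Q)"
    then obtain w where w: "w \<in> set Q" "z \<in> set w" by (auto simp: set_cword)
    have "sorted_wrt (<) (S @ w)" using tabl_sorted[OF Cons.prems(3), of "S @ w"] V Q(1) w by auto
    then show "s < z" using \<open>s \<in> set S\<close> w by (auto simp: sorted_wrt_append)
  qed
  have setQ: "set (cword Q) \<subseteq> set (cword (V @ R))" using Q V by (auto simp: set_cword)
  obtain x' ys where d: "tabl ((c @ x') # ys)" "y @ rev q \<sim> rev x' @ rev c @ cword ys" "z \<sim> rev x' @ cword ys"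
    using step_decomp[OF z] by blast
  \<comment> \<open>The decomposition found for \<open>y @ rev q\<close> survives when
    \<open>cword Q\<close> is appended, because its letters also lie above \<open>S\<close> and
    respect the initial segment.\<close>
  have "step c (y @ rev q @ cword Q) (rev x' @ (cword ys @ cword Q))"
  proof (rule step_intro[OF srtc])
    have "set (cword ys) \<subseteq> set y \<union> set q" using knuth_set[OF d(2)] by auto
    then show "init_seg c (set (cword ys @ cword Q))"
      using setQ QS qS Cons.prems(4) setW by (intro ic) auto
    show "\<forall>z\<in>set (rev x'). \<forall>c\<in>set c. c < z" using tabl_sorted[OF d(1), of "c @ x'"] by (auto simp: sorted_wrt_append)
    show "y @ rev q @ cword Q \<sim> rev x' @ rev c @ cword ys @ cword Q"
      using knuth_cong[OF d(2) knuth_refl, of "cword Q"] by simp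
  qed
  moreover have "rev x' @ cword ys @ cword Q \<sim> z @ cword Q"
    using knuth_cong[OF knuth_sym[OF d(3)] knuth_refl, of "cword Q"] by simp
  ultimately have "step c (y @ cword (q # Q)) (z @ cword Q)" using step_cong[OF _ knuth_refl] by simp
  then have "peels (c # cs) (y @ cword (q # Q)) Z" using Q(2) by auto
  then show ?case using Q(1,3) V v by (intro exI[of _ "q # Q"] exI[of _ Z]) (simp add: q_def)
qed

section \<open>Weakly increasing subsequences as a Knuth invariant\<close>

lemma subseq3: "subseq t [a, b, c] \<longleftrightarrow> t \<in> {[], [a], [b], [c], [a, b], [a, c], [b, c], [a, b, c]}"
  by (simp flip: in_set_subseqs) blast

lemma sorted_wrt_subseq: "subseq t u \<Longrightarrow> sorted_wrt P u \<Longrightarrow> sorted_wrt P t"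
  by (induction rule: list_emb.induct) (auto dest: set_subseq)

text \<open>The greatest such \<open>k\<close> is the length of the first row of the insertion
  tableau of the letters above \<open>m\<close>, the simplest case of Greene's theorem. The
  threshold \<open>m\<close> makes it possible to disregard columns with small letters only.\<close>

definition increasing_in :: "nat \<Rightarrow> nat \<Rightarrow> nat list \<Rightarrow> bool" where
  "increasing_in m k u \<longleftrightarrow> (\<exists>s. subseq s u \<and> sorted s \<and> length s = k \<and> (\<forall>z\<in>set s. m < z))"

text \<open>Exchanging a triple destroys at most one increasing subword \<open>e\<close>, and
  \<open>e'\<close> replaces it in every increasing context. With \<open>e = e' = []\<close> nothing
  is destroyed.\<close>

lemma increasing_in_replace:
  assumes "increasing_in m k (us @ w @ vs)"
    and keep: "\<And>t. subseq t w \<Longrightarrow> sorted t \<Longrightarrow> t \<noteq> e \<Longrightarrow> subseq t w'"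
    and e: "subseq e' w'" "length e' = length e"
    and repl: "\<And>x y. sorted (x @ e @ y) \<Longrightarrow> sorted (x @ e' @ y)"
    and large: "\<forall>z\<in>set e. m < z \<Longrightarrow> \<forall>z\<in>set e'. m < z"
  shows "increasing_in m k (us @ w' @ vs)"
proof -
  obtain s where s: "subseq s (us @ w @ vs)" "sorted s" "length s = k" "\<forall>z\<in>set s. m < z"
    using assms(1) by (auto simp: increasing_in_def)
  from subseq_appendE[OF s(1)] obtain x u where "s = x @ u" "subseq x us" "subseq u (w @ vs)"
    by metis
  moreover from subseq_appendE[OF this(3)] obtain t y where "u = t @ y" "subseq t w" "subseq y vs"
    by metis
  ultimately have t: "s = x @ t @ y" "subseq x us" "subseq t w" "subseq y vs" by auto
  define t' where "t' = (if t = e then e' else t)"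
  have "subseq t' w'" using keep[OF t(3)] e(1) s(2) t(1) by (auto simp: t'_def sorted_append)
  then have "subseq (x @ t' @ y) (us @ w' @ vs)" using t by (intro list_emb_append_mono)
  moreover have "sorted (x @ t' @ y)" using repl s(2) t(1) by (auto simp: t'_def)
  moreover have "length (x @ t' @ y) = k" "\<forall>z\<in>set (x @ t' @ y). m < z"
    using s(3,4) e(2) large t(1) by (auto simp: t'_def)
  ultimately show ?thesis unfolding increasing_in_def by blast
qed

lemma increasing_in_step:
  assumes "knuth_step u v"
  shows "increasing_in m k u = increasing_in m k v"
  using assms
proof cases
  case (1 a b c us vs)
  show ?thesis unfolding 1(1,2)
  proof
    assume "increasing_in m k (us @ [a, c, b] @ vs)"
    then show "increasing_in m k (us @ [c, a, b] @ vs)"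
    proof (rule increasing_in_replace[where e = "[a, c]" and e' = "[a, b]"])
      fix t assume "subseq t [a, c, b]" "sorted t" "t \<noteq> [a, c]"
      then show "subseq t [c, a, b]" using 1(3,4) unfolding subseq3 by (elim insertE emptyE; simp)
    next
      fix x y assume "sorted (x @ [a, c] @ y)"
      then show "sorted (x @ [a, b] @ y)" using 1(3,4) by (fastforce simp: sorted_append)
    qed (use 1(3,4) in auto)
  next
    assume "increasing_in m k (us @ [c, a, b] @ vs)"
    then show "increasing_in m k (us @ [a, c, b] @ vs)"
    proof (rule increasing_in_replace[where e = "[]" and e' = "[]"])
      fix t assume "subseq t [c, a, b]" "sorted t"
      then show "subseq t [a, c, b]" using 1(3,4) unfolding subseq3 by (elim insertE emptyE; simp)
    qed auto
  qed
next
  case (2 a b c us vs)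
  show ?thesis unfolding 2(1,2)
  proof
    assume "increasing_in m k (us @ [b, a, c] @ vs)"
    then show "increasing_in m k (us @ [b, c, a] @ vs)"
    proof (rule increasing_in_replace[where e = "[a, c]" and e' = "[b, c]"])
      fix t assume "subseq t [b, a, c]" "sorted t" "t \<noteq> [a, c]"
      then show "subseq t [b, c, a]" using 2(3,4) unfolding subseq3 by (elim insertE emptyE; simp)
    next
      fix x y assume "sorted (x @ [a, c] @ y)"
      then show "sorted (x @ [b, c] @ y)" using 2(3,4) by (fastforce simp: sorted_append)
    qed (use 2(3,4) in auto)
  next
    assume "increasing_in m k (us @ [b, c, a] @ vs)"
    then show "increasing_in m k (us @ [b, a, c] @ vs)"
    proof (rule increasing_in_replace[where e = "[]" and e' = "[]"])
      fix t assume "subseq t [b, c, a]" "sorted t"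
      then show "subseq t [b, a, c]" using 2(3,4) unfolding subseq3 by (elim insertE emptyE; simp)
    qed auto
  qed
qed

text \<open>A column is read in strictly decreasing order, so a weakly increasing subsequence uses
  at most one of its letters, and none if no letter exceeds \<open>m\<close>.\<close>

lemma increasing_in_peels:
  assumes "peels Cs X Y" "increasing_in m k X"
  shows "\<exists>l. increasing_in m l Y \<and> k \<le> l + length (filter (\<lambda>C. \<exists>c\<in>set C. m < c) Cs)"
  using assms
proof (induction Cs arbitrary: X k)
  case Nil
  then show ?case using knuth_invariant[of X Y "increasing_in m k"] increasing_in_step by auto
next
  case (Cons C Cs)
  then obtain X' where X': "step C X X'" "peels Cs X' Y" by auto
  obtain x ys where d: "tabl ((C @ x) # ys)" "X \<sim> rev x @ rev C @ cword ys" "X' \<sim> rev x @ cword ys"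
    using step_decomp[OF X'(1)] by blast
  have "increasing_in m k (rev x @ rev C @ cword ys)"
    using knuth_invariant[OF d(2), of "increasing_in m k"] increasing_in_step Cons.prems(2) by simp
  then obtain t where t: "subseq t (rev x @ rev C @ cword ys)" "sorted t" "length t = k" "\<forall>z\<in>set t. m < z"
    by (auto simp: increasing_in_def)
  from subseq_appendE[OF t(1)] obtain t1 u where 1: "t = t1 @ u" "subseq t1 (rev x)" "subseq u (rev C @ cword ys)"
    by metis
  from subseq_appendE[OF 1(3)] obtain t2 t3 where 2: "u = t2 @ t3" "subseq t2 (rev C)" "subseq t3 (cword ys)"
    by metis
  have "subseq (t1 @ t3) (rev x @ cword ys)" using 1 2 by (intro list_emb_append_mono)
  moreover have "sorted (t1 @ t3)" "\<forall>z\<in>set (t1 @ t3). m < z" using t(2,4) 1(1) 2(1) by (auto simp: sorted_append)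
  ultimately have "increasing_in m (length (t1 @ t3)) (rev x @ cword ys)" unfolding increasing_in_def by blast
  then have inc: "increasing_in m (length (t1 @ t3)) X'"
    using knuth_invariant[OF d(3), of "increasing_in m (length (t1 @ t3))"] increasing_in_step by simp
  have "sorted_wrt (<) C" using tabl_sorted[OF d(1), of "C @ x"] by (auto simp: sorted_wrt_append)
  hence "sorted_wrt (>) t2" by (intro sorted_wrt_subseq[OF 2(2)]) (simp add: sorted_wrt_rev)
  moreover have "sorted t2" using t(2) 1 2 by (auto simp: sorted_append)
  ultimately have "length t2 \<le> 1" by (cases t2 rule: remdups_adj.cases) auto
  moreover have "t2 = []" if "\<not> (\<exists>c\<in>set C. m < c)"
  proof (rule ccontr)
    assume "t2 \<noteq> []"
    then obtain z where "z \<in> set t2" by (cases t2) auto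
    then show False using set_subseq[OF 2(2)] that t(4) 1 2 by auto
  qed
  ultimately have len: "k \<le> length (t1 @ t3) + (if \<exists>c\<in>set C. m < c then 1 else 0)"
    using t(3) 1(1) 2(1) by auto
  obtain l where "increasing_in m l Y" "length (t1 @ t3) \<le> l + length (filter (\<lambda>C. \<exists>c\<in>set C. m < c) Cs)"
    using Cons.IH[OF X'(2) inc] by blast
  moreover from this len have "k \<le> l + length (filter (\<lambda>C. \<exists>c\<in>set C. m < c) (C # Cs))"
    by (cases "\<exists>c\<in>set C. m < c") auto
  ultimately show ?case by blast
qed

text \<open>Without the common top \<open>S\<close> the columns still form a tableau, past which the
  copies of \<open>S\<close> slide by \<open>tabl_slide\<close>.\<close>

lemma cword_prefix_out:
  assumes "tabl (map ((@) S) Q)"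
  shows "cword (map ((@) S) Q) \<sim> cword Q @ concat (replicate (length Q) (rev S))"
  using assms
proof (induction Q)
  case (Cons q Q)
  have col_le: "col_le (S @ a) (S @ b) = col_le a b" for a b by (induction S) auto
  have tq: "tabl (q # Q)" using Cons.prems
    by (induction Q arbitrary: q) (auto simp: sorted_wrt_append col_le)
  have S: "sorted_wrt (<) S" using Cons.prems by (auto simp: tabl_Cons sorted_wrt_append)
  have "\<forall>s\<in>set S. \<forall>z\<in>set w. s < z" if "w \<in> set (q # Q)" for w
    using tabl_sorted[OF Cons.prems, of "S @ w"] that by (auto simp: sorted_wrt_append)
  hence "rev q @ cword Q @ rev S \<sim> rev q @ rev S @ cword Q"
    by (intro tabl_slide[OF tq S]) (auto simp: set_cword)
  from knuth_cong[OF knuth_sym[OF this] knuth_refl, of "concat (replicate (length Q) (rev S))"]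
  have "rev q @ rev S @ (cword Q @ concat (replicate (length Q) (rev S)))
    \<sim> rev q @ cword Q @ rev S @ concat (replicate (length Q) (rev S))" by simp
  moreover have "rev q @ rev S @ cword (map ((@) S) Q)
    \<sim> rev q @ rev S @ (cword Q @ concat (replicate (length Q) (rev S)))"
    using Cons by (intro knuth_cong) (auto simp: tabl_Cons)
  ultimately have "rev q @ rev S @ cword (map ((@) S) Q)
    \<sim> rev q @ cword Q @ rev S @ concat (replicate (length Q) (rev S))" by (rule knuth_trans[rotated])
  then show ?case by simp
qed simp

section \<open>The diagram of the Zelevinsky permutation\<close>

lemma row_offset_Suc: "row_offset r (Suc j) = row_offset r j + r j j"
  by (simp add: row_offset_def)

lemma row_offset_mono: "i \<le> j \<Longrightarrow> row_offset r i \<le> row_offset r j"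
  unfolding row_offset_def by (rule sum_mono2) auto

lemma row_offset_0 [simp]: "row_offset r 0 = 0"
  by (simp add: row_offset_def)

lemma grid_size_eq: "grid_size n r = row_offset r (Suc n)"
  by (simp add: grid_size_def row_offset_def lessThan_Suc_atMost)

lemma col_offset_row_offset: "k \<le> n \<Longrightarrow> col_offset n r k + row_offset r (Suc k) = grid_size n r"
proof -
  assume "k \<le> n"
  hence "{..n} = {..k} \<union> {k<..n}" by auto
  moreover have "sum f ({..k} \<union> {k<..n}) = sum f {..k} + sum f {k<..n}" for f :: "nat \<Rightarrow> nat"
    by (rule sum.union_disjoint) auto
  ultimately show ?thesis unfolding grid_size_def row_offset_def col_offset_def
    by (simp add: lessThan_Suc_atMost)
qed

lemma col_offset_antimono: "i \<le> j \<Longrightarrow> col_offset n r j \<le> col_offset n r i"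
  unfolding col_offset_def by (rule sum_mono2) auto

lemma col_offset_Suc: "i < n \<Longrightarrow> col_offset n r i = col_offset n r (Suc i) + r (Suc i) (Suc i)"
proof -
  assume "i < n"
  hence "{i<..n} = insert (Suc i) {Suc i<..n}" by auto
  then show ?thesis by (simp add: col_offset_def)
qed

section \<open>Block rows and block columns of the grid\<close>

definition row_blk :: "(nat \<Rightarrow> nat \<Rightarrow> nat) \<Rightarrow> nat \<Rightarrow> nat" where
  "row_blk r q = (LEAST j. q \<le> row_offset r (Suc j))"

text \<open>Column offsets decrease in the label, so again the least index is that of the block
  containing \<open>p\<close>. Empty blocks, which share an offset with a neighbour, are skipped by
  minimality.\<close>

definition col_blk :: "nat \<Rightarrow> (nat \<Rightarrow> nat \<Rightarrow> nat) \<Rightarrow> nat \<Rightarrow> nat" where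
  "col_blk n r p = (LEAST i. col_offset n r i < p)"

lemma row_blk_le_iff: "q \<in> {1..grid_size n r} \<Longrightarrow> row_blk r q \<le> k \<longleftrightarrow> q \<le> row_offset r (Suc k)"
proof -
  assume q: "q \<in> {1..grid_size n r}"
  have "q \<le> row_offset r (Suc (row_blk r q))" unfolding row_blk_def
    by (rule LeastI[of _ n]) (use q in \<open>simp add: grid_size_eq\<close>)
  moreover have "row_blk r q \<le> k" if "q \<le> row_offset r (Suc k)" unfolding row_blk_def using that by (rule Least_le)
  ultimately show ?thesis using row_offset_mono[of "Suc (row_blk r q)" "Suc k" r] by auto
qed

lemma row_blk_less_iff: "q \<in> {1..grid_size n r} \<Longrightarrow> row_blk r q < k \<longleftrightarrow> q \<le> row_offset r k"
  using row_blk_le_iff[of q n r "k - 1"] by (cases k) auto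

lemma row_blk_le_n: "q \<in> {1..grid_size n r} \<Longrightarrow> row_blk r q \<le> n"
  by (simp add: row_blk_le_iff[of q n] grid_size_eq)

lemma row_blk_mono: "q \<le> q' \<Longrightarrow> q \<in> {1..grid_size n r} \<Longrightarrow> q' \<in> {1..grid_size n r} \<Longrightarrow> row_blk r q \<le> row_blk r q'"
  using row_blk_le_iff[of q n r "row_blk r q'"] row_blk_le_iff[of q' n r "row_blk r q'"] by auto

lemma block_row_iff: "q \<in> {1..grid_size n r} \<Longrightarrow> q \<in> block_row r j \<longleftrightarrow> row_blk r q = j"
  using row_blk_less_iff[of q n r j] row_blk_le_iff[of q n r j] unfolding block_row_def row_offset_Suc by auto

lemma block_row_subset: "j \<le> n \<Longrightarrow> block_row r j \<subseteq> {1..grid_size n r}"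
  using row_offset_mono[of "Suc j" "Suc n" r] unfolding block_row_def grid_size_eq row_offset_Suc by auto

lemma col_blk_le_iff: "p \<in> {1..grid_size n r} \<Longrightarrow> col_blk n r p \<le> k \<longleftrightarrow> col_offset n r k < p"
proof -
  assume p: "p \<in> {1..grid_size n r}"
  have "col_offset n r (col_blk n r p) < p" unfolding col_blk_def
    by (rule LeastI[of _ n]) (use p in \<open>simp add: col_offset_def\<close>)
  moreover have "col_blk n r p \<le> k" if "col_offset n r k < p" unfolding col_blk_def using that by (rule Least_le)
  ultimately show ?thesis using col_offset_antimono[of "col_blk n r p" k n r] by auto
qed

lemma col_blk_le_n: "p \<in> {1..grid_size n r} \<Longrightarrow> col_blk n r p \<le> n"
  by (simp add: col_blk_le_iff col_offset_def)

lemma col_blk_antimono: "p \<le> p' \<Longrightarrow> p \<in> {1..grid_size n r} \<Longrightarrow> p' \<in> {1..grid_size n r} \<Longrightarrow> col_blk n r p' \<le> col_blk n r p"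
  using col_blk_le_iff[of p n r "col_blk n r p"] col_blk_le_iff[of p' n r "col_blk n r p"] by auto

lemma block_col_iff: "p \<in> {1..grid_size n r} \<Longrightarrow> i \<le> n \<Longrightarrow> p \<in> block_col n r i \<longleftrightarrow> col_blk n r p = i"
proof -
  assume p: "p \<in> {1..grid_size n r}" "i \<le> n"
  show ?thesis
  proof (cases i)
    case 0
    then show ?thesis using p col_blk_le_iff[of p n r 0] col_offset_row_offset[of 0 n r]
      by (auto simp: block_col_def row_offset_Suc)
  next
    case (Suc k)
    then show ?thesis using p col_blk_le_iff[of p n r i] col_blk_le_iff[of p n r k] col_offset_Suc[of k n r]
      by (auto simp: block_col_def)
  qed
qed

lemma block_col_subset: "i \<le> n \<Longrightarrow> block_col n r i \<subseteq> {1..grid_size n r}"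
  using col_offset_row_offset[of i n r] by (auto simp: block_col_def row_offset_Suc)

lemma filter_split:
  "sorted_wrt (\<lambda>x y. P y \<longrightarrow> P x) ps \<Longrightarrow> ps = filter P ps @ filter (\<lambda>x. \<not> P x) ps"
proof (induction ps)
  case (Cons x ps)
  show ?case
  proof (cases "P x")
    case False
    then have "filter P ps = []" "filter (\<lambda>x. \<not> P x) ps = ps"
      using Cons.prems by (auto simp: filter_empty_conv filter_id_conv)
    then show ?thesis using False by simp
  qed (use Cons in auto)
qed simp

lemma sorted_list_of_set_union:
  assumes "finite A" "finite B" "\<forall>a\<in>A. \<forall>b\<in>B. a < b"
  shows "sorted_list_of_set (A \<union> B) = sorted_list_of_set A @ sorted_list_of_set (B :: nat set)"
proof (rule sorted_distinct_set_unique)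
  show "sorted (sorted_list_of_set A @ sorted_list_of_set B)"
    using assms by (auto simp: sorted_append less_imp_le)
  show "distinct (sorted_list_of_set A @ sorted_list_of_set B)"
    using assms by auto
qed (use assms in auto)

section \<open>A fixed Zelevinsky permutation\<close>

locale zel =
  fixes n :: nat and r :: "nat \<Rightarrow> nat \<Rightarrow> nat" and v :: "nat \<Rightarrow> nat"
  assumes zel: "is_zelevinsky n r v"
begin

abbreviation d where "d \<equiv> grid_size n r"
definition v_inv where "v_inv = inv_into UNIV v"
definition one_col where "one_col q = col_blk n r (v q)"
definition one_row where "one_row p = row_blk r (v_inv p)"

lemma perm: "v permutes {1..d}"
  using zel by (simp add: is_zelevinsky_def)

lemma v_in: "q \<in> {1..d} \<Longrightarrow> v q \<in> {1..d}"
  using permutes_in_image[OF perm] by simp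

lemma v_inv_in: "p \<in> {1..d} \<Longrightarrow> v_inv p \<in> {1..d}"
  using permutes_in_image[OF permutes_inv[OF perm]] by (simp add: v_inv_def)

lemma v_v_inv [simp]: "v (v_inv p) = p"
  using permutes_inverses(1)[OF perm] by (simp add: v_inv_def)

lemma v_inv_v [simp]: "v_inv (v q) = q"
  using permutes_inverses(2)[OF perm] by (simp add: v_inv_def)

lemma one_col_v_inv [simp]: "one_col (v_inv p) = col_blk n r p"
  by (simp add: one_col_def)

lemma one_col_le: "q \<in> {1..d} \<Longrightarrow> one_col q \<le> Suc (row_blk r q)"
proof (rule ccontr)
  assume q: "q \<in> {1..d}" and *: "\<not> one_col q \<le> Suc (row_blk r q)"
  have le: "row_blk r q \<le> n" "one_col q \<le> n" using q row_blk_le_n col_blk_le_n v_in by (auto simp: one_col_def)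
  let ?X = "{q' \<in> block_row r (row_blk r q). v q' \<in> block_col n r (one_col q)}"
  have "int (card ?X) = 0" using zel le * unfolding is_zelevinsky_def by auto
  moreover have "finite ?X" by (simp add: block_row_def)
  moreover have "q \<in> ?X" using q le v_in block_row_iff[of q n r] block_col_iff[of "v q" n r] by (auto simp: one_col_def)
  ultimately show False by auto
qed

lemma v_mono_block: "q < q' \<Longrightarrow> q \<in> {1..d} \<Longrightarrow> q' \<in> {1..d} \<Longrightarrow> row_blk r q = row_blk r q' \<Longrightarrow> v q < v q'"
  using zel row_blk_le_n[of q n r] block_row_iff[of q n r] block_row_iff[of q' n r]
  unfolding is_zelevinsky_def by metis

lemma v_inv_mono_block: "p < p' \<Longrightarrow> p \<in> {1..d} \<Longrightarrow> p' \<in> {1..d} \<Longrightarrow> col_blk n r p = col_blk n r p' \<Longrightarrow> v_inv p < v_inv p'"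
  using zel col_blk_le_n[of p n r] block_col_iff[of p n r] block_col_iff[of p' n r]
  unfolding is_zelevinsky_def v_inv_def by metis

text \<open>Inside a block row or block column the ones run from northwest to southeast, so both
  inequalities defining the diagram must already hold strictly between blocks. Membership becomes a
  matter of block indices.\<close>

lemma diagram_iff:
  "(q, p) \<in> perm_diagram d v \<longleftrightarrow> q \<in> {1..d} \<and> p \<in> {1..d} \<and> one_col q < col_blk n r p \<and> row_blk r q < one_row p"
proof -
  have "p < v q \<and> q < v_inv p \<longleftrightarrow> one_col q < col_blk n r p \<and> row_blk r q < one_row p" if q: "q \<in> {1..d}" and p: "p \<in> {1..d}"
  proof
    assume *: "p < v q \<and> q < v_inv p"
    have "one_col q \<le> col_blk n r p" using col_blk_antimono[of p "v q"] * p v_in[OF q] by (auto simp: one_col_def)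
    moreover have "one_col q \<noteq> col_blk n r p" using v_inv_mono_block[of p "v q"] * p v_in[OF q] by (auto simp: one_col_def)
    moreover have "row_blk r q \<le> one_row p" using row_blk_mono[of q "v_inv p"] * q v_inv_in[OF p] by (auto simp: one_row_def)
    moreover have "row_blk r q \<noteq> one_row p" using v_mono_block[of q "v_inv p"] * q v_inv_in[OF p] by (auto simp: one_row_def)
    ultimately show "one_col q < col_blk n r p \<and> row_blk r q < one_row p" by simp
  next
    assume *: "one_col q < col_blk n r p \<and> row_blk r q < one_row p"
    have "\<not> v q \<le> p" using col_blk_antimono[of "v q" p n r] * p v_in[OF q] by (auto simp: one_col_def)
    moreover have "\<not> v_inv p \<le> q" using row_blk_mono[of "v_inv p" q n r] * q v_inv_in[OF p] by (auto simp: one_row_def)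
    ultimately show "p < v q \<and> q < v_inv p" by simp
  qed
  then show ?thesis by (auto simp: perm_diagram_def v_inv_def)
qed

lemma one_row_mono: "p \<le> p' \<Longrightarrow> p \<in> {1..d} \<Longrightarrow> p' \<in> {1..d} \<Longrightarrow> col_blk n r p = col_blk n r p' \<Longrightarrow> one_row p \<le> one_row p'"
  using v_inv_mono_block[of p p'] row_blk_mono[of "v_inv p" "v_inv p'" n r] v_inv_in by (cases "p = p'") (auto simp: one_row_def)

lemma col_blk_le_one_row: "p \<in> {1..d} \<Longrightarrow> col_blk n r p \<le> Suc (one_row p)"
  using one_col_le[of "v_inv p"] v_inv_in by (auto simp: one_row_def)

lemma one_row_le_n: "p \<in> {1..d} \<Longrightarrow> one_row p \<le> n"
  using row_blk_le_n v_inv_in by (auto simp: one_row_def)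

text \<open>Every 1 in block rows above \<open>m\<close> lies in block columns \<open>\<le> m\<close>, so this is a difference of
  two block sums.\<close>

lemma card_ones: "m \<le> n \<Longrightarrow> card {q \<in> {1..d}. one_col q \<le> m \<and> m \<le> row_blk r q} = r m m"
proof -
  assume m: "m \<le> n"
  have "card {q \<in> {1..d}. one_col q \<le> m} = card (v ` {q \<in> {1..d}. one_col q \<le> m})"
    using permutes_inj[OF perm] by (intro card_image[symmetric]) (auto intro: inj_on_subset)
  also have "v ` {q \<in> {1..d}. one_col q \<le> m} = {p \<in> {1..d}. col_blk n r p \<le> m}"
  proof (intro equalityI subsetI)
    fix p assume "p \<in> {p \<in> {1..d}. col_blk n r p \<le> m}"
    then show "p \<in> v ` {q \<in> {1..d}. one_col q \<le> m}" using v_inv_in by (intro image_eqI[of _ _ "v_inv p"]) auto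
  next
    fix p assume "p \<in> v ` {q \<in> {1..d}. one_col q \<le> m}"
    then obtain q where "p = v q" "q \<in> {1..d}" "one_col q \<le> m" by blast
    then show "p \<in> {p \<in> {1..d}. col_blk n r p \<le> m}" using v_in[of q] by (simp add: one_col_def)
  qed
  also have "\<dots> = {col_offset n r m <.. d}" using col_blk_le_iff[of _ n r m] by auto
  finally have 1: "card {q \<in> {1..d}. one_col q \<le> m} = d - col_offset n r m" by simp
  have "{q \<in> {1..d}. row_blk r q < m} = {1..row_offset r m}"
    using row_blk_less_iff[of _ n r m] row_offset_mono[of m "Suc n" r] m by (auto simp: grid_size_eq)
  hence 2: "card {q \<in> {1..d}. row_blk r q < m} = row_offset r m" by simp
  have eq: "{q \<in> {1..d}. one_col q \<le> m \<and> m \<le> row_blk r q} = {q \<in> {1..d}. one_col q \<le> m} - {q \<in> {1..d}. row_blk r q < m}" by auto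
  have "card {q \<in> {1..d}. one_col q \<le> m \<and> m \<le> row_blk r q} = d - col_offset n r m - row_offset r m"
    unfolding eq using 1 2 one_col_le by (subst card_Diff_subset) fastforce+
  then show ?thesis using col_offset_row_offset[OF m, of r] by (simp add: row_offset_Suc)
qed

text \<open>The ones of \<open>card_ones\<close>, counted by their columns.\<close>

lemma card_ones_cols: "m \<le> n \<Longrightarrow> card {p \<in> {1..d}. col_blk n r p \<le> m \<and> m \<le> one_row p} = r m m"
proof -
  assume m: "m \<le> n"
  have "inj_on v_inv A" for A using v_v_inv by (metis inj_on_inverseI)
  hence "card {p \<in> {1..d}. col_blk n r p \<le> m \<and> m \<le> one_row p} = card (v_inv ` {p \<in> {1..d}. col_blk n r p \<le> m \<and> m \<le> one_row p})"
    by (simp add: card_image)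
  also have "v_inv ` {p \<in> {1..d}. col_blk n r p \<le> m \<and> m \<le> one_row p} = {q \<in> {1..d}. one_col q \<le> m \<and> m \<le> row_blk r q}"
  proof (intro equalityI subsetI)
    fix q assume "q \<in> {q \<in> {1..d}. one_col q \<le> m \<and> m \<le> row_blk r q}"
    then show "q \<in> v_inv ` {p \<in> {1..d}. col_blk n r p \<le> m \<and> m \<le> one_row p}"
      using v_in by (intro image_eqI[of _ _ "v q"]) (auto simp: one_col_def one_row_def)
  next
    fix q assume "q \<in> v_inv ` {p \<in> {1..d}. col_blk n r p \<le> m \<and> m \<le> one_row p}"
    then obtain p where "q = v_inv p" "p \<in> {1..d}" "col_blk n r p \<le> m" "m \<le> one_row p" by blast
    then show "q \<in> {q \<in> {1..d}. one_col q \<le> m \<and> m \<le> row_blk r q}" using v_inv_in[of p] by (simp add: one_row_def)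
  qed
  finally show ?thesis using card_ones[OF m] by simp
qed

section \<open>Layers of the diagram\<close>

definition cols where "cols m = [Suc (col_offset n r m)..<Suc (col_offset n r m + r m m)]"

text \<open>\<open>t\<close> counts the layers already removed: what is left of column
  \<open>p\<close> starts in block row \<open>m - 1 + t\<close>. Writing this with
  \<open>Suc\<close> avoids truncated subtraction.\<close>

definition colset where
  "colset t m p = {q \<in> {1..d}. m + t \<le> Suc (row_blk r q) \<and> row_blk r q < one_row p \<and> one_col q < m}"

definition blk where "blk t m = map (\<lambda>p. sorted_list_of_set (colset t m p)) (cols m)"

text \<open>\<open>rowset\<close> and \<open>width\<close> describe the uppermost remaining
  rectangle, in block row \<open>m - 1 + t\<close>. Column \<open>p\<close> meets it only if its 1
  lies in a later block row, hence \<open>m + t \<le> one_row p\<close> in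
  \<open>width\<close>.\<close>

definition rowset where "rowset t m = {q \<in> {1..d}. Suc (row_blk r q) = m + t \<and> one_col q < m}"

definition width where "width t m = card {p \<in> {1..d}. col_blk n r p = m \<and> m + t \<le> one_row p}"

definition rect_word where
  "rect_word t m = concat (replicate (width t m) (rev (sorted_list_of_set (rowset t m))))"

text \<open>Block row \<open>n\<close> has no box of the diagram, since the 1 of the column would
  have to lie in a later block row; this explains the bound \<open>row_blk r q < n\<close>.\<close>

definition letters where
  "letters t m k = {q \<in> {1..d}. m + t \<le> Suc (row_blk r q) \<and> row_blk r q < n \<and> one_col q < k}"

lemma cols_iff: "m \<le> n \<Longrightarrow> p \<in> set (cols m) \<longleftrightarrow> p \<in> {1..d} \<and> col_blk n r p = m"
  using block_col_iff[of p n r m] block_col_subset[of m n r] by (auto simp: cols_def block_col_def)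

lemma length_blk [simp]: "length (blk t m) = r m m"
  by (simp add: blk_def cols_def)

lemma finite_colset [simp]: "finite (colset t m p)" "finite (rowset t m)"
  by (auto simp: colset_def rowset_def)

lemma colset_Suc:
  assumes "m + t \<le> one_row p"
  shows "sorted_list_of_set (colset t m p) = sorted_list_of_set (rowset t m) @ sorted_list_of_set (colset (Suc t) m p)"
proof -
  have "colset t m p = rowset t m \<union> colset (Suc t) m p"
    using assms by (auto simp: colset_def rowset_def)
  moreover have "\<forall>a\<in>rowset t m. \<forall>b\<in>colset (Suc t) m p. a < b"
  proof (intro ballI)
    fix a b assume "a \<in> rowset t m" "b \<in> colset (Suc t) m p"
    then show "a < b" using row_blk_mono[of b a n r] by (force simp: colset_def rowset_def)
  qed
  ultimately show ?thesis by (simp add: sorted_list_of_set_union)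
qed

text \<open>In a block column the ones descend to the right, so the columns whose 1 is too high to
  meet the rectangle come first and are empty. All others begin with the full set of rows of the
  rectangle.\<close>

lemma blk_split:
  assumes "m \<le> n"
  obtains k cs where "blk t m = replicate k [] @ map ((@) (sorted_list_of_set (rowset t m))) cs"
    "blk (Suc t) m = replicate k [] @ cs" "length cs = width t m"
    "\<forall>c\<in>set cs. \<exists>p. c = sorted_list_of_set (colset (Suc t) m p) \<and>
      sorted_list_of_set (rowset t m) @ c = sorted_list_of_set (colset t m p)"
proof -
  define P where "P p \<longleftrightarrow> one_row p < m + t" for p
  define xs where "xs = filter P (cols m)"
  define ys where "ys = filter (\<lambda>p. \<not> P p) (cols m)"
  have "sorted_wrt (\<lambda>x y. P y \<longrightarrow> P x) (cols m)"
  proof (rule sorted_wrt_mono_rel[of _ "(<)"])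
    fix x y assume "x \<in> set (cols m)" "y \<in> set (cols m)" "x < y"
    then have "one_row x \<le> one_row y" using assms by (intro one_row_mono) (auto simp: cols_iff)
    then show "P y \<longrightarrow> P x" by (auto simp: P_def)
  qed (simp add: cols_def del: upt_Suc)
  hence split: "cols m = xs @ ys" unfolding xs_def ys_def by (rule filter_split)
  have *: "colset t m p = {}" "colset (Suc t) m p = {}" if "p \<in> set xs" for p
    using that by (auto simp: xs_def P_def colset_def)
  have e: "map (\<lambda>p. sorted_list_of_set (colset t' m p)) xs = replicate (length xs) []" if "t' \<in> {t, Suc t}" for t'
    using * that by (intro replicate_eqI) auto
  have ys: "set ys = {p \<in> {1..d}. col_blk n r p = m \<and> m + t \<le> one_row p}" "distinct ys"
    using assms by (auto simp: ys_def P_def cols_iff not_less) (simp add: cols_def)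
  show ?thesis
  proof
    let ?cs = "map (\<lambda>p. sorted_list_of_set (colset (Suc t) m p)) ys"
    show "blk t m = replicate (length xs) [] @ map ((@) (sorted_list_of_set (rowset t m))) ?cs"
      using ys e[of t] by (auto simp: blk_def split colset_Suc)
    show "blk (Suc t) m = replicate (length xs) [] @ ?cs"
      using e[of "Suc t"] by (auto simp: blk_def split)
    show "length ?cs = width t m"
      using ys by (simp add: width_def flip: distinct_card)
    show "\<forall>c\<in>set ?cs. \<exists>p. c = sorted_list_of_set (colset (Suc t) m p) \<and>
      sorted_list_of_set (rowset t m) @ c = sorted_list_of_set (colset t m p)"
      using ys by (auto intro!: exI simp: colset_Suc)
  qed
qed

text \<open>\<open>Y m\<close> is what remains of \<open>w (n - t), ..., w m\<close> once block
  columns \<open>n - t, ..., m\<close> have been peeled; it is read in front of the next piece.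
  Peeling starts and ends with nothing. The bounds on letters keep the initial segment conditions
  available when layers are added or removed.\<close>

definition good where
  "good t w \<longleftrightarrow> (\<exists>Y. Y (Suc n - t) = [] \<and> Y 1 = [] \<and>
    (\<forall>m\<in>{1..n - t}. peels (blk t m) (Y (Suc m) @ w m) (Y m) \<and> set (w m) \<subseteq> letters t m m) \<and>
    (\<forall>m\<in>{1..n - t}. set (Y m) \<subseteq> letters t m (m - 1)))"

text \<open>Inside such an \<open>A\<close>, belonging to the column is only an upper bound on the
  block row, which is monotone in the row.\<close>

lemma init_colset: "A \<subseteq> {q \<in> {1..d}. m + t \<le> Suc (row_blk r q) \<and> one_col q < m} \<Longrightarrow>
  init_seg (sorted_list_of_set (colset t m p)) A"
  unfolding init_seg_def
proof (intro ballI impI)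
  fix z c assume A: "A \<subseteq> {q \<in> {1..d}. m + t \<le> Suc (row_blk r q) \<and> one_col q < m}" and "z \<in> A"
    "c \<in> set (sorted_list_of_set (colset t m p))" "z < c"
  then show "z \<in> set (sorted_list_of_set (colset t m p))"
    using row_blk_mono[of z c n r] by (force simp: colset_def)
qed

lemma good_knuth:
  assumes "good t w" "\<forall>m\<in>{1..n - t}. w m \<sim> w' m"
  shows "good t w'"
proof -
  from assms(1) obtain Y where Y: "Y (Suc n - t) = []" "Y 1 = []"
    "\<forall>m\<in>{1..n - t}. peels (blk t m) (Y (Suc m) @ w m) (Y m) \<and> set (w m) \<subseteq> letters t m m"
    "\<forall>m\<in>{1..n - t}. set (Y m) \<subseteq> letters t m (m - 1)" unfolding good_def by blast
  have "peels (blk t m) (Y (Suc m) @ w' m) (Y m) \<and> set (w' m) \<subseteq> letters t m m" if "m \<in> {1..n - t}" for m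
    using Y(3) that assms(2) knuth_set[of "w m" "w' m"] peels_cong[OF _ knuth_cong[OF knuth_refl] knuth_refl] by metis
  then show ?thesis unfolding good_def using Y by blast
qed

lemma set_rect_word: "set (rect_word t m) \<subseteq> rowset t m"
  by (auto simp: rect_word_def)

end

section \<open>Peeling block columns\<close>

lemma peels_replicate_append: "peels (replicate k [] @ cs) X Y \<longleftrightarrow> peels cs X Y"
  unfolding peels_append peels_replicate_Nil
  using peels_cong[of cs _ Y X Y] knuth_refl knuth_sym by blast

lemma in_cword: "y \<in> set ys \<Longrightarrow> z \<in> set y \<Longrightarrow> z \<in> set (cword ys)"
  by (auto simp: set_cword)

context zel
begin

lemma letters_mono: "m' + t' \<ge> m + t \<Longrightarrow> k' \<le> k \<Longrightarrow> letters t' m' k' \<subseteq> letters t m k"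
  by (auto simp: letters_def)

lemma rowset_less: "a \<in> rowset t m \<Longrightarrow> b \<in> letters (Suc t) m k \<Longrightarrow> a < b"
  using row_blk_mono[of b a n r] by (force simp: rowset_def letters_def)

text \<open>In block column \<open>n - t\<close> layer \<open>t\<close> already lies in block row
  \<open>n - 1\<close>, the last one that can carry boxes.\<close>

lemma blk_last_Nil: "t < n \<Longrightarrow> blk (Suc t) (n - t) = replicate (length (cols (n - t))) []"
proof -
  assume t: "t < n"
  have "colset (Suc t) (n - t) p = {}" if "p \<in> set (cols (n - t))" for p
    using that one_row_le_n[of p] t cols_iff[of "n - t" p] by (force simp: colset_def)
  hence "blk (Suc t) (n - t) = map (\<lambda>_. []) (cols (n - t))" unfolding blk_def by (intro map_cong) auto
  then show ?thesis by (simp add: map_replicate_const)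
qed

text \<open>The leftovers of layer \<open>t\<close> are those of layer \<open>t + 1\<close> followed
  by \<open>P (m - 1)\<close>. Then \<open>Y (Suc m) @ Q m\<close> becomes
  \<open>Yh (Suc m) @ P m @ Q m\<close>, which the deeper layer peels, and
  \<open>peels_extend\<close> supplies the rectangle and \<open>P (m - 1)\<close>.\<close>

lemma good_Suc_intro:
  assumes t: "t < n" and g: "good (Suc t) (\<lambda>i. P i @ Q i)" and P0: "P 0 = []" and Qn: "Q (n - t) = []"
    and w: "\<forall>i\<in>{1..n - t}. w i \<sim> Q i @ rect_word t i @ P (i - 1)"
  shows "good t w"
proof -
  obtain Yh where Yh: "Yh (n - t) = []" "Yh 1 = []"
    "\<And>m. m \<in> {1..n - Suc t} \<Longrightarrow> peels (blk (Suc t) m) (Yh (Suc m) @ P m @ Q m) (Yh m)"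
    "\<And>m. m \<in> {1..n - Suc t} \<Longrightarrow> set (P m @ Q m) \<subseteq> letters (Suc t) m m"
    "\<And>m. m \<in> {1..n - Suc t} \<Longrightarrow> set (Yh m) \<subseteq> letters (Suc t) m (m - 1)"
    using g unfolding good_def by auto
  \<comment> \<open>Nothing has been peeled at the left end, and \<open>Yh\<close> is not
    constrained at this index; hence the separate value.\<close>
  define Y where "Y m = (if m = Suc n - t then [] else Yh m @ P (m - 1))" for m
  define w' where "w' i = Q i @ rect_word t i @ P (i - 1)" for i
  have setYh: "set (Yh m) \<subseteq> letters (Suc t) m (m - 1)" if "m \<in> {1..n - t}" for m
  proof (cases "m = n - t")
    case False
    then have "m \<in> {1..n - Suc t}" using that by auto
    then show ?thesis by (rule Yh(5))
  qed (use Yh(1) in simp)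
  have setQ: "set (Q m) \<subseteq> letters (Suc t) m m" if "m \<in> {1..n - t}" for m
  proof (cases "m = n - t")
    case False
    then have "m \<in> {1..n - Suc t}" using that by auto
    then show ?thesis using Yh(4) by auto
  qed (use Qn in simp)
  have setP: "set (P (m - 1)) \<subseteq> letters t m (m - 1)" if "m \<in> {1..n - t}" for m
  proof (cases "m = 1")
    case False
    then have "m - 1 \<in> {1..n - Suc t}" using that by auto
    from Yh(4)[OF this] have "set (P (m - 1)) \<subseteq> letters (Suc t) (m - 1) (m - 1)" by auto
    also have "\<dots> \<subseteq> letters t m (m - 1)" using that by (intro letters_mono) auto
    finally show ?thesis .
  qed (use P0 in auto)
  have peel: "peels (blk t m) (Y (Suc m) @ w' m) (Y m)" if m: "m \<in> {1..n - t}" for m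
  proof -
    define X where "X = Y (Suc m) @ Q m"
    have mn: "m \<le> n" using m by auto
    have Xp: "peels (blk (Suc t) m) X (Yh m) \<and> set X \<subseteq> letters (Suc t) m m"
    proof (cases "m = n - t")
      case True
      then show ?thesis using t Yh(1) Qn by (auto simp: X_def Y_def blk_last_Nil peels_replicate_Nil)
    next
      case False
      hence m': "m \<in> {1..n - Suc t}" using m by auto
      have X: "X = Yh (Suc m) @ P m @ Q m" using m' by (auto simp: X_def Y_def)
      have "set (Yh (Suc m)) \<subseteq> letters (Suc t) (Suc m) m" using setYh[of "Suc m"] m' by fastforce
      also have "\<dots> \<subseteq> letters (Suc t) m m" by (intro letters_mono) auto
      finally show ?thesis using X Yh(3,4)[OF m'] by auto
    qed
    let ?S = "sorted_list_of_set (rowset t m)"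
    obtain k cs where cs: "blk t m = replicate k [] @ map ((@) ?S) cs"
      "blk (Suc t) m = replicate k [] @ cs" "length cs = width t m"
      "\<forall>c\<in>set cs. \<exists>p. c = sorted_list_of_set (colset (Suc t) m p) \<and> ?S @ c = sorted_list_of_set (colset t m p)"
      using blk_split[OF mn] by metis
    have "peels (map ((@) ?S) cs) (X @ concat (replicate (length cs) (rev ?S)) @ P (m - 1)) (Yh m @ P (m - 1))"
    proof (rule peels_extend)
      show "peels cs X (Yh m)" using Xp cs(2) by (simp add: peels_replicate_append)
      show "\<forall>c\<in>set cs. sorted_wrt (<) (?S @ c) \<and> init_seg (?S @ c) (set ?S \<union> set X \<union> set (P (m - 1)))"
      proof
        fix c assume "c \<in> set cs"
        then obtain p where p: "?S @ c = sorted_list_of_set (colset t m p)" using cs(4) by blast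
        have "set ?S \<union> set X \<union> set (P (m - 1)) \<subseteq> {q \<in> {1..d}. m + t \<le> Suc (row_blk r q) \<and> one_col q < m}"
          using Xp setP[OF m] by (fastforce simp: rowset_def letters_def)
        from init_colset[OF this] show "sorted_wrt (<) (?S @ c) \<and> init_seg (?S @ c) (set ?S \<union> set X \<union> set (P (m - 1)))"
          using p by simp
      qed
      show "\<forall>s\<in>set ?S. \<forall>z\<in>set X. s < z" using Xp rowset_less by auto
    qed
    moreover have "Y m = Yh m @ P (m - 1)" using m by (auto simp: Y_def)
    ultimately show ?thesis using cs
      by (simp add: peels_replicate_append w'_def X_def rect_word_def)
  qed
  have "good t w'"
    unfolding good_def
  proof (intro exI[of _ Y] conjI ballI)
    show "Y (Suc n - t) = []" "Y 1 = []" using Yh P0 t by (auto simp: Y_def)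
    fix m assume m: "m \<in> {1..n - t}"
    show "peels (blk t m) (Y (Suc m) @ w' m) (Y m)" by (rule peel[OF m])
    have "rowset t m \<subseteq> letters t m m" using m t by (auto simp: rowset_def letters_def)
    then show "set (w' m) \<subseteq> letters t m m"
      using setQ[OF m] setP[OF m] set_rect_word[of t m] letters_mono[of m t m "Suc t" m m]
        letters_mono[of m t m t "m - 1" m] by (auto simp: w'_def)
    show "set (Y m) \<subseteq> letters t m (m - 1)"
      using setYh[OF m] setP[OF m] letters_mono[of m t m "Suc t" "m - 1" "m - 1"] by (auto simp: Y_def)
  qed
  moreover have "\<forall>m\<in>{1..n - t}. w' m \<sim> w m" using w by (auto simp: w'_def intro: knuth_sym)
  ultimately show ?thesis by (rule good_knuth)
qed

text \<open>\<open>w m\<close> is rewritten as a tableau and cut after \<open>width t m\<close>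
  columns. \<open>peels_restrict\<close> shows that each column before the cut begins with the rows
  of the rectangle; stripping them gives \<open>Q m\<close>, and the columns after the cut give
  \<open>P (m - 1)\<close>.\<close>

lemma good_Suc_elim:
  assumes t: "t < n" and g: "good t w"
  obtains P Q where "P 0 = []" "Q (n - t) = []"
    "\<forall>i\<in>{1..n - t}. w i \<sim> Q i @ rect_word t i @ P (i - 1)" "good (Suc t) (\<lambda>i. P i @ Q i)"
proof -
  obtain Y where Y: "Y (Suc n - t) = []" "Y 1 = []"
    "\<And>m. m \<in> {1..n - t} \<Longrightarrow> peels (blk t m) (Y (Suc m) @ w m) (Y m)"
    "\<And>m. m \<in> {1..n - t} \<Longrightarrow> set (w m) \<subseteq> letters t m m"
    "\<And>m. m \<in> {1..n - t} \<Longrightarrow> set (Y m) \<subseteq> letters t m (m - 1)"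
    using g unfolding good_def by auto
  have setY: "set (Y (Suc m)) \<subseteq> letters (Suc t) m m" if "m \<in> {1..n - t}" for m
  proof (cases "m = n - t")
    case True
    then show ?thesis using Y(1) t by (simp add: Suc_diff_le)
  next
    case False
    then have "set (Y (Suc m)) \<subseteq> letters t (Suc m) m" using Y(5)[of "Suc m"] that by auto
    also have "\<dots> \<subseteq> letters (Suc t) m m" by (intro letters_mono) auto
    finally show ?thesis .
  qed
  have "\<forall>m\<in>{1..n - t}. \<exists>x. case x of (q, p, Z) \<Rightarrow> w m \<sim> q @ rect_word t m @ p \<and>
      peels (blk (Suc t) m) (Y (Suc m) @ q) Z \<and> Y m \<sim> Z @ p \<and> set q \<subseteq> letters (Suc t) m m"
  proof
    fix m assume m: "m \<in> {1..n - t}"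
    hence mn: "m \<le> n" by auto
    let ?S = "sorted_list_of_set (rowset t m)"
    obtain k cs where cs: "blk t m = replicate k [] @ map ((@) ?S) cs"
      "blk (Suc t) m = replicate k [] @ cs" "length cs = width t m"
      "\<forall>c\<in>set cs. \<exists>p. c = sorted_list_of_set (colset (Suc t) m p) \<and> ?S @ c = sorted_list_of_set (colset t m p)"
      using blk_split[OF mn] by metis
    obtain V0 where V0: "tabl V0" "w m \<sim> cword V0" using tabl_exists by blast
    \<comment> \<open>The padding guarantees that \<open>width t m\<close> columns can be cut
      off.\<close>
    define V where "V = V0 @ replicate (width t m) []"
    define V1 where "V1 = take (width t m) V"
    define R where "R = drop (width t m) V"
    have V: "V1 @ R = V" "length V1 = length cs" using cs(3) by (simp add: V1_def R_def, simp add: V1_def V_def)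
    have tV: "tabl (V1 @ R)" using V(1) tabl_pad[OF V0(1)] by (simp add: V_def)
    have wV: "w m \<sim> cword (V1 @ R)" using V0(2) unfolding V(1) V_def by (simp add: cword_def)
    have setV: "set (cword (V1 @ R)) \<subseteq> letters t m m" using knuth_set[OF wV] Y(4)[OF m] by simp
    have pV: "peels (map ((@) ?S) cs) (Y (Suc m) @ cword (V1 @ R)) (Y m)"
      using Y(3)[OF m] cs(1) peels_cong[OF _ knuth_cong[OF knuth_refl wV] knuth_refl] by (simp add: peels_replicate_append)
    have "\<exists>Q Z. V1 = map ((@) ?S) Q \<and> peels cs (Y (Suc m) @ cword Q) Z \<and> Y m \<sim> Z @ cword R"
    proof (rule peels_restrict[OF pV V(2) tV])
      show "\<forall>s\<in>set ?S. \<forall>z\<in>set (Y (Suc m)). s < z" using setY[OF m] rowset_less by auto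
      show "\<forall>c\<in>set cs. sorted_wrt (<) (?S @ c) \<and> init_seg (?S @ c) (set (Y (Suc m)) \<union> set (cword (V1 @ R)))"
      proof
        fix c assume "c \<in> set cs"
        then obtain p where p: "?S @ c = sorted_list_of_set (colset t m p)" using cs(4) by blast
        have "set (Y (Suc m)) \<union> set (cword (V1 @ R)) \<subseteq> {q \<in> {1..d}. m + t \<le> Suc (row_blk r q) \<and> one_col q < m}"
          using setY[OF m] setV by (fastforce simp: letters_def)
        from init_colset[OF this] show "sorted_wrt (<) (?S @ c) \<and> init_seg (?S @ c) (set (Y (Suc m)) \<union> set (cword (V1 @ R)))"
          using p by simp
      qed
    qed
    then obtain Q Z where Q: "V1 = map ((@) ?S) Q" "peels cs (Y (Suc m) @ cword Q) Z" "Y m \<sim> Z @ cword R" by blast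
    have "cword V1 \<sim> cword Q @ rect_word t m"
      using cword_prefix_out[of ?S Q] Q(1) tabl_appendD[OF tV] V(2) cs(3) by (simp add: rect_word_def)
    from knuth_trans[OF wV] knuth_cong[OF this knuth_refl, of "cword R"]
    have 1: "w m \<sim> cword Q @ rect_word t m @ cword R" by simp
    have "set (cword Q) \<subseteq> letters (Suc t) m m"
    proof
      fix z assume "z \<in> set (cword Q)"
      then obtain w' where w': "w' \<in> set Q" "z \<in> set w'" by (auto simp: set_cword)
      have "sorted_wrt (<) (?S @ w')" using tabl_sorted[OF tV, of "?S @ w'"] Q(1) w' by auto
      hence "z \<notin> rowset t m" using w'(2) by (auto simp: sorted_wrt_append)
      moreover have "z \<in> letters t m m"
        using setV Q(1) w' in_cword[of "?S @ w'" "V1 @ R" z] by auto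
      ultimately show "z \<in> letters (Suc t) m m" by (auto simp: letters_def rowset_def)
    qed
    then show "\<exists>x. case x of (q, p, Z) \<Rightarrow> w m \<sim> q @ rect_word t m @ p \<and>
      peels (blk (Suc t) m) (Y (Suc m) @ q) Z \<and> Y m \<sim> Z @ p \<and> set q \<subseteq> letters (Suc t) m m"
      using 1 Q cs(2) by (intro exI[of _ "(cword Q, cword R, Z)"]) (simp add: peels_replicate_append)
  qed
  then obtain f where f: "\<forall>m\<in>{1..n - t}. case f m of (q, p, Z) \<Rightarrow> w m \<sim> q @ rect_word t m @ p \<and>
      peels (blk (Suc t) m) (Y (Suc m) @ q) Z \<and> Y m \<sim> Z @ p \<and> set q \<subseteq> letters (Suc t) m m"
    by (elim bchoice[THEN exE])
  define Q where "Q m = fst (f m)" for m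
  \<comment> \<open>The index shifts by one: the columns cut off from piece \<open>m + 1\<close> are
    called \<open>P m\<close>.\<close>
  define P where "P m = fst (snd (f (Suc m)))" for m
  define Z where "Z m = snd (snd (f m))" for m
  have F: "w m \<sim> Q m @ rect_word t m @ P (m - 1)" "peels (blk (Suc t) m) (Y (Suc m) @ Q m) (Z m)"
    "Y m \<sim> Z m @ P (m - 1)" "set (Q m) \<subseteq> letters (Suc t) m m" if "m \<in> {1..n - t}" for m
    using bspec[OF f that] that by (simp_all add: Q_def P_def Z_def case_prod_unfold)
  have 1: "1 \<in> {1..n - t}" "n - t \<in> {1..n - t}" using t by auto
  have "P 0 = []" "Z 1 = []" using F(3)[OF 1(1)] Y(2) by auto
  \<comment> \<open>Only block row \<open>n\<close> would be left at this place, and it has no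
    letters.\<close>
  have "letters (Suc t) (n - t) k = {}" for k using t by (auto simp: letters_def)
  hence Qn: "Q (n - t) = []" using F(4)[OF 1(2)] by auto
  have "Z (n - t) = []"
    using peels_mset[OF F(2)[OF 1(2)]] Qn Y(1) t by (simp add: Suc_diff_le)
  have "good (Suc t) (\<lambda>i. P i @ Q i)"
    unfolding good_def
  proof (intro exI[of _ Z] conjI ballI)
    show "Z (Suc n - Suc t) = []" "Z 1 = []" using \<open>Z (n - t) = []\<close> \<open>Z 1 = []\<close> by simp_all
    fix m assume "m \<in> {1..n - Suc t}"
    hence m: "m \<in> {1..n - t}" "Suc m \<in> {1..n - t}" by auto
    have "Y (Suc m) @ Q m \<sim> (Z (Suc m) @ P m) @ Q m" using F(3)[OF m(2)] by (intro knuth_cong) auto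
    then show "peels (blk (Suc t) m) (Z (Suc m) @ P m @ Q m) (Z m)"
      using peels_cong[OF F(2)[OF m(1)] _ knuth_refl] by simp
    show "set (P m @ Q m) \<subseteq> letters (Suc t) m m"
      using F(4)[OF m(1)] knuth_set[OF F(3)[OF m(2)]] setY[OF m(1)] by auto
    have "set (Z m) \<subseteq> letters (Suc t) m m"
      using peels_set[OF F(2)[OF m(1)]] setY[OF m(1)] F(4)[OF m(1)] by auto
    moreover have "set (Z m) \<subseteq> letters t m (m - 1)" using knuth_set[OF F(3)[OF m(1)]] Y(5)[OF m(1)] by auto
    ultimately show "set (Z m) \<subseteq> letters (Suc t) m (m - 1)" by (auto simp: letters_def)
  qed
  then show ?thesis using that[of P Q] F(1) Qn \<open>P 0 = []\<close> by blast
qed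

section \<open>Full columns and the removal of \<open>D_Hom\<close>\<close>

definition key_col where "key_col m = [1..<Suc (row_offset r (m - 1))]"

definition full_blk where
  "full_blk m = map (\<lambda>p. sorted_list_of_set {q. (q, p) \<in> perm_diagram d v}) (cols m)"

text \<open>Block columns carry decreasing labels from left to right, so the highest index comes
  first.\<close>

fun stack :: "(nat \<Rightarrow> nat list list) \<Rightarrow> nat \<Rightarrow> nat list list" where
  "stack V 0 = []"
| "stack V (Suc m) = V (Suc m) @ stack V m"

abbreviation full_blks where "full_blks \<equiv> stack full_blk"

lemma key_col_iff: "m \<in> {1..n} \<Longrightarrow> q \<in> set (key_col m) \<longleftrightarrow> q \<in> {1..d} \<and> Suc (row_blk r q) < m"
proof -
  assume m: "m \<in> {1..n}"
  have "row_offset r (m - 1) \<le> d" using row_offset_mono[of "m - 1" "Suc n" r] m unfolding grid_size_eq by auto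
  then show ?thesis using row_blk_less_iff[of q n r "m - 1"] m unfolding key_col_def by auto
qed

text \<open>A row in block row \<open>j \<le> m - 2\<close> has its 1 in a block column at most
  \<open>j + 1 < m\<close>, and the 1 of column \<open>p\<close> lies in block row
  \<open>m - 1\<close> or later. So every column of block column \<open>m\<close> contains all of
  \<open>key_col m\<close>.\<close>

lemma key_col_append:
  assumes "m \<in> {1..n}" "p \<in> set (cols m)"
  shows "key_col m @ sorted_list_of_set (colset 0 m p) = sorted_list_of_set {q. (q, p) \<in> perm_diagram d v}"
proof -
  have p: "p \<in> {1..d}" "col_blk n r p = m" using assms cols_iff[of m p] by auto
  have "{q. (q, p) \<in> perm_diagram d v} = set (key_col m) \<union> colset 0 m p"
  proof (rule Set.set_eqI)
    fix q
    show "q \<in> {q. (q, p) \<in> perm_diagram d v} \<longleftrightarrow> q \<in> set (key_col m) \<union> colset 0 m p"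
      using one_col_le[of q] col_blk_le_one_row[OF p(1)] p
      by (cases "Suc (row_blk r q) < m") (auto simp: key_col_iff[OF assms(1)] diagram_iff colset_def)
  qed
  moreover have "\<forall>a\<in>set (key_col m). \<forall>b\<in>colset 0 m p. a < b"
  proof (intro ballI)
    fix a b assume "a \<in> set (key_col m)" "b \<in> colset 0 m p"
    then show "a < b" using row_blk_mono[of b a n r] by (force simp: key_col_iff[OF assms(1)] colset_def)
  qed
  moreover have "sorted_list_of_set (set (key_col m)) = key_col m"
    by (simp add: key_col_def del: upt_Suc)
  ultimately show ?thesis by (simp add: sorted_list_of_set_union)
qed

lemma full_blk_eq: "m \<in> {1..n} \<Longrightarrow> full_blk m = map ((@) (key_col m)) (blk 0 m)"
  unfolding full_blk_def blk_def map_map by (intro map_cong) (auto simp: key_col_append)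

lemma full_blk_cond:
  assumes "m \<in> {1..n}" "A \<subseteq> {q \<in> {1..d}. one_col q < m}"
  shows "\<forall>c\<in>set (blk 0 m). sorted_wrt (<) (key_col m @ c) \<and> init_seg (key_col m @ c) A"
proof
  fix c assume "c \<in> set (blk 0 m)"
  then obtain p where p: "p \<in> set (cols m)" "c = sorted_list_of_set (colset 0 m p)" by (auto simp: blk_def)
  have eq: "key_col m @ c = sorted_list_of_set {q. (q, p) \<in> perm_diagram d v}"
    using key_col_append[OF assms(1) p(1)] p(2) by simp
  have fin: "finite {q. (q, p) \<in> perm_diagram d v}"
    by (rule finite_subset[of _ "{1..d}"]) (auto simp: diagram_iff)
  have "init_seg (sorted_list_of_set {q. (q, p) \<in> perm_diagram d v}) A"
    unfolding init_seg_def
  proof (intro ballI impI)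
    fix z c assume z: "z \<in> A" "c \<in> set (sorted_list_of_set {q. (q, p) \<in> perm_diagram d v})" "z < c"
    hence "(c, p) \<in> perm_diagram d v" using fin by simp
    moreover have "p \<in> {1..d}" "col_blk n r p = m" using p assms cols_iff[of m p] by auto
    moreover have "z \<in> {1..d}" "one_col z < m" using z assms by auto
    ultimately have "(z, p) \<in> perm_diagram d v" using row_blk_mono[of z c n r] z(3) by (auto simp: diagram_iff)
    then show "z \<in> set (sorted_list_of_set {q. (q, p) \<in> perm_diagram d v})" using fin by simp
  qed
  then show "sorted_wrt (<) (key_col m @ c) \<and> init_seg (key_col m @ c) A" unfolding eq by simp
qed

lemma set_full_blks: "m \<le> n \<Longrightarrow> set (concat (full_blks m)) \<subseteq> {q \<in> {1..d}. row_blk r q < n \<and> one_col q < m}"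
proof (induction m)
  case (Suc m)
  have fin: "finite {q. (q, p) \<in> perm_diagram d v}" for p
    by (rule finite_subset[of _ "{1..d}"]) (auto simp: diagram_iff)
  have "set (concat (full_blk (Suc m))) \<subseteq> {q \<in> {1..d}. row_blk r q < n \<and> one_col q < Suc m}"
    using Suc.prems one_row_le_n by (fastforce simp: full_blk_def fin cols_iff diagram_iff)
  then show ?case using Suc by auto
qed simp

text \<open>\<open>y\<close> is what the block columns further left have left over. Its letters lie
  in block rows from \<open>m\<close> on, beyond all rows of \<open>key_col m\<close>, as
  \<open>peels_restrict\<close> requires.\<close>

lemma full_elim:
  assumes "m \<le> n" "peels (full_blks m) (y @ cword (stack V m @ R)) []" "tabl (stack V m @ R)"
    "\<forall>i\<in>{1..m}. length (V i) = r i i" "set y \<subseteq> {q. m \<le> row_blk r q}"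
  shows "\<exists>W Y. Y (Suc m) = y \<and> Y 1 = [] \<and> cword R = [] \<and>
    (\<forall>i\<in>{1..m}. V i = map ((@) (key_col i)) (W i) \<and> peels (blk 0 i) (Y (Suc i) @ cword (W i)) (Y i) \<and>
      set (cword (W i)) \<subseteq> letters 0 i i \<and> set (Y i) \<subseteq> letters 0 i (i - 1))"
  using assms
proof (induction m arbitrary: y)
  case 0
  then show ?case by (intro exI[of _ "\<lambda>_. []"]) auto
next
  case (Suc m)
  let ?K = "key_col (Suc m)"
  have m: "Suc m \<in> {1..n}" using Suc.prems by auto
  have letters: "set (y @ cword (stack V (Suc m) @ R)) \<subseteq> {q \<in> {1..d}. row_blk r q < n \<and> one_col q < Suc m}"
    using peels_set[OF Suc.prems(2)] set_full_blks[OF Suc.prems(1)] by auto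
  obtain X' where X': "peels (map ((@) ?K) (blk 0 (Suc m))) (y @ cword (V (Suc m) @ (stack V m @ R))) X'"
    "peels (full_blks m) X' []"
    using Suc.prems(2) full_blk_eq[OF m] by (auto simp: peels_append)
  have "\<exists>Q Z. V (Suc m) = map ((@) ?K) Q \<and> peels (blk 0 (Suc m)) (y @ cword Q) Z \<and> X' \<sim> Z @ cword (stack V m @ R)"
  proof (rule peels_restrict[OF X'(1)])
    show "length (V (Suc m)) = length (blk 0 (Suc m))" using Suc.prems(4) by auto
    show "tabl (V (Suc m) @ stack V m @ R)" using Suc.prems(3) by simp
    show "\<forall>s\<in>set ?K. \<forall>z\<in>set y. s < z"
    proof (intro ballI)
      fix s z assume "s \<in> set ?K" "z \<in> set y"
      then show "s < z" using letters Suc.prems(5) row_blk_mono[of z s n r] by (force simp: key_col_iff[OF m])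
    qed
    show "\<forall>c\<in>set (blk 0 (Suc m)). sorted_wrt (<) (?K @ c) \<and>
        init_seg (?K @ c) (set y \<union> set (cword (V (Suc m) @ stack V m @ R)))"
      using letters by (intro full_blk_cond[OF m]) auto
  qed
  then obtain Q Z where Q: "V (Suc m) = map ((@) ?K) Q" "peels (blk 0 (Suc m)) (y @ cword Q) Z"
    "X' \<sim> Z @ cword (stack V m @ R)" by blast
  have setQ: "set (cword Q) \<subseteq> letters 0 (Suc m) (Suc m)"
  proof
    fix z assume "z \<in> set (cword Q)"
    then obtain w' where w': "w' \<in> set Q" "z \<in> set w'" by (auto simp: set_cword)
    have "sorted_wrt (<) (?K @ w')" using tabl_sorted[OF Suc.prems(3), of "?K @ w'"] Q(1) w' by auto
    hence "z \<notin> set ?K" using w'(2) by (auto simp: sorted_wrt_append)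
    moreover have "z \<in> {q \<in> {1..d}. row_blk r q < n \<and> one_col q < Suc m}" 
      using letters Q(1) w' in_cword[of "?K @ w'" "stack V (Suc m) @ R" z] by auto
    ultimately show "z \<in> letters 0 (Suc m) (Suc m)" by (auto simp: letters_def key_col_iff[OF m])
  qed
  have pZ: "peels (full_blks m) (Z @ cword (stack V m @ R)) []" using peels_cong[OF X'(2) Q(3) knuth_refl] .
  have "set Z \<subseteq> set y \<union> set (cword Q)" using peels_set[OF Q(2)] by auto
  hence setZ: "set Z \<subseteq> {q. m \<le> row_blk r q}" using Suc.prems(5) setQ by (fastforce simp: letters_def)
  \<comment> \<open>\<open>Z\<close> must be consumed by block columns \<open>m, ..., 1\<close>, so
    each of its letters is a row of the diagram there, which bounds \<open>one_col\<close>.\<close>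
  have "set Z \<subseteq> {q \<in> {1..d}. row_blk r q < n \<and> one_col q < m}"
    using peels_set[OF pZ] set_full_blks[of m] Suc.prems(1) by auto
  hence setZ': "set Z \<subseteq> letters 0 (Suc m) m" using setZ by (auto simp: letters_def)
  obtain W Y where IH: "Y (Suc m) = Z" "Y 1 = []" "cword R = []"
    "\<forall>i\<in>{1..m}. V i = map ((@) (key_col i)) (W i) \<and> peels (blk 0 i) (Y (Suc i) @ cword (W i)) (Y i) \<and>
      set (cword (W i)) \<subseteq> letters 0 i i \<and> set (Y i) \<subseteq> letters 0 i (i - 1)"
    using Suc.IH[OF _ pZ _ _ setZ] Suc.prems tabl_appendD[of "V (Suc m)" "stack V m @ R"] by auto
  show ?case
  proof (intro exI[of _ "W(Suc m := Q)"] exI[of _ "Y(Suc (Suc m) := y)"] conjI ballI)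
    fix i assume i: "i \<in> {1..Suc m}"
    show "V i = map ((@) (key_col i)) ((W(Suc m := Q)) i)"
      "peels (blk 0 i) ((Y(Suc (Suc m) := y)) (Suc i) @ cword ((W(Suc m := Q)) i)) ((Y(Suc (Suc m) := y)) i)"
      "set (cword ((W(Suc m := Q)) i)) \<subseteq> letters 0 i i" "set ((Y(Suc (Suc m) := y)) i) \<subseteq> letters 0 i (i - 1)"
      using IH Q setQ setZ' i by (cases "i = Suc m"; simp)+
  qed (use IH in auto)
qed

text \<open>\<open>cword_prefix_out\<close> gathers the copies of \<open>key_col\<close> behind the
  word of \<open>W m\<close>; \<open>peels_extend\<close> then applies, with the words of the block
  columns further right as the untouched suffix.\<close>

lemma full_intro:
  assumes "m \<le> n" "Y 1 = []"
    "\<forall>i\<in>{1..m}. length (W i) = r i i \<and> tabl (map ((@) (key_col i)) (W i)) \<and>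
      peels (blk 0 i) (Y (Suc i) @ cword (W i)) (Y i) \<and>
      set (cword (W i)) \<subseteq> letters 0 i i \<and> set (Y (Suc i)) \<subseteq> letters 0 (Suc i) i"
  shows "peels (full_blks m) (Y (Suc m) @ cword (stack (\<lambda>i. map ((@) (key_col i)) (W i)) m)) [] \<and>
    set (cword (stack (\<lambda>i. map ((@) (key_col i)) (W i)) m)) \<subseteq> {q \<in> {1..d}. one_col q < m}"
  using assms
proof (induction m)
  case (Suc m)
  let ?K = "key_col (Suc m)"
  let ?G = "\<lambda>i. map ((@) (key_col i)) (W i)"
  let ?P = "cword (stack ?G m)"
  have m: "Suc m \<in> {1..n}" using Suc.prems by auto
  have IH: "peels (full_blks m) (Y (Suc m) @ ?P) []" "set ?P \<subseteq> {q \<in> {1..d}. one_col q < m}"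
    using Suc by auto
  have W: "length (W (Suc m)) = r (Suc m) (Suc m)" "tabl (map ((@) ?K) (W (Suc m)))"
      "peels (blk 0 (Suc m)) (Y (Suc (Suc m)) @ cword (W (Suc m))) (Y (Suc m))"
      "set (cword (W (Suc m))) \<subseteq> letters 0 (Suc m) (Suc m)" "set (Y (Suc (Suc m))) \<subseteq> letters 0 (Suc (Suc m)) (Suc m)"
    using Suc.prems(3) by auto
  have K: "set ?K \<subseteq> {q \<in> {1..d}. one_col q < Suc m}" using one_col_le by (force simp: key_col_iff[OF m])
  let ?X = "Y (Suc (Suc m)) @ cword (W (Suc m))"
  have "peels (map ((@) ?K) (blk 0 (Suc m))) (?X @ concat (replicate (length (blk 0 (Suc m))) (rev ?K)) @ ?P) (Y (Suc m) @ ?P)"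
  proof (rule peels_extend[OF W(3)])
    show "\<forall>c\<in>set (blk 0 (Suc m)). sorted_wrt (<) (?K @ c) \<and> init_seg (?K @ c) (set ?K \<union> set ?X \<union> set ?P)"
      using K IH(2) W(4,5) by (intro full_blk_cond[OF m]) (auto simp: letters_def)
    show "\<forall>s\<in>set ?K. \<forall>z\<in>set ?X. s < z"
    proof (intro ballI)
      fix s z assume "s \<in> set ?K" "z \<in> set ?X"
      then show "s < z" using W(4,5) row_blk_mono[of z s n r] by (force simp: key_col_iff[OF m] letters_def)
    qed
  qed
  moreover have "?X @ concat (replicate (length (blk 0 (Suc m))) (rev ?K)) @ ?P \<sim> Y (Suc (Suc m)) @ cword (?G (Suc m)) @ ?P"
    using knuth_cong[OF knuth_refl knuth_cong[OF knuth_sym[OF cword_prefix_out[OF W(2)]] knuth_refl], of "Y (Suc (Suc m))" ?P] W(1)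
    by simp
  ultimately have "peels (full_blk (Suc m)) (Y (Suc (Suc m)) @ cword (?G (Suc m)) @ ?P) (Y (Suc m) @ ?P)"
    unfolding full_blk_eq[OF m] using peels_cong knuth_refl by blast
  then have "peels (full_blks (Suc m)) (Y (Suc (Suc m)) @ cword (stack ?G (Suc m))) []"
    using IH(1) by (auto simp: peels_append)
  moreover have "set (cword (?G (Suc m))) \<subseteq> set ?K \<union> set (cword (W (Suc m)))" by (auto simp: set_cword)
  ultimately show ?case using K IH(2) W(4) by (auto simp: letters_def)
qed simp

text \<open>The letters of \<open>w m\<close> lie in block rows from \<open>m - 1\<close> on.
  Peeling everything removes an increasing subsequence of them at most one letter per column, and
  only columns \<open>p\<close> with \<open>m \<le> one_row p\<close> contain such letters; in block
  columns up to \<open>m\<close> there are \<open>r m m\<close> of these.\<close>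

lemma good_width:
  assumes "good 0 w" "m \<in> {1..n}" "subseq s (w m)" "sorted s"
  shows "length s \<le> r m m"
proof -
  obtain Y where Y: "Y 1 = []" "\<And>m. m \<in> {1..n} \<Longrightarrow> peels (blk 0 m) (Y (Suc m) @ w m) (Y m)"
    "\<And>m. m \<in> {1..n} \<Longrightarrow> set (w m) \<subseteq> letters 0 m m"
    using assms(1) unfolding good_def by auto
  let ?M = "row_offset r (m - 1)"
  have above: "?M < q \<longleftrightarrow> m \<le> Suc (row_blk r q)" if "q \<in> {1..d}" for q
    using row_blk_less_iff[OF that, of "m - 1"] assms(2) by auto
  \<comment> \<open>The bound is generalised to every block column \<open>i\<close>, since the
    leftover of one block column enters the next.\<close>
  have "i \<in> {1..n} \<Longrightarrow> increasing_in ?M k (Y (Suc i) @ w i) \<Longrightarrow>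
    k \<le> card {p \<in> {1..d}. col_blk n r p \<le> i \<and> m \<le> one_row p}" for k i
  proof (induction i arbitrary: k)
    case (Suc i)
    note i = Suc.prems(1)
    from Suc.prems(2) obtain l where l: "increasing_in ?M l (Y (Suc i))"
      "k \<le> l + length (filter (\<lambda>C. \<exists>c\<in>set C. ?M < c) (blk 0 (Suc i)))"
      using increasing_in_peels[OF Y(2)[OF i]] by blast
    have *: "m \<le> one_row p" if "c \<in> colset 0 (Suc i) p" "?M < c" for p c
      using that above[of c] by (auto simp: colset_def)
    let ?f = "\<lambda>p. \<exists>c\<in>colset 0 (Suc i) p. ?M < c"
    have "length (filter (\<lambda>C. \<exists>c\<in>set C. ?M < c) (blk 0 (Suc i))) = length (filter ?f (cols (Suc i)))"
      by (simp add: blk_def filter_map o_def)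
    also have "\<dots> = card (set (filter ?f (cols (Suc i))))"
      by (rule distinct_card[symmetric]) (simp add: cols_def)
    also have "\<dots> \<le> card {p \<in> {1..d}. col_blk n r p = Suc i \<and> m \<le> one_row p}"
      using i * by (intro card_mono) (auto simp: cols_iff)
    moreover have "l \<le> card {p \<in> {1..d}. col_blk n r p \<le> i \<and> m \<le> one_row p}"
    proof (cases "i = 0")
      case True
      then show ?thesis using l(1) Y(1) by (auto simp: increasing_in_def dest: list_emb_Nil2)
    next
      case False
      moreover have "increasing_in ?M l (Y (Suc i) @ w i)"
        using l(1) subseq_rev_drop_many by (fastforce simp: increasing_in_def)
      ultimately show ?thesis using Suc.IH[of l] i by simp
    qed
    ultimately have "k \<le> card {p \<in> {1..d}. col_blk n r p \<le> i \<and> m \<le> one_row p} + card {p \<in> {1..d}. col_blk n r p = Suc i \<and> m \<le> one_row p}"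
      using l(2) by linarith
    also have "\<dots> = card ({p \<in> {1..d}. col_blk n r p \<le> i \<and> m \<le> one_row p} \<union> {p \<in> {1..d}. col_blk n r p = Suc i \<and> m \<le> one_row p})"
      by (rule card_Un_disjoint[symmetric]) auto
    also have "\<dots> = card {p \<in> {1..d}. col_blk n r p \<le> Suc i \<and> m \<le> one_row p}"
      by (rule arg_cong[where f = card]) auto
    finally show ?case .
  qed simp
  moreover have "\<forall>z\<in>set s. ?M < z"
  proof
    fix z assume "z \<in> set s"
    then have "z \<in> letters 0 m m" using set_subseq[OF assms(3)] Y(3)[OF assms(2)] by auto
    then show "?M < z" using above[of z] by (simp add: letters_def)
  qed
  moreover have "subseq s (Y (Suc m) @ w m)" using assms(3) by (rule subseq_drop_many)
  ultimately have "length s \<le> card {p \<in> {1..d}. col_blk n r p \<le> m \<and> m \<le> one_row p}"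
    using assms(2,4) unfolding increasing_in_def by blast
  then show ?thesis using card_ones_cols[of m] assms(2) by simp
qed

end

section \<open>Fillings\<close>

lemma col_le_refl [simp]: "col_le x x"
  by (simp add: col_le_iff)

lemma col_le_trans: "col_le x y \<Longrightarrow> col_le y z \<Longrightarrow> col_le x z"
  unfolding col_le_iff by (meson le_trans less_le_trans)

lemma tabl_iff: "tabl ys \<longleftrightarrow> (\<forall>y\<in>set ys. sorted_wrt (<) y) \<and> sorted_wrt col_le ys"
proof (induction ys rule: tabl.induct)
  case (3 x y ys)
  then show ?case by (auto intro: col_le_trans)
qed auto

lemma col_le_append_same [simp]: "col_le (S @ x) (S @ y) \<longleftrightarrow> col_le x y"
  by (induction S) auto

definition column :: "filling \<Rightarrow> nat \<Rightarrow> nat list" where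
  "column F k = map (\<lambda>a. the (F (a, k))) (sorted_list_of_set {a. (a, k) \<in> dom F})"

lemma column_empty: "k \<notin> snd ` dom F \<Longrightarrow> column F k = []"
proof -
  assume "k \<notin> snd ` dom F"
  hence "{a. (a, k) \<in> dom F} = {}" by force
  then show ?thesis by (simp add: column_def)
qed

text \<open>Any interval containing the occupied columns will do, as empty columns contribute
  nothing to the word.\<close>

lemma column_word_eq:
  assumes "finite (dom F)" "snd ` dom F \<subseteq> {a..<b}"
  shows "column_word F = cword (map (column F) [a..<b])"
proof -
  have sl: "sorted_list_of_set (snd ` dom F) = filter (\<lambda>k. k \<in> snd ` dom F) [a..<b]"
  proof (rule sorted_distinct_set_unique)
    have "set (filter (\<lambda>k. k \<in> snd ` dom F) [a..<b]) = {a..<b} \<inter> snd ` dom F" by auto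
    then show "set (sorted_list_of_set (snd ` dom F)) = set (filter (\<lambda>k. k \<in> snd ` dom F) [a..<b])"
      using assms by (simp add: inf.absorb2)
  qed (use assms in \<open>auto simp: sorted_wrt_filter\<close>)
  have *: "concat (map f (filter P xs)) = concat (map f xs)" if "\<forall>x. \<not> P x \<longrightarrow> f x = []"
    for f :: "nat \<Rightarrow> nat list" and P xs using that by (induction xs) auto
  have "column_word F = concat (map (\<lambda>k. rev (column F k)) (sorted_list_of_set (snd ` dom F)))"
    by (simp add: column_word_def column_def rev_map)
  also have "\<dots> = concat (map (\<lambda>k. rev (column F k)) [a..<b])"
    unfolding sl by (rule *) (use column_empty in auto)
  finally show ?thesis by (simp add: cword_def o_def)
qed

definition fill :: "nat list list \<Rightarrow> filling" where
  "fill ys = (\<lambda>(a, b). if b \<in> {1..length ys} \<and> a \<in> {1..length (ys ! (b - 1))}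
     then Some (ys ! (b - 1) ! (a - 1)) else None)"

lemma dom_fill: "dom (fill ys) = {(a, b). b \<in> {1..length ys} \<and> a \<in> {1..length (ys ! (b - 1))}}"
  by (auto simp: fill_def split: if_splits)

lemma finite_dom_fill: "finite (dom (fill ys))"
proof -
  have "dom (fill ys) = (\<Union>b\<in>{1..length ys}. (\<lambda>a. (a, b)) ` {1..length (ys ! (b - 1))})"
    unfolding dom_fill by auto
  then show ?thesis by simp
qed

lemma column_fill: "column (fill ys) k = (if k \<in> {1..length ys} then ys ! (k - 1) else [])"
proof (cases "k \<in> {1..length ys}")
  case True
  have "{a. (a, k) \<in> dom (fill ys)} = {1..<Suc (length (ys ! (k - 1)))}"
    using True by (auto simp: dom_fill)
  hence "column (fill ys) k = map (\<lambda>a. the (fill ys (a, k))) [1..<Suc (length (ys ! (k - 1)))]"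
    by (simp add: column_def del: upt_Suc)
  also have "\<dots> = ys ! (k - 1)"
    using True by (intro nth_equalityI) (auto simp: fill_def simp del: upt_Suc)
  finally show ?thesis using True by simp
next
  case False
  then have "k \<notin> snd ` dom (fill ys)" by (auto simp: dom_fill)
  then show ?thesis using False by (auto simp: column_empty)
qed

lemma map_column_fill: "map (column (fill ys)) [1..<Suc (length ys)] = ys"
  by (rule nth_equalityI) (auto simp: column_fill simp del: upt_Suc)

lemma column_word_fill: "column_word (fill ys) = cword ys"
proof -
  have "snd ` dom (fill ys) \<subseteq> {1..<Suc (length ys)}" by (auto simp: dom_fill)
  then show ?thesis using column_word_eq[OF finite_dom_fill] map_column_fill by metis
qed

lemma tableau_fill: "tabl ys \<Longrightarrow> tableau (fill ys)"
proof -
  assume t: "tabl ys"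
  have srt: "sorted_wrt (<) (ys ! i)" if "i < length ys" for i using t that by (simp add: tabl_sorted)
  have le: "col_le (ys ! i) (ys ! j)" if "i \<le> j" "j < length ys" for i j
    using t that sorted_wrt_nth_less[of col_le ys i j] by (cases "i = j") (auto simp: tabl_iff)
  show ?thesis
    unfolding tableau_def young_diagram_def semistandard_def
  proof (intro conjI allI impI)
    fix a b a' b' assume *: "(a, b) \<in> dom (fill ys) \<and> a' \<in> {1..a} \<and> b' \<in> {1..b}"
    then have "col_le (ys ! (b' - 1)) (ys ! (b - 1))" by (intro le) (auto simp: dom_fill)
    then show "(a', b') \<in> dom (fill ys)" using * by (auto simp: dom_fill dest: col_le_length)
  next
    fix a b b' x y assume *: "b < b' \<and> fill ys (a, b) = Some x \<and> fill ys (a, b') = Some y"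
    then have "col_le (ys ! (b - 1)) (ys ! (b' - 1))" by (intro le) (auto simp: fill_def split: if_splits)
    then show "x \<le> y" using * by (auto simp: fill_def col_le_iff split: if_splits)
  next
    fix a a' b x y assume *: "a < a' \<and> fill ys (a, b) = Some x \<and> fill ys (a', b) = Some y"
    then show "x < y" using sorted_wrt_nth_less[OF srt[of "b - 1"], of "a - 1" "a' - 1"]
      by (auto simp: fill_def split: if_splits)
  next
    show "finite (dom (fill ys))" by (rule finite_dom_fill)
  qed (auto simp: dom_fill)
qed

lemma tableau_dom:
  assumes "tableau F" "(a, b) \<in> dom F"
  shows "1 \<le> a" "1 \<le> b" "a' \<in> {1..a} \<Longrightarrow> b' \<in> {1..b} \<Longrightarrow> (a', b') \<in> dom F"
proof -
  have y: "young_diagram (dom F)" using assms(1) by (simp add: tableau_def)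
  then show "1 \<le> a" "1 \<le> b" using assms(2) unfolding young_diagram_def by auto
  show "a' \<in> {1..a} \<Longrightarrow> b' \<in> {1..b} \<Longrightarrow> (a', b') \<in> dom F"
    using y assms(2) unfolding young_diagram_def by blast
qed

lemma tableau_column:
  assumes "tableau F"
  shows "F (a, k) = (if a \<in> {1..length (column F k)} then Some (column F k ! (a - 1)) else None)"
    and "sorted_wrt (<) (column F k)"
proof -
  let ?A = "{a. (a, k) \<in> dom F}"
  have "finite (dom F)" using assms by (simp add: tableau_def young_diagram_def)
  hence fin: "finite ?A" by (rule finite_surj[of _ _ fst]) force
  have cl: "a' \<in> ?A" if "a \<in> ?A" "a' \<in> {1..a}" for a a'
    using tableau_dom(2)[OF assms, of a k] tableau_dom(3)[OF assms, of a k a' k] that by simp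
  have pos: "a \<ge> 1" if "a \<in> ?A" for a using that tableau_dom(1)[OF assms] by blast
  \<comment> \<open>A column of a Young diagram occupies an initial interval of rows.\<close>
  have A: "?A = {1..<Suc (card ?A)}"
  proof (cases "?A = {}")
    case False
    define M where "M = Max ?A"
    have M: "M \<in> ?A" "\<And>a. a \<in> ?A \<Longrightarrow> a \<le> M"
      using Max_in[OF fin False] Max_ge[OF fin] by (auto simp: M_def)
    have eq: "?A = {1..M}"
    proof (intro equalityI subsetI)
      fix a assume "a \<in> ?A" then show "a \<in> {1..M}" using M(2) pos by simp
    next
      fix a assume "a \<in> {1..M}" then show "a \<in> ?A" by (rule cl[OF M(1)])
    qed
    then have "card ?A = M" by simp
    then show ?thesis using eq by (simp add: atLeastLessThanSuc_atLeastAtMost)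
  qed simp
  have "sorted_list_of_set ?A = [1..<Suc (card ?A)]"
    using arg_cong[OF A, of sorted_list_of_set] by (simp del: upt_Suc)
  hence col: "column F k = map (\<lambda>a. the (F (a, k))) [1..<Suc (card ?A)]"
    unfolding column_def by (rule arg_cong)
  have len: "length (column F k) = card ?A" unfolding col by simp
  show "F (a, k) = (if a \<in> {1..length (column F k)} then Some (column F k ! (a - 1)) else None)"
  proof (cases "a \<in> ?A")
    case True
    then have "a \<in> {1..<Suc (card ?A)}" using A by blast
    then show ?thesis using True len by (auto simp: col simp del: upt_Suc)
  next
    case False
    then have "a \<notin> {1..<Suc (card ?A)}" using A by blast
    then show ?thesis using False len by auto
  qed
  show "sorted_wrt (<) (column F k)"
    unfolding sorted_wrt_iff_nth_less
  proof (intro allI impI)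
    fix i j assume ij: "i < j" "j < length (column F k)"
    have "Suc i \<in> ?A" "Suc j \<in> ?A" using ij len A by auto
    then obtain x y where "F (Suc i, k) = Some x" "F (Suc j, k) = Some y" by auto
    moreover have "semistandard F" using assms by (simp add: tableau_def)
    moreover from calculation have "x < y" using ij(1) unfolding semistandard_def by (meson Suc_less_eq)
    ultimately show "column F k ! i < column F k ! j" using ij len by (simp add: col del: upt_Suc)
  qed
qed

lemma tableau_tabl:
  assumes "tableau F" "snd ` dom F \<subseteq> {1..<Suc N}"
  shows "tabl (map (column F) [1..<Suc N])" "F = fill (map (column F) [1..<Suc N])"
    "column_word F = cword (map (column F) [1..<Suc N])"
proof -
  have "col_le (column F k) (column F k')" if k: "k < k'" "1 \<le> k" for k k'
  proof -
    have cl: "(a, k') \<in> dom F \<Longrightarrow> (a, k) \<in> dom F" for a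
      using tableau_dom(1)[OF assms(1), of a k'] tableau_dom(3)[OF assms(1), of a k' a k] k by simp
    show ?thesis
      unfolding col_le_iff
    proof (intro conjI allI impI)
      show "length (column F k') \<le> length (column F k)"
        using cl[of "length (column F k')"] tableau_column(1)[OF assms(1)]
        by (cases "length (column F k') = 0") (auto simp: dom_def split: if_splits)
      fix a assume a: "a < length (column F k')"
      have 1: "F (Suc a, k') = Some (column F k' ! a)" using a tableau_column(1)[OF assms(1), of "Suc a" k'] by simp
      then have "(Suc a, k) \<in> dom F" using cl[of "Suc a"] by auto
      then have 2: "F (Suc a, k) = Some (column F k ! a)"
        using tableau_column(1)[OF assms(1), of "Suc a" k] by (auto split: if_splits)
      show "column F k ! a \<le> column F k' ! a"
        using 1 2 k assms(1) unfolding tableau_def semistandard_def by blast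
    qed
  qed
  then show "tabl (map (column F) [1..<Suc N])"
    unfolding tabl_iff sorted_wrt_map using tableau_column(2)[OF assms(1)]
    by (auto simp: sorted_wrt_iff_nth_less[of _ "[_..<_]"] simp del: upt_Suc)
  show "F = fill (map (column F) [1..<Suc N])"
  proof
    fix x :: box obtain a b where x: "x = (a, b)" by (cases x)
    show "F x = fill (map (column F) [1..<Suc N]) x"
    proof (cases "b \<in> {1..<Suc N}")
      case True
      then have "map (column F) [1..<Suc N] ! (b - 1) = column F b"
        by (subst nth_map) (auto simp del: upt_Suc)
      then show ?thesis using True tableau_column(1)[OF assms(1), of a b] unfolding x fill_def by auto
    next
      case False
      then have "(a, b) \<notin> dom F" using assms(2) by force
      then show ?thesis using False by (auto simp: x fill_def)
    qed
  qed
  show "column_word F = cword (map (column F) [1..<Suc N])"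
    using assms by (intro column_word_eq) (auto simp: tableau_def young_diagram_def)
qed

lemma tableau_bound: "tableau F \<Longrightarrow> \<exists>N\<ge>M. snd ` dom F \<subseteq> {1..<Suc N}"
proof -
  assume t: "tableau F"
  hence fin: "finite (snd ` dom F)" and pos: "snd ` dom F \<subseteq> {1..}"
    by (auto simp: tableau_def young_diagram_def)
  have "snd ` dom F \<subseteq> {1..<Suc (max M (Max (snd ` dom F)))}"
  proof
    fix k assume "k \<in> snd ` dom F"
    then show "k \<in> {1..<Suc (max M (Max (snd ` dom F)))}" using Max_ge[OF fin] pos by (auto simp: le_max_iff_disj less_Suc_eq_le)
  qed
  then show ?thesis by (meson max.cobounded1)
qed

lemma tableau_word_unique:
  assumes "tableau F" "tableau G" "column_word F \<sim> column_word G"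
  shows "F = G"
proof -
  obtain M where M: "snd ` dom F \<subseteq> {1..<Suc M}" using tableau_bound[OF assms(1)] by blast
  obtain N where N: "N \<ge> M" "snd ` dom G \<subseteq> {1..<Suc N}" using tableau_bound[OF assms(2)] by blast
  have M': "snd ` dom F \<subseteq> {1..<Suc N}" using M N(1) by fastforce
  note f = tableau_tabl[OF assms(1) M'] and g = tableau_tabl[OF assms(2) N(2)]
  have "map (column F) [1..<Suc N] = map (column G) [1..<Suc N]"
    using f(1,3) g(1,3) assms(3) by (intro tabl_unique) auto
  then show ?thesis using f(2) g(2) by metis
qed

text \<open>Column insertion gives existence and \<open>tabl_unique\<close> gives uniqueness, so the
  definite description in \<open>tableau_of\<close> is meaningful.\<close>

lemma tableau_of_props: "tableau (tableau_of u)" "column_word (tableau_of u) \<sim> u"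
proof -
  obtain ys where "tabl ys" "u \<sim> cword ys" using tabl_exists by blast
  then have ex: "tableau (fill ys) \<and> column_word (fill ys) \<sim> u"
    by (simp add: tableau_fill column_word_fill knuth_sym)
  then have "\<exists>!F. tableau F \<and> column_word F \<sim> u"
    using tableau_word_unique knuth_sym knuth_trans by (intro ex_ex1I) (blast, meson)
  from theI'[OF this] show "tableau (tableau_of u)" "column_word (tableau_of u) \<sim> u"
    by (auto simp: tableau_of_def)
qed

lemma tableau_of_eq: "tableau F \<Longrightarrow> column_word F \<sim> u \<Longrightarrow> tableau_of u = F"
  using tableau_word_unique[OF tableau_of_props(1)] tableau_of_props(2) knuth_sym knuth_trans by meson

lemma tableau_of_cong: "u \<sim> v \<Longrightarrow> tableau_of u = tableau_of v"
  using tableau_of_eq[OF tableau_of_props(1)] tableau_of_props(2) knuth_sym knuth_trans by meson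

lemma fill_Nil [simp]: "fill [] = Map.empty"
  by (auto simp: fill_def)

lemma tableau_empty [simp]: "tableau Map.empty"
  using tableau_fill[of "[]"] by simp

lemma column_word_empty [simp]: "column_word Map.empty = []"
  using column_word_fill[of "[]"] by simp

section \<open>Peelability in terms of words\<close>

lemma column_tableau_fill: "column_tableau C = fill [sorted_list_of_set (fst ` C)]"
  if "inj_on fst C" "finite C"
  using that by (auto simp: column_tableau_def fill_def card_image fun_eq_iff)

text \<open>The bridge from \<open>peelable\<close> to \<open>step\<close>: for the word of a
  tableau, \<open>first_col\<close> is the actual first column, and \<open>rest_word\<close> is the
  word of the other columns.\<close>

lemma peel_column:
  assumes Q: "tableau Q"
  shows "fill [C] \<subseteq>\<^sub>m Q \<longleftrightarrow> (\<exists>x. first_col (column_word Q) = C @ x)"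
    and "first_col (column_word Q) = C @ x \<Longrightarrow>
      column_word (remove_sub Q (fill [C])) = rev x @ rest_word (column_word Q)"
proof -
  obtain N where N: "N \<ge> 1" "snd ` dom Q \<subseteq> {1..<Suc N}" using tableau_bound[OF Q] by blast
  have upt: "[1..<Suc N] = 1 # [2..<Suc N]" using N(1) by (metis Suc_1 One_nat_def upt_conv_Cons le_imp_less_Suc)
  have t: "tabl (column Q 1 # map (column Q) [2..<Suc N])"
    "column_word Q = cword (column Q 1 # map (column Q) [2..<Suc N])"
    using tableau_tabl[OF Q N(2)] unfolding upt by simp_all
  have fc: "first_col (column_word Q) = column Q 1" "rest_word (column_word Q) = cword (map (column Q) [2..<Suc N])"
    using first_col_tabl[OF t(1)] rest_word_tabl[OF t(1)] t(2) by auto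
  note Q1 = tableau_column(1)[OF Q, of _ 1]
  show "fill [C] \<subseteq>\<^sub>m Q \<longleftrightarrow> (\<exists>x. first_col (column_word Q) = C @ x)"
  proof
    assume sub: "fill [C] \<subseteq>\<^sub>m Q"
    have eq: "Q (Suc a, 1) = Some (C ! a)" if "a < length C" for a
    proof -
      have "(Suc a, 1) \<in> dom (fill [C])" using that by (simp add: dom_fill)
      then have "fill [C] (Suc a, 1) = Q (Suc a, 1)" using sub unfolding map_le_def by blast
      then show ?thesis using that by (simp add: fill_def)
    qed
    have "length C \<le> length (column Q 1)"
      using eq[of "length C - 1"] Q1[of "length C"] by (cases "C = []") (auto split: if_splits)
    moreover have "C ! a = column Q 1 ! a" if "a < length C" for a
      using eq[OF that] Q1[of "Suc a"] by (auto split: if_splits)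
    ultimately have "C = take (length C) (column Q 1)" by (intro nth_equalityI) auto
    then show "\<exists>x. first_col (column_word Q) = C @ x" using fc(1) by (metis append_take_drop_id)
  next
    assume "\<exists>x. first_col (column_word Q) = C @ x"
    then obtain x where x: "column Q 1 = C @ x" using fc by auto
    show "fill [C] \<subseteq>\<^sub>m Q"
      unfolding map_le_def dom_fill
    proof (clarsimp)
      fix a assume a: "Suc 0 \<le> a" "a \<le> length C"
      then show "fill [C] (a, Suc 0) = Q (a, Suc 0)"
        using Q1[of a] x by (auto simp: fill_def nth_append)
    qed
  qed
  assume "first_col (column_word Q) = C @ x"
  then have x: "column Q 1 = C @ x" using fc by auto
  let ?R = "remove_sub Q (fill [C])"
  have domR: "dom ?R = dom Q - {(a, b). b = 1 \<and> a \<in> {1..length C}}"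
    unfolding remove_sub_def dom_restrict dom_fill by auto
  have RQ: "?R (a, b) = Q (a, b)" if "b \<noteq> 1 \<or> a \<notin> {1..length C}" for a b
    using that by (auto simp: remove_sub_def restrict_map_def dom_fill)
  have R2: "column ?R k = column Q k" if "k \<noteq> 1" for k
    using that RQ by (simp add: column_def domR)
  have "{a. (a, 1) \<in> dom ?R} = {Suc (length C)..<Suc (length (C @ x))}"
    using Q1 x unfolding domR by (fastforce split: if_splits)
  hence "column ?R 1 = map (\<lambda>a. the (?R (a, 1))) [Suc (length C)..<Suc (length (C @ x))]"
    unfolding column_def by (metis sorted_list_of_set_range)
  also have "\<dots> = x"
    using Q1 x RQ by (intro nth_equalityI) (auto simp: nth_append simp del: upt_Suc)
  finally have R1: "column ?R 1 = x" .
  have "finite (dom ?R)" "snd ` dom ?R \<subseteq> {1..<Suc N}"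
    using Q N(2) unfolding domR by (auto simp: tableau_def young_diagram_def)
  then have "column_word ?R = rev (column ?R 1) @ cword (map (column ?R) [2..<Suc N])"
    using column_word_eq[of ?R 1 "Suc N"] unfolding upt by (simp del: upt_Suc)
  moreover have "map (column ?R) [2..<Suc N] = map (column Q) [2..<Suc N]"
    using R2 by (intro map_cong) auto
  ultimately show "column_word ?R = rev x @ rest_word (column_word Q)"
    by (simp only: R1 fc)
qed

lemma peelable_empty_iff: "peelable {} Q \<longleftrightarrow> Q = Map.empty"
  by (auto elim: peelable.cases intro: peelable_empty)

lemma peelable_step_iff:
  assumes "finite D" "D \<noteq> {}"
  shows "peelable D Q \<longleftrightarrow> tableau Q \<and> column_tableau (first_column D) \<subseteq>\<^sub>m Q \<and>
     peelable (D - first_column D)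
       (tableau_of (column_word (remove_sub Q (column_tableau (first_column D)))))"
  using assms by (auto elim: peelable.cases intro: peelable_step)

text \<open>Grid columns without boxes appear on the right as empty columns, for which a step
  changes nothing. This allows a range of columns independent of the diagram.\<close>

lemma peelable_iff_peels:
  assumes "finite D" "snd ` D \<subseteq> {a..<b}"
  shows "peelable D Q \<longleftrightarrow> tableau Q \<and> peels (map (\<lambda>p. sorted_list_of_set {q. (q, p) \<in> D}) [a..<b]) (column_word Q) []"
  using assms
proof (induction "b - a" arbitrary: a D Q)
  case 0
  hence D: "D = {}" by auto
  have "Q = Map.empty" if "tableau Q" "column_word Q = []"
    using tableau_word_unique[of Q Map.empty] that by simp
  then show ?case using 0 by (auto simp: D peelable_empty_iff)
next
  case (Suc k)
  hence ab: "a < b" "k = b - Suc a" by auto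
  let ?col = "\<lambda>D p. sorted_list_of_set {q. (q, p) \<in> D}"
  show ?case
  proof (cases "a \<in> snd ` D")
    case False
    hence e: "{q. (q, a) \<in> D} = {}" by force
    have "snd ` D \<subseteq> {Suc a..<b}"
    proof
      fix p assume "p \<in> snd ` D"
      then show "p \<in> {Suc a..<b}" using Suc.prems(2) False by (cases "p = a") auto
    qed
    from Suc.hyps(1)[OF ab(2) Suc.prems(1) this, of Q]
    have "peelable D Q \<longleftrightarrow> tableau Q \<and> peels (map (?col D) [Suc a..<b]) (column_word Q) []" .
    moreover have "peels ([] # Cs) X Y \<longleftrightarrow> peels Cs X Y" for Cs X Y
      using peels_replicate_append[of 1 Cs X Y] by simp
    ultimately show ?thesis using ab(1) e by (simp add: upt_conv_Cons del: peels.simps upt_Suc)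
  next
    case True
    let ?F = "first_column D"
    have ne: "D \<noteq> {}" using True by auto
    have "Min (snd ` D) = a" using True Suc.prems by (intro Min_eqI) auto
    hence F: "?F = {(q, p). (q, p) \<in> D \<and> p = a}" by (auto simp: first_column_def)
    have finF: "finite ?F" using Suc.prems(1) by (auto simp: first_column_def intro: finite_subset)
    have fstF: "fst ` ?F = {q. (q, a) \<in> D}" unfolding F by force
    have "inj_on fst ?F" unfolding F by (auto simp: inj_on_def)
    from column_tableau_fill[OF this finF] have CT: "column_tableau ?F = fill [?col D a]"
      using fstF by simp
    have sub: "snd ` (D - ?F) \<subseteq> {Suc a..<b}"
    proof
      fix p assume "p \<in> snd ` (D - ?F)"
      then obtain q where "(q, p) \<in> D - ?F" by force
      then have "(q, p) \<in> D" "p \<noteq> a" by (auto simp: F)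
      then show "p \<in> {Suc a..<b}" using Suc.prems(2) by force
    qed
    have cols: "map (?col (D - ?F)) [Suc a..<b] = map (?col D) [Suc a..<b]"
      by (intro map_cong) (auto simp: F)
    have IH: "peelable (D - ?F) Q' \<longleftrightarrow> tableau Q' \<and> peels (map (?col D) [Suc a..<b]) (column_word Q') []" for Q'
      using Suc.hyps(1)[OF ab(2) _ sub, of Q'] Suc.prems(1) unfolding cols by auto
    let ?C = "?col D a"
    have "peelable D Q \<longleftrightarrow> tableau Q \<and> fill [?C] \<subseteq>\<^sub>m Q \<and>
       peels (map (?col D) [Suc a..<b]) (column_word (tableau_of (column_word (remove_sub Q (fill [?C]))))) []"
      unfolding peelable_step_iff[OF Suc.prems(1) ne] CT IH by (simp add: tableau_of_props)
    \<comment> \<open>Rectification stays in the Knuth class, so \<open>tableau_of\<close> may be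
      dropped.\<close>
    also have "\<dots> \<longleftrightarrow> tableau Q \<and> fill [?C] \<subseteq>\<^sub>m Q \<and>
       peels (map (?col D) [Suc a..<b]) (column_word (remove_sub Q (fill [?C]))) []"
      using peels_cong[OF _ tableau_of_props(2) knuth_refl] peels_cong[OF _ knuth_sym[OF tableau_of_props(2)] knuth_refl]
      by blast
    also have "\<dots> \<longleftrightarrow> tableau Q \<and> peels (?C # map (?col D) [Suc a..<b]) (column_word Q) []"
    proof (cases "tableau Q")
      case tQ: True
      show ?thesis
      proof (intro iffI conjI)
        assume *: "tableau Q \<and> fill [?C] \<subseteq>\<^sub>m Q \<and>
          peels (map (?col D) [Suc a..<b]) (column_word (remove_sub Q (fill [?C]))) []"
        then obtain x where x: "first_col (column_word Q) = ?C @ x" using peel_column(1)[OF tQ] by auto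
        then have "step ?C (column_word Q) (column_word (remove_sub Q (fill [?C])))"
          using peel_column(2)[OF tQ x] by (auto simp: step_def)
        then show "peels (?C # map (?col D) [Suc a..<b]) (column_word Q) []" using * by auto
      next
        assume *: "tableau Q \<and> peels (?C # map (?col D) [Suc a..<b]) (column_word Q) []"
        then obtain X' where X': "step ?C (column_word Q) X'" "peels (map (?col D) [Suc a..<b]) X' []" by auto
        then obtain x where x: "first_col (column_word Q) = ?C @ x" "X' \<sim> rev x @ rest_word (column_word Q)"
          by (auto simp: step_def)
        show "fill [?C] \<subseteq>\<^sub>m Q" using peel_column(1)[OF tQ] x(1) by auto
        show "peels (map (?col D) [Suc a..<b]) (column_word (remove_sub Q (fill [?C]))) []"
          using peels_cong[OF X'(2) x(2) knuth_refl] peel_column(2)[OF tQ x(1)] by simp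
      qed (use tQ in auto)
    qed simp
    finally show ?thesis using ab(1) by (simp add: upt_conv_Cons del: upt_Suc)
  qed
qed

section \<open>Factor sequences\<close>

lemma interval_of_convex:
  fixes S :: "nat set"
  assumes "finite S" "S \<noteq> {}" "\<And>x y z. x \<in> S \<Longrightarrow> z \<in> S \<Longrightarrow> x \<le> y \<Longrightarrow> y \<le> z \<Longrightarrow> y \<in> S"
  shows "S = {Min S..<Min S + card S}"
proof -
  have eq: "S = {Min S..Max S}"
  proof (intro equalityI subsetI)
    fix y assume "y \<in> {Min S..Max S}"
    then show "y \<in> S" using assms(3)[OF Min_in[OF assms(1,2)] Max_in[OF assms(1,2)], of y] by simp
  qed (use assms(1) in simp)
  moreover have "Min S \<le> Max S" using assms(1,2) by simp
  ultimately have "card S = Suc (Max S) - Min S" by (metis card_atLeastAtMost)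
  then have "Min S + card S = Suc (Max S)" using \<open>Min S \<le> Max S\<close> by simp
  then show ?thesis using eq by (simp add: atLeastLessThanSuc_atLeastAtMost)
qed

lemma initial_of_downward_closed:
  fixes S :: "nat set"
  assumes "finite S" "\<And>x. x \<in> S \<Longrightarrow> k < x" "\<And>x y. x \<in> S \<Longrightarrow> k < y \<Longrightarrow> y \<le> x \<Longrightarrow> y \<in> S"
  shows "S = {k<..k + card S}"
proof (cases "S = {}")
  case False
  have M: "Max S \<in> S" using assms(1) False by simp
  have eq: "S = {k<..Max S}"
  proof (intro equalityI subsetI)
    fix y assume "y \<in> {k<..Max S}"
    then show "y \<in> S" using assms(3)[OF M, of y] by simp
  next
    fix y assume "y \<in> S"
    then show "y \<in> {k<..Max S}" using assms(2)[of y] assms(1) by simp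
  qed
  moreover have "k < Max S" using assms(2)[OF M] .
  ultimately have "card S = Max S - k" by (metis card_greaterThanAtMost)
  then show ?thesis using eq \<open>k < Max S\<close> by simp
qed simp

lemma sorted_nth_ge: "sorted_wrt (<) y \<Longrightarrow> \<forall>z\<in>set y. k \<le> z \<Longrightarrow> a < length y \<Longrightarrow> k + a \<le> (y ! a :: nat)"
proof (induction a)
  case (Suc a)
  then show ?case using sorted_wrt_nth_less[of "(<)" y a "Suc a"] by simp
qed simp

text \<open>The first row, one top entry from each column, is a subsequence of the column word.
  Through \<open>good_width\<close> it limits the number of nonempty columns.\<close>

lemma nonempty_columns_weakly_increasing:
  assumes "tabl ys" "\<forall>y\<in>set ys. y \<noteq> []"
  shows "subseq (map hd ys) (cword ys) \<and> sorted (map hd ys)"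
  using assms
proof (induction ys)
  case (Cons y ys)
  have IH: "subseq (map hd ys) (cword ys)" "sorted (map hd ys)" using Cons by (auto simp: tabl_Cons)
  have "subseq [hd y] (rev y)" using Cons.prems by (simp add: subseq_singleton_left)
  from list_emb_append_mono[OF this IH(1)] have "subseq (map hd (y # ys)) (cword (y # ys))" by simp
  moreover have "hd y \<le> hd z" if "z \<in> set ys" for z
    using Cons.prems that by (cases y; cases z) (auto simp: tabl_iff)
  ultimately show ?case using IH(2) by auto
qed simp

section \<open>Uniqueness of the Zelevinsky permutation\<close>

context zel
begin

text \<open>Down a block row the ones move right, towards smaller labels. So the rows with
  \<open>one_col\<close> at least \<open>i\<close> come first, and their number determines
  them.\<close>

lemma one_col_ge_iff:
  assumes "q \<in> {1..d}"
  shows "i \<le> one_col q \<longleftrightarrow> q \<le> row_offset r (row_blk r q) + card {q' \<in> block_row r (row_blk r q). i \<le> one_col q'}"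
proof -
  let ?S = "{q' \<in> block_row r (row_blk r q). i \<le> one_col q'}"
  have sub: "block_row r (row_blk r q) \<subseteq> {1..d}" using block_row_subset row_blk_le_n assms by blast
  have eq: "?S = {row_offset r (row_blk r q)<..row_offset r (row_blk r q) + card ?S}"
  proof (rule initial_of_downward_closed)
    fix x y assume x: "x \<in> ?S" and y: "row_offset r (row_blk r q) < y" "y \<le> x"
    then have yb: "y \<in> block_row r (row_blk r q)" by (auto simp: block_row_def)
    have d: "x \<in> {1..d}" "y \<in> {1..d}" using x yb sub by blast+
    then have "row_blk r x = row_blk r y"
      using x yb block_row_iff[OF d(1)] block_row_iff[OF d(2)] by auto
    then have "y = x \<or> v y < v x" using v_mono_block[of y x] y d by (cases "y = x") auto
    then have "one_col x \<le> one_col y"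
      using col_blk_antimono[of "v y" "v x" n r] v_in[OF d(1)] v_in[OF d(2)] by (auto simp: one_col_def)
    then show "y \<in> ?S" using x yb by auto
  qed (auto simp: block_row_def)
  have q: "q \<in> block_row r (row_blk r q)" using assms block_row_iff by blast
  then have "i \<le> one_col q \<longleftrightarrow> q \<in> ?S" by blast
  also have "\<dots> \<longleftrightarrow> q \<in> {row_offset r (row_blk r q)<..row_offset r (row_blk r q) + card ?S}"
    by (rule arg_cong[OF eq])
  finally show ?thesis using q by (simp add: block_row_def)
qed

text \<open>The right-hand side is expressed through \<open>n\<close> and \<open>r\<close> only, so
  it is common to all candidates for the permutation.\<close>

lemma card_one_col_ge:
  assumes "j \<le> n"
  shows "card {q \<in> block_row r j. i \<le> one_col q} =
    (\<Sum>i'\<in>{i..n}. nat (if i' \<le> j then lace_count n r i' j else if i' = j + 1 then int (r j (j + 1)) else 0))"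
proof -
  have sub: "block_row r j \<subseteq> {1..d}" using block_row_subset assms by blast
  have "{q \<in> block_row r j. i \<le> one_col q} = (\<Union>i'\<in>{i..n}. {q \<in> block_row r j. v q \<in> block_col n r i'})"
  proof (intro equalityI subsetI)
    fix q assume q: "q \<in> {q \<in> block_row r j. i \<le> one_col q}"
    then have "q \<in> {1..d}" using sub by auto
    then have "one_col q \<le> n" "v q \<in> block_col n r (one_col q)"
      using col_blk_le_n v_in block_col_iff[of "v q" n r] by (auto simp: one_col_def)
    then show "q \<in> (\<Union>i'\<in>{i..n}. {q \<in> block_row r j. v q \<in> block_col n r i'})" using q by auto
  next
    fix q assume "q \<in> (\<Union>i'\<in>{i..n}. {q \<in> block_row r j. v q \<in> block_col n r i'})"
    then obtain i' where i': "i' \<in> {i..n}" "q \<in> block_row r j" "v q \<in> block_col n r i'" by auto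
    then have "one_col q = i'" using sub v_in[of q] block_col_iff[of "v q" n r i'] by (auto simp: one_col_def)
    then show "q \<in> {q \<in> block_row r j. i \<le> one_col q}" using i' by auto
  qed
  also have "card \<dots> = (\<Sum>i'\<in>{i..n}. card {q \<in> block_row r j. v q \<in> block_col n r i'})"
  proof (rule card_UN_disjoint)
    show "\<forall>i'\<in>{i..n}. finite {q \<in> block_row r j. v q \<in> block_col n r i'}" by (simp add: block_row_def)
    show "\<forall>a\<in>{i..n}. \<forall>b\<in>{i..n}. a \<noteq> b \<longrightarrow>
      {q \<in> block_row r j. v q \<in> block_col n r a} \<inter> {q \<in> block_row r j. v q \<in> block_col n r b} = {}"
    proof (intro ballI impI)
      fix a b assume ab: "a \<in> {i..n}" "b \<in> {i..n}" "a \<noteq> b"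
      have "False" if "q \<in> block_row r j" "v q \<in> block_col n r a" "v q \<in> block_col n r b" for q
        using that ab sub v_in[of q] block_col_iff[of "v q" n r a] block_col_iff[of "v q" n r b] by auto
      then show "{q \<in> block_row r j. v q \<in> block_col n r a} \<inter> {q \<in> block_row r j. v q \<in> block_col n r b} = {}"
        by blast
    qed
  qed simp
  also have "\<dots> = (\<Sum>i'\<in>{i..n}. nat (if i' \<le> j then lace_count n r i' j else if i' = j + 1 then int (r j (j + 1)) else 0))"
  proof (rule sum.cong)
    fix i' assume "i' \<in> {i..n}"
    then have "int (card {q \<in> block_row r j. v q \<in> block_col n r i'}) =
      (if i' \<le> j then lace_count n r i' j else if i' = j + 1 then int (r j (j + 1)) else 0)"
      using zel assms unfolding is_zelevinsky_def by auto
    from arg_cong[OF this, of nat] show "card {q \<in> block_row r j. v q \<in> block_col n r i'} =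
      nat (if i' \<le> j then lace_count n r i' j else if i' = j + 1 then int (r j (j + 1)) else 0)"
      by (simp only: nat_int)
  qed simp
  finally show ?thesis .
qed

text \<open>The columns are ordered by their block and, inside a block, by the row of their 1.\<close>

lemma v_formula:
  assumes "q \<in> {1..d}"
  shows "v q = Suc (card {q' \<in> {1..d}. one_col q < one_col q' \<or> one_col q = one_col q' \<and> q' < q})"
proof -
  have "v q' < v q \<longleftrightarrow> one_col q < one_col q' \<or> one_col q = one_col q' \<and> q' < q" if q': "q' \<in> {1..d}" for q'
  proof -
    have le: "one_col q \<le> one_col q'" if "v q' \<le> v q"
      using col_blk_antimono[OF that] v_in assms q' by (auto simp: one_col_def)
    have le': "one_col q' \<le> one_col q" if "v q \<le> v q'"
      using col_blk_antimono[OF that] v_in assms q' by (auto simp: one_col_def)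
    have lt: "a < b" if "a \<in> {1..d}" "b \<in> {1..d}" "one_col a = one_col b" "v a < v b" for a b
      using v_inv_mono_block[of "v a" "v b"] v_in that by (auto simp: one_col_def)
    have inj: "q' = q" if "v q' = v q" using that by (metis v_inv_v)
    show ?thesis
    proof (cases "v q' < v q")
      case True
      have "one_col q \<le> one_col q'" using le True by simp
      moreover have "q' < q" if "one_col q = one_col q'" using lt[OF q' assms] that True by simp
      ultimately show ?thesis using True by auto
    next
      case False
      have "one_col q' \<le> one_col q" using le' False by simp
      moreover have "q \<le> q'" if "one_col q = one_col q'"
      proof (cases "v q' = v q")
        case True
        then show ?thesis using inj by simp
      next
        case neq: False
        then show ?thesis using lt[OF assms q'] that False by simp
      qed
      ultimately show ?thesis using False by auto
    qed
  qed
  hence "{q' \<in> {1..d}. one_col q < one_col q' \<or> one_col q = one_col q' \<and> q' < q} = {q' \<in> {1..d}. v q' < v q}" by auto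
  hence "card {q' \<in> {1..d}. one_col q < one_col q' \<or> one_col q = one_col q' \<and> q' < q} = card {q' \<in> {1..d}. v q' < v q}"
    by (rule arg_cong)
  also have "\<dots> = card (v ` {q' \<in> {1..d}. v q' < v q})"
    using permutes_inj[OF perm] by (intro card_image[symmetric]) (auto intro: inj_on_subset)
  also have "v ` {q' \<in> {1..d}. v q' < v q} = {1..<v q}"
  proof (intro equalityI subsetI)
    fix p assume "p \<in> {1..<v q}"
    then show "p \<in> v ` {q' \<in> {1..d}. v q' < v q}"
      using v_in[OF assms] v_inv_in[of p] by (intro image_eqI[of _ _ "v_inv p"]) auto
  qed (use v_in in auto)
  finally show ?thesis using v_in[OF assms] by auto
qed

end

text \<open>Equal counts force equal \<open>one_col\<close>, from which \<open>v_formula\<close>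
  recovers the permutation.\<close>

lemma is_zelevinsky_unique:
  assumes "is_zelevinsky n r v" "is_zelevinsky n r w"
  shows "v = w"
proof -
  interpret V: zel n r v by unfold_locales fact
  interpret W: zel n r w by unfold_locales fact
  have "i \<le> V.one_col q \<longleftrightarrow> i \<le> W.one_col q" if "q \<in> {1..grid_size n r}" for q i
    using V.one_col_ge_iff[OF that] W.one_col_ge_iff[OF that] V.card_one_col_ge W.card_one_col_ge row_blk_le_n[OF that] by simp
  hence one_col: "V.one_col q = W.one_col q" if "q \<in> {1..grid_size n r}" for q
    using that by (meson order_antisym order_refl)
  show ?thesis
  proof
    fix q
    show "v q = w q"
    proof (cases "q \<in> {1..grid_size n r}")
      case True
      have "{q' \<in> {1..grid_size n r}. V.one_col q < V.one_col q' \<or> V.one_col q = V.one_col q' \<and> q' < q} =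
        {q' \<in> {1..grid_size n r}. W.one_col q < W.one_col q' \<or> W.one_col q = W.one_col q' \<and> q' < q}"
        using one_col True by auto
      then show ?thesis using V.v_formula[OF True] W.v_formula[OF True] by simp
    next
      case False
      then show ?thesis using V.perm W.perm by (metis permutes_not_in)
    qed
  qed
qed

section \<open>Factor sequences and the layers of the diagram\<close>

context zel
begin

lemma D_rank_eq: "D_rank n r = perm_diagram d v"
proof -
  have "zelevinsky n r = v"
    unfolding zelevinsky_def using zel is_zelevinsky_unique by blast
  then show ?thesis by (simp add: D_rank_def)
qed

text \<open>Down a block row \<open>one_col\<close> decreases, and along a block column
  \<open>one_row\<close> increases. Hence rows and columns of the rectangle are intervals, and
  moving their minima to 1 gives equal adjacent columns.\<close>

lemma T_rank_eq:
  assumes "m \<ge> 1" "m + t \<le> n"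
  shows "T_rank n r m (m - 1 + t) = fill (replicate (width t m) (sorted_list_of_set (rowset t m)))"
proof -
  let ?S = "rowset t m"
  let ?P = "{p \<in> {1..d}. col_blk n r p = m \<and> m + t \<le> one_row p}"
  let ?j = "m - 1 + t"
  define B where "B = D_rank n r \<inter> (block_row r ?j \<times> block_col n r m)"
  have B: "B = ?S \<times> ?P"
  proof (rule Set.set_eqI, clarify)
    fix q p
    have j: "Suc (row_blk r q) = m + t \<longleftrightarrow> row_blk r q = ?j" using assms by auto
    show "(q, p) \<in> B \<longleftrightarrow> (q, p) \<in> ?S \<times> ?P"
    proof (cases "q \<in> {1..d} \<and> p \<in> {1..d}")
      case True
      then show ?thesis using assms j block_row_iff[of q n r ?j] block_col_iff[of p n r m]
        by (auto simp: B_def D_rank_eq diagram_iff rowset_def)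
    next
      case False
      then show ?thesis by (auto simp: B_def D_rank_eq diagram_iff rowset_def)
    qed
  qed
  have T: "T_rank n r m ?j = shift_nw (Min (fst ` B) - 1) (Min (snd ` B) - 1) (row_filling B)"
    by (simp add: T_rank_def B_def Let_def)
  have finP: "finite ?P" by simp
  show ?thesis
  proof (cases "?S = {} \<or> ?P = {}")
    \<comment> \<open>For an empty rectangle the minima carry no information, but the filling is
      empty under any shift.\<close>
    case True
    then have "B = {}" using B by blast
    then have "T_rank n r m ?j = Map.empty" unfolding T by (auto simp: shift_nw_def row_filling_def)
    moreover have "fill (replicate (width t m) (sorted_list_of_set ?S)) = Map.empty"
    proof -
      have "fill (replicate k []) = Map.empty" for k by (auto simp: fill_def fun_eq_iff)
      moreover have "width t m = 0" if "?P = {}" using that by (simp only: width_def card.empty)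
      ultimately show ?thesis using True by auto
    qed
    ultimately show ?thesis by simp
  next
    case False
    hence ne: "?S \<noteq> {}" "?P \<noteq> {}" by auto
    have mins: "fst ` B = ?S" "snd ` B = ?P" using ne unfolding B by auto
    have S: "?S = {Min ?S..<Min ?S + card ?S}"
    proof (rule interval_of_convex[OF _ ne(1)])
      fix x y z assume *: "x \<in> ?S" "z \<in> ?S" "x \<le> y" "y \<le> z"
      then have y: "y \<in> {1..d}" by (auto simp: rowset_def)
      have "row_blk r x \<le> row_blk r y" "row_blk r y \<le> row_blk r z"
        using * y row_blk_mono[of x y n r] row_blk_mono[of y z n r] by (auto simp: rowset_def)
      then have rby: "row_blk r y = row_blk r x" using * by (auto simp: rowset_def)
      have "one_col y \<le> one_col x"
      proof (cases "x = y")
        case False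
        have x: "x \<in> {1..d}" using * by (simp add: rowset_def)
        have "v x < v y" using False *(3) by (intro v_mono_block x y) (auto simp: rby)
        then show ?thesis using col_blk_antimono[of "v x" "v y" n r] v_in[OF x] v_in[OF y] by (simp add: one_col_def)
      qed simp
      then show "y \<in> ?S" using * y rby by (auto simp: rowset_def)
    qed simp
    have P: "?P = {Min ?P..<Min ?P + card ?P}"
    proof (rule interval_of_convex[OF finP ne(2)])
      fix x y z assume *: "x \<in> ?P" "z \<in> ?P" "x \<le> y" "y \<le> z"
      then have y: "y \<in> {1..d}" by auto
      have "col_blk n r y = m" using * y col_blk_antimono[of x y n r] col_blk_antimono[of y z n r] by auto
      then show "y \<in> ?P" using * y one_row_mono[of x y] by auto
    qed
    define a0 where "a0 = Min ?S"
    define b0 where "b0 = Min ?P"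
    define h where "h = card ?S"
    have S': "?S = {a0..<a0 + h}" using S by (simp add: a0_def h_def)
    have P': "?P = {b0..<b0 + width t m}" using P by (simp add: b0_def width_def)
    have "a0 \<in> ?S" "b0 \<in> ?P" using ne finP unfolding a0_def b0_def by (intro Min_in; simp)+
    hence pos: "a0 \<ge> 1" "b0 \<ge> 1" by (auto simp: rowset_def)
    have sl: "sorted_list_of_set ?S = [a0..<a0 + h]" unfolding S' by simp
    show ?thesis
    proof
      fix x :: box obtain a b where x: "x = (a, b)" by (cases x)
      have mem: "q \<in> ?S \<longleftrightarrow> a0 \<le> q \<and> q < a0 + h" "p \<in> ?P \<longleftrightarrow> b0 \<le> p \<and> p < b0 + width t m" for p q
        unfolding S' P' by auto
      have "T_rank n r m ?j (a, b) = (if 1 \<le> a \<and> 1 \<le> b \<and> a0 - 1 + a \<in> ?S \<and> b0 - 1 + b \<in> ?P then Some (a0 - 1 + a) else None)"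
        unfolding T mins by (auto simp: shift_nw_def row_filling_def B a0_def b0_def)
      also have "\<dots> = fill (replicate (width t m) (sorted_list_of_set ?S)) (a, b)"
        unfolding sl mem using pos by (auto simp: fill_def)
      finally show "T_rank n r m ?j x = fill (replicate (width t m) (sorted_list_of_set ?S)) x" using x by simp
    qed
  qed
qed

lemma T_rank_props:
  assumes "m \<ge> 1" "m + t \<le> n"
  shows "tableau (T_rank n r m (m - 1 + t))" "column_word (T_rank n r m (m - 1 + t)) = rect_word t m"
proof -
  have "tabl (replicate (width t m) (sorted_list_of_set (rowset t m)))"
  proof -
    have "sorted_wrt col_le (replicate k x)" for k x by (induction k) auto
    then show ?thesis unfolding tabl_iff by auto
  qed
  then show "tableau (T_rank n r m (m - 1 + t))" unfolding T_rank_eq[OF assms] by (rule tableau_fill)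
  show "column_word (T_rank n r m (m - 1 + t)) = rect_word t m"
    unfolding T_rank_eq[OF assms] column_word_fill by (simp add: rect_word_def cword_def)
qed

text \<open>With \<open>n\<close> layers removed no block column is left; the recursion starts from
  here.\<close>

lemma good_n: "good n w"
  unfolding good_def by (intro exI[of _ "\<lambda>_. []"]) auto

text \<open>Raising the second index of the array by one means passing to the next layer, since
  \<open>T m (m - 1 + t)\<close> is the rectangle of layer \<open>t\<close> in block column
  \<open>m\<close>.\<close>

lemma factor_sequence_imp_good:
  assumes "factor_sequence N T W" "T = (\<lambda>i j. T_rank n r i (j + t))" "N = n - t" "t < n"
  shows "length W = n - t \<and> (\<forall>i\<in>{1..n - t}. tableau (W ! (i - 1))) \<and> good t (\<lambda>i. column_word (W ! (i - 1)))"
  using assms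
proof (induction arbitrary: t rule: factor_sequence.induct)
  case (factor_sequence_base T)
  hence nt: "n - t = 1" "n = Suc t" by auto
  have T: "tableau (T_rank n r 1 t)" "column_word (T_rank n r 1 t) = rect_word t 1"
    using T_rank_props[of 1 t] nt by auto
  \<comment> \<open>With a single block column nothing stands on either side of the rectangle, so
    both families of words are empty.\<close>
  have "good t (\<lambda>i. column_word ([T 1 0] ! (i - 1)))"
    by (rule good_Suc_intro[of t "\<lambda>_. []" "\<lambda>_. []"]) (use nt T good_n in \<open>auto simp: factor_sequence_base\<close>)
  then show ?case using nt T by (simp add: factor_sequence_base)
next
  case (factor_sequence_step N T U P Q W)
  have nt: "N = n - t" "N - 1 = n - Suc t" "Suc t < n" using factor_sequence_step by auto
  have IH: "length U = n - Suc t" "\<forall>i\<in>{1..n - Suc t}. tableau (U ! (i - 1))"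
    "good (Suc t) (\<lambda>i. column_word (U ! (i - 1)))"
    using factor_sequence_step.IH[of "Suc t"] factor_sequence_step.prems nt by auto
  have U: "U ! (i - 1) = tableau_of (column_word (P i) @ column_word (Q i))" if "i \<in> {1..n - Suc t}" for i
    using factor_sequence_step.hyps(3) that nt by auto
  have W: "W ! (i - 1) = tableau_of (column_word (Q i) @ rect_word t i @ column_word (P (i - 1)))"
    if "i \<in> {1..n - t}" for i
    using factor_sequence_step.hyps(7) that nt T_rank_props(2)[of i t] factor_sequence_step.prems by auto
  have "good t (\<lambda>i. column_word (W ! (i - 1)))"
  proof (rule good_Suc_intro)
    show "good (Suc t) (\<lambda>i. column_word (P i) @ column_word (Q i))"
      using U tableau_of_props(2) by (intro good_knuth[OF IH(3)]) auto
    show "\<forall>i\<in>{1..n - t}. column_word (W ! (i - 1)) \<sim> column_word (Q i) @ rect_word t i @ column_word (P (i - 1))"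
      using W tableau_of_props(2) by auto
  qed (use factor_sequence_step nt in auto)
  then show ?case using W tableau_of_props(1) factor_sequence_step.hyps(6) nt by auto
qed

text \<open>\<open>good_Suc_elim\<close> yields words, whereas factor sequences consist of tableaux;
  \<open>P\<close>, \<open>Q\<close> and their products are therefore rectified, which preserves all
  Knuth classes.\<close>

lemma good_imp_factor_sequence:
  assumes "t < n" "length W = n - t" "\<forall>i\<in>{1..n - t}. tableau (W ! (i - 1))"
    "good t (\<lambda>i. column_word (W ! (i - 1)))"
  shows "factor_sequence (n - t) (\<lambda>i j. T_rank n r i (j + t)) W"
  using assms
proof (induction "n - t" arbitrary: t W rule: less_induct)
  case less
  obtain P Q where PQ: "P 0 = []" "Q (n - t) = []"
    "\<forall>i\<in>{1..n - t}. column_word (W ! (i - 1)) \<sim> Q i @ rect_word t i @ P (i - 1)"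
    "good (Suc t) (\<lambda>i. P i @ Q i)"
    using good_Suc_elim[OF less.prems(1,4)] by metis
  show ?case
  proof (cases "n - t = 1")
    case True
    have "W ! 0 = T_rank n r 1 t"
    proof (rule tableau_word_unique)
      show "tableau (W ! 0)" using less.prems(3) True by auto
      show "tableau (T_rank n r 1 t)" using T_rank_props(1)[of 1 t] True by auto
      show "column_word (W ! 0) \<sim> column_word (T_rank n r 1 t)"
        using T_rank_props(2)[of 1 t] PQ True by auto
    qed
    then have "W = [T_rank n r 1 (0 + t)]" using less.prems(2) True by (cases W) auto
    then show ?thesis using factor_sequence_base[of "\<lambda>i j. T_rank n r i (j + t)"] True by simp
  next
    case False
    hence n2: "n - t \<ge> 2" "Suc t < n" "n - Suc t = n - t - 1" using less.prems by auto
    define U where "U = map (\<lambda>i. tableau_of (P i @ Q i)) [1..<Suc (n - Suc t)]"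
    have Ui: "U ! (i - 1) = tableau_of (P i @ Q i)" if "i \<in> {1..n - Suc t}" for i
      using that unfolding U_def by (subst nth_map) (auto simp del: upt_Suc)
    have "factor_sequence (n - Suc t) (\<lambda>i j. T_rank n r i (j + Suc t)) U"
    proof (rule less.hyps)
      show "good (Suc t) (\<lambda>i. column_word (U ! (i - 1)))"
        using Ui tableau_of_props(2) by (intro good_knuth[OF PQ(4)]) (auto intro: knuth_sym)
    qed (use n2 Ui tableau_of_props(1) in \<open>auto simp: U_def simp del: upt_Suc\<close>)
    then have fU: "factor_sequence (n - t - 1) (\<lambda>i j. T_rank n r i (j + 1 + t)) U"
      by simp
    show ?thesis
    proof (rule factor_sequence_step[OF n2(1) fU, where P = "\<lambda>i. tableau_of (P i)" and Q = "\<lambda>i. tableau_of (Q i)"])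
      have cong: "tableau_of u = tableau_of u'" if "u' \<sim> u" for u u' using tableau_of_cong[OF knuth_sym[OF that]] .
      show "\<forall>i\<in>{1..n - t - 1}. tableau (tableau_of (P i)) \<and> tableau (tableau_of (Q i)) \<and>
          U ! (i - 1) = tableau_of (column_word (tableau_of (P i)) @ column_word (tableau_of (Q i)))"
      proof
        fix i assume "i \<in> {1..n - t - 1}"
        then have "U ! (i - 1) = tableau_of (P i @ Q i)" by (intro Ui) auto
        also have "\<dots> = tableau_of (column_word (tableau_of (P i)) @ column_word (tableau_of (Q i)))"
          by (rule cong[OF knuth_cong[OF tableau_of_props(2) tableau_of_props(2)]])
        finally show "tableau (tableau_of (P i)) \<and> tableau (tableau_of (Q i)) \<and>
          U ! (i - 1) = tableau_of (column_word (tableau_of (P i)) @ column_word (tableau_of (Q i)))"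
          using tableau_of_props(1) by blast
      qed
      show "tableau_of (P 0) = Map.empty" "tableau_of (Q (n - t)) = Map.empty"
        using tableau_of_eq[of Map.empty "[]"] PQ by auto
      show "length W = n - t" by fact
      show "\<forall>i\<in>{1..n - t}. W ! (i - 1) = tableau_of (column_word (tableau_of (Q i)) @
         column_word (T_rank n r i (i - 1 + t)) @ column_word (tableau_of (P (i - 1))))"
      proof
        fix i assume i: "i \<in> {1..n - t}"
        have "Q i @ rect_word t i @ P (i - 1) \<sim> column_word (tableau_of (Q i)) @
         column_word (T_rank n r i (i - 1 + t)) @ column_word (tableau_of (P (i - 1)))"
          using T_rank_props(2)[of i t] i by (auto intro!: knuth_cong knuth_sym[OF tableau_of_props(2)])
        with PQ(3) i have "column_word (W ! (i - 1)) \<sim> column_word (tableau_of (Q i)) @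
         column_word (T_rank n r i (i - 1 + t)) @ column_word (tableau_of (P (i - 1)))"
          using knuth_trans by blast
        then show "W ! (i - 1) = tableau_of (column_word (tableau_of (Q i)) @
         column_word (T_rank n r i (i - 1 + t)) @ column_word (tableau_of (P (i - 1))))"
          using less.prems(3) i by (intro tableau_of_eq[symmetric]) auto
      qed
    qed
  qed
qed

end

section \<open>Existence of the Zelevinsky permutation\<close>

text \<open>The prescribed number of ones in each block; \<open>nat\<close> loses nothing once the
  lace counts are nonnegative.\<close>

definition ones :: "nat \<Rightarrow> (nat \<Rightarrow> nat \<Rightarrow> nat) \<Rightarrow> nat \<Rightarrow> nat \<Rightarrow> nat" where
  "ones n r i j = nat (if i \<le> j then lace_count n r i j else if i = j + 1 then int (r j (j + 1)) else 0)"

lemma sum_telescope_atMost: "(\<Sum>i\<le>k. f (int i) - f (int i - 1)) = f (int k) - (f (- 1) :: int)"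
  by (induction k) auto

lemma sum_telescope_from:
  "i \<le> k \<Longrightarrow> (\<Sum>j\<in>{i..k}. f (int j) - f (int j + 1)) = f (int i) - (f (int k + 1) :: int)"
proof (induction k rule: dec_induct)
  case (step k)
  have "{i..Suc k} = insert (Suc k) {i..k}" using step by auto
  then show ?case using step by (simp add: add.commute)
qed simp

text \<open>The lace counts telescope in \<open>i\<close> to \<open>r j j - r j (j + 1)\<close>, and
  the block labelled \<open>j + 1\<close> supplies the missing \<open>r j (j + 1)\<close>; both
  corrections vanish for \<open>j = n\<close>.\<close>

lemma sum_ones_row:
  assumes "j \<le> n" "\<And>i j. i \<le> j \<Longrightarrow> j \<le> n \<Longrightarrow> 0 \<le> lace_count n r i j"
  shows "(\<Sum>i\<le>n. ones n r i j) = r j j"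
proof -
  define R where "R a = rank_ext n r a (int j) - rank_ext n r a (int j + 1)" for a
  have lace: "lace_count n r i j = R (int i) - R (int i - 1)" for i
    by (simp add: lace_count_def R_def)
  have split: "{..n} = {..j} \<union> {j<..n}" using assms(1) by auto
  have "int (\<Sum>i\<le>n. ones n r i j) = (\<Sum>i\<le>n. int (ones n r i j))" by simp
  also have "\<dots> = (\<Sum>i\<le>j. int (ones n r i j)) + (\<Sum>i\<in>{j<..n}. int (ones n r i j))"
    unfolding split by (rule sum.union_disjoint) auto
  also have "(\<Sum>i\<le>j. int (ones n r i j)) = (\<Sum>i\<le>j. R (int i) - R (int i - 1))"
    using assms by (intro sum.cong) (auto simp: ones_def simp flip: lace)
  also have "\<dots> = R (int j)" by (simp add: sum_telescope_atMost) (simp add: R_def rank_ext_def)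
  also have "(\<Sum>i\<in>{j<..n}. int (ones n r i j)) = rank_ext n r (int j) (int j + 1)"
  proof (cases "j < n")
    case True
    have "(\<Sum>i\<in>{j<..n}. int (ones n r i j)) = (\<Sum>i\<in>{Suc j}. int (ones n r i j))"
      using True by (intro sum.mono_neutral_right) (auto simp: ones_def)
    then show ?thesis using True by (simp add: ones_def rank_ext_def nat_add_distrib)
  next
    case False
    then show ?thesis using assms(1) by (simp add: rank_ext_def)
  qed
  finally have "int (\<Sum>i\<le>n. ones n r i j) = int (r j j)"
    using assms(1) by (simp add: R_def rank_ext_def del: of_nat_sum)
  then show ?thesis by (simp only: of_nat_eq_iff)
qed

text \<open>Here the telescoping is in \<open>j\<close>, and block row \<open>i - 1\<close> supplies
  the missing \<open>r (i - 1) i\<close>.\<close>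

lemma sum_ones_col:
  assumes "i \<le> n" "\<And>i j. i \<le> j \<Longrightarrow> j \<le> n \<Longrightarrow> 0 \<le> lace_count n r i j"
  shows "(\<Sum>j\<le>n. ones n r i j) = r i i"
proof -
  define R where "R a = rank_ext n r (int i) a - rank_ext n r (int i - 1) a" for a
  have lace: "lace_count n r i j = R (int j) - R (int j + 1)" for j
    by (simp add: lace_count_def R_def)
  have split: "{..n} = {..<i} \<union> {i..n}" using assms(1) by auto
  have "int (\<Sum>j\<le>n. ones n r i j) = (\<Sum>j\<le>n. int (ones n r i j))" by simp
  also have "\<dots> = (\<Sum>j<i. int (ones n r i j)) + (\<Sum>j\<in>{i..n}. int (ones n r i j))"
    unfolding split by (rule sum.union_disjoint) auto
  also have "(\<Sum>j\<in>{i..n}. int (ones n r i j)) = (\<Sum>j\<in>{i..n}. R (int j) - R (int j + 1))"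
    using assms by (intro sum.cong) (auto simp: ones_def simp flip: lace)
  also have "\<dots> = R (int i)"
    using assms(1) by (simp add: sum_telescope_from) (simp add: R_def rank_ext_def)
  also have "(\<Sum>j<i. int (ones n r i j)) = rank_ext n r (int i - 1) (int i)"
  proof (cases i)
    case (Suc k)
    have "(\<Sum>j<i. int (ones n r i j)) = (\<Sum>j\<in>{k}. int (ones n r i j))"
      using Suc by (intro sum.mono_neutral_right) (auto simp: ones_def)
    then show ?thesis using Suc assms(1) by (simp add: ones_def rank_ext_def nat_add_distrib)
  qed (simp add: rank_ext_def)
  finally have "int (\<Sum>j\<le>n. ones n r i j) = int (r i i)"
    using assms(1) by (simp add: R_def rank_ext_def del: of_nat_sum)
  then show ?thesis by (simp only: of_nat_eq_iff)
qed

text \<open>The block column of the 1 in row \<open>q\<close>: a block row is cut, from top to bottom, into pieces of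
  sizes \<open>ones n r n j, \<dots>, ones n r 0 j\<close>.\<close>

definition label :: "nat \<Rightarrow> (nat \<Rightarrow> nat \<Rightarrow> nat) \<Rightarrow> nat \<Rightarrow> nat" where
  "label n r q = card {i \<in> {1..n}. q \<le> row_offset r (row_blk r q) + (\<Sum>i'\<in>{i..n}. ones n r i' (row_blk r q))}"

lemma label_le: "label n r q \<le> n"
proof -
  have "label n r q \<le> card {1..n}" unfolding label_def by (rule card_mono) auto
  then show ?thesis by simp
qed

text \<open>The indices counted by \<open>label\<close> are closed downwards, so their number is the
  greatest of them. For \<open>i = 0\<close> the bound holds because the pieces fill the block row
  exactly.\<close>

lemma label_ge_iff:
  assumes "q \<in> block_row r j" "j \<le> n" "i \<le> n"
    and "\<And>i j. i \<le> j \<Longrightarrow> j \<le> n \<Longrightarrow> 0 \<le> lace_count n r i j"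
  shows "i \<le> label n r q \<longleftrightarrow> q \<le> row_offset r j + (\<Sum>i'\<in>{i..n}. ones n r i' j)"
proof -
  have "q \<in> {1..grid_size n r}" using assms block_row_subset by blast
  then have row_blk: "row_blk r q = j" using assms(1) block_row_iff by blast
  let ?S = "{i \<in> {1..n}. q \<le> row_offset r j + (\<Sum>i'\<in>{i..n}. ones n r i' j)}"
  show ?thesis
  proof (cases "i = 0")
    case True
    have "(\<Sum>i'\<in>{0..n}. ones n r i' j) = r j j"
      using sum_ones_row[OF assms(2,4)] by (simp add: atLeast0AtMost)
    then show ?thesis using True assms(1) by (simp add: block_row_def)
  next
    case False
    have eq: "?S = {0<..0 + card ?S}"
    proof (rule initial_of_downward_closed)
      fix x y assume x: "x \<in> ?S" and y: "0 < y" "y \<le> x"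
      have "(\<Sum>i'\<in>{x..n}. ones n r i' j) \<le> (\<Sum>i'\<in>{y..n}. ones n r i' j)"
        using y by (intro sum_mono2) auto
      then show "y \<in> ?S" using x y by auto
    qed auto
    have "i \<le> label n r q \<longleftrightarrow> i \<in> {0<..0 + card ?S}" using False by (simp add: label_def row_blk)
    also have "\<dots> \<longleftrightarrow> i \<in> ?S" by (rule arg_cong[OF eq[symmetric]])
    finally show ?thesis using False assms(3) by simp
  qed
qed

lemma card_label:
  assumes "j \<le> n" "i \<le> n" "\<And>i j. i \<le> j \<Longrightarrow> j \<le> n \<Longrightarrow> 0 \<le> lace_count n r i j"
  shows "card {q \<in> block_row r j. label n r q = i} = ones n r i j"
proof -
  let ?G = "\<lambda>i. \<Sum>i'\<in>{i..n}. ones n r i' j"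
  let ?o = "row_offset r j"
  have G: "?G i = ones n r i j + ?G (Suc i)"
    using assms(2) by (simp add: sum.atLeast_Suc_atMost)
  have top: "?G i \<le> r j j"
  proof -
    have "?G i \<le> (\<Sum>i'\<le>n. ones n r i' j)" by (intro sum_mono2) auto
    then show ?thesis using sum_ones_row[OF assms(1,3)] by simp
  qed
  have ge: "Suc i \<le> label n r q \<longleftrightarrow> q \<le> ?o + ?G (Suc i)" if q: "q \<in> block_row r j" for q
  proof (cases "i = n")
    case True
    then show ?thesis using label_le[of n r q] q by (simp add: block_row_def)
  next
    case False
    then show ?thesis using label_ge_iff[OF q assms(1) _ assms(3), of "Suc i"] assms(2) by simp
  qed
  have "label n r q = i \<longleftrightarrow> ?o + ?G (Suc i) < q \<and> q \<le> ?o + ?G i" if q: "q \<in> block_row r j" for q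
    using ge[OF q] label_ge_iff[OF q assms(1,2,3)] by auto
  hence "{q \<in> block_row r j. label n r q = i} = {q \<in> block_row r j. ?o + ?G (Suc i) < q \<and> q \<le> ?o + ?G i}" by blast
  also have "\<dots> = {?o + ?G (Suc i)<..?o + ?G i}"
    using top by (auto simp: block_row_def)
  finally show ?thesis using G by simp
qed

lemma UN_block_row: "(\<Union>j\<in>{..n}. block_row r j) = {1..grid_size n r}"
proof (intro equalityI subsetI)
  fix q assume "q \<in> (\<Union>j\<in>{..n}. block_row r j)"
  then obtain j where "j \<le> n" "q \<in> block_row r j" by auto
  then show "q \<in> {1..grid_size n r}" using block_row_subset[of j n r] by blast
next
  fix q assume "q \<in> {1..grid_size n r}"
  then show "q \<in> (\<Union>j\<in>{..n}. block_row r j)" using block_row_iff[of q n r] row_blk_le_n[of q n r] by auto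
qed

lemma card_less_witness: "finite B \<Longrightarrow> A \<subseteq> B \<Longrightarrow> x \<in> B \<Longrightarrow> x \<notin> A \<Longrightarrow> card A < card B"
  by (rule psubset_card_mono) auto

text \<open>As \<open>v_formula\<close> dictates, rows are ordered by decreasing label and then by
  position, and \<open>v q\<close> is the place of \<open>q\<close> in this order.\<close>

lemma zelevinsky_exists:
  assumes nonneg: "\<And>i j. i \<le> j \<Longrightarrow> j \<le> n \<Longrightarrow> 0 \<le> lace_count n r i j"
  shows "\<exists>v. is_zelevinsky n r v"
proof -
  let ?d = "grid_size n r"
  let ?l = "label n r"
  define prec where "prec a b \<longleftrightarrow> ?l b < ?l a \<or> ?l a = ?l b \<and> a < b" for a b
  define v where "v q = (if q \<in> {1..?d} then Suc (card {q' \<in> {1..?d}. prec q' q}) else q)" for q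
  have v_less: "v a < v b" if "a \<in> {1..?d}" "b \<in> {1..?d}" "prec a b" for a b
  proof -
    have "card {q' \<in> {1..?d}. prec q' a} < card {q' \<in> {1..?d}. prec q' b}"
      by (rule card_less_witness[of _ _ a]) (use that in \<open>auto simp: prec_def\<close>)
    then show ?thesis using that by (simp add: v_def)
  qed
  have total: "prec a b \<or> a = b \<or> prec b a" for a b by (auto simp: prec_def)
  have v_iff: "v a < v b \<longleftrightarrow> prec a b" if "a \<in> {1..?d}" "b \<in> {1..?d}" for a b
    using total[of a b] v_less[of a b] v_less[of b a] that by auto
  have v_in: "v q \<in> {1..?d}" if q: "q \<in> {1..?d}" for q
  proof -
    have "card {q' \<in> {1..?d}. prec q' q} < card {1..?d}"
      by (rule card_less_witness[of _ _ q]) (use q in \<open>auto simp: prec_def\<close>)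
    then show ?thesis using q by (simp add: v_def)
  qed
  have "inj_on v {1..?d}"
  proof (rule inj_onI)
    fix a b assume "a \<in> {1..?d}" "b \<in> {1..?d}" "v a = v b"
    then show "a = b" using total[of a b] v_less[of a b] v_less[of b a] by auto
  qed
  moreover from this have "v ` {1..?d} = {1..?d}" using v_in by (intro endo_inj_surj) auto
  ultimately have "bij_betw v {1..?d} {1..?d}" by (simp add: bij_betw_def)
  moreover have "v q = q" if "q \<notin> {1..?d}" for q using that by (simp only: v_def if_False)
  ultimately have perm: "v permutes {1..?d}" by (rule bij_imp_permutes)
  \<comment> \<open>This is where the column sums enter: label class \<open>i\<close> is as large as
    block column \<open>i\<close> is wide.\<close>
  have card_l: "card {q \<in> {1..?d}. ?l q = i} = r i i" if i: "i \<le> n" for i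
  proof -
    have "{q \<in> {1..?d}. ?l q = i} = (\<Union>j\<in>{..n}. {q \<in> block_row r j. ?l q = i})"
      using UN_block_row[where n = n and r = r] by auto
    also have "card \<dots> = (\<Sum>j\<in>{..n}. card {q \<in> block_row r j. ?l q = i})"
    proof (rule card_UN_disjoint)
      have "block_row r a \<inter> block_row r b = {}" if "a \<le> n" "b \<le> n" "a \<noteq> b" for a b
      proof (rule ccontr)
        assume "block_row r a \<inter> block_row r b \<noteq> {}"
        then obtain q where q: "q \<in> block_row r a" "q \<in> block_row r b" by blast
        then have "q \<in> {1..?d}" using block_row_subset[OF that(1)] by blast
        then show False using q that(3) block_row_iff[of q n r] by auto
      qed
      then show "\<forall>a\<in>{..n}. \<forall>b\<in>{..n}. a \<noteq> b \<longrightarrow>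
        {q \<in> block_row r a. ?l q = i} \<inter> {q \<in> block_row r b. ?l q = i} = {}" by blast
    qed (auto simp: block_row_def)
    also have "\<dots> = (\<Sum>j\<in>{..n}. ones n r i j)"
      using i nonneg by (intro sum.cong card_label) auto
    also have "\<dots> = r i i" using i nonneg by (rule sum_ones_col)
    finally show ?thesis .
  qed
  have card_gt: "card {q \<in> {1..?d}. i < ?l q} = col_offset n r i" for i
  proof -
    have "{q \<in> {1..?d}. i < ?l q} = (\<Union>i'\<in>{i<..n}. {q \<in> {1..?d}. ?l q = i'})"
      using label_le[of n r] by auto
    also have "card \<dots> = (\<Sum>i'\<in>{i<..n}. card {q \<in> {1..?d}. ?l q = i'})"
      by (rule card_UN_disjoint) auto
    finally show ?thesis using card_l by (simp add: col_offset_def)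
  qed
  have v_block: "v q \<in> block_col n r (?l q)" if q: "q \<in> {1..?d}" for q
  proof -
    have "card {q' \<in> {1..?d}. ?l q < ?l q'} \<le> card {q' \<in> {1..?d}. prec q' q}"
      by (rule card_mono) (auto simp: prec_def)
    moreover have "card {q' \<in> {1..?d}. prec q' q} < card ({q' \<in> {1..?d}. ?l q < ?l q'} \<union> {q' \<in> {1..?d}. ?l q' = ?l q})"
      by (rule card_less_witness[of _ _ q]) (use q in \<open>auto simp: prec_def\<close>)
    moreover have "card ({q' \<in> {1..?d}. ?l q < ?l q'} \<union> {q' \<in> {1..?d}. ?l q' = ?l q}) = col_offset n r (?l q) + r (?l q) (?l q)"
      using card_gt card_l label_le[of n r q] by (subst card_Un_disjoint) auto
    ultimately show ?thesis using card_gt[of "?l q"] q by (simp add: block_col_def v_def)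
  qed
  have v_block_iff: "v q \<in> block_col n r i \<longleftrightarrow> ?l q = i" if "q \<in> {1..?d}" "i \<le> n" for q i
    using v_block[OF that(1)] block_col_iff[OF v_in[OF that(1)], of "?l q"] block_col_iff[OF v_in[OF that(1)] that(2)]
      label_le[of n r q] by auto
  have "is_zelevinsky n r v"
    unfolding is_zelevinsky_def
  proof (intro conjI allI impI ballI)
    show "v permutes {1..?d}" by (rule perm)
  next
    fix i j assume ij: "i \<le> n" "j \<le> n"
    have "{q \<in> block_row r j. v q \<in> block_col n r i} = {q \<in> block_row r j. ?l q = i}"
      using v_block_iff[OF _ ij(1)] block_row_subset[OF ij(2)] by blast
    then have "card {q \<in> block_row r j. v q \<in> block_col n r i} = ones n r i j"
      using card_label[OF ij(2,1) nonneg] by simp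
    then show "int (card {q \<in> block_row r j. v q \<in> block_col n r i}) =
      (if i \<le> j then lace_count n r i j else if i = j + 1 then int (r j (j + 1)) else 0)"
      using nonneg ij by (auto simp: ones_def)
  next
    fix j q q' assume q: "j \<le> n" "q \<in> block_row r j" "q' \<in> block_row r j" "q < q'"
    have d: "q \<in> {1..?d}" "q' \<in> {1..?d}" using q block_row_subset by blast+
    have "?l q' \<le> ?l q"
      using label_ge_iff[OF q(2,1) label_le[of n r q'] nonneg] label_ge_iff[OF q(3,1) label_le[of n r q'] nonneg] q(4) by auto
    then show "v q < v q'" using q(4) by (intro v_less d) (auto simp: prec_def)
  next
    fix i p p' assume p: "i \<le> n" "p \<in> block_col n r i" "p' \<in> block_col n r i" "p < p'"
    define q where "q = inv_into UNIV v p"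
    define q' where "q' = inv_into UNIV v p'"
    have vq: "v q = p" "v q' = p'"
      using permutes_inverses(1)[OF perm] by (auto simp: q_def q'_def)
    have pd: "p \<in> {1..?d}" "p' \<in> {1..?d}" using p block_col_subset by blast+
    have d: "q \<in> {1..?d}" "q' \<in> {1..?d}"
      using permutes_in_image[OF perm] vq pd by metis+
    have "?l q = i" "?l q' = i" using v_block_iff[OF d(1) p(1)] v_block_iff[OF d(2) p(1)] vq p by auto
    then show "inv_into UNIV v p < inv_into UNIV v p'"
      using v_iff[OF d] vq p(4) by (auto simp: prec_def q_def q'_def)
  qed
  then show ?thesis by blast
qed

section \<open>The bijection\<close>

lemma upt_split: "i \<le> j \<Longrightarrow> j \<le> k \<Longrightarrow> [i..<k] = [i..<j] @ [j..<k]"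
  by (metis le_add_diff_inverse upt_add_eq_append)

context zel
begin

text \<open>The lists are padded to exactly \<open>r i i\<close> columns. This makes
  \<open>fill\<close> injective on them and lets \<open>glue\<close> put every block at its
  offset.\<close>

definition fits where
  "fits W \<longleftrightarrow> good 0 (\<lambda>i. cword (W i)) \<and> (\<forall>i\<in>{1..n}. length (W i) = r i i \<and> tabl (W i) \<and>
     (\<forall>c\<in>set (W i). length c \<le> r (i - 1) (i - 1) \<and> set c \<subseteq> letters 0 i i))"

definition glue where "glue W = stack (\<lambda>i. map ((@) (key_col i)) (W i)) n"

text \<open>Columns being strict, this bounds the height of \<open>W i\<close> by that of its
  rectangle.\<close>

lemma card_letters: "i \<in> {1..n} \<Longrightarrow> card (letters 0 i i) \<le> r (i - 1) (i - 1)"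
proof -
  assume i: "i \<in> {1..n}"
  have "card (letters 0 i i) \<le> card {q \<in> {1..d}. one_col q \<le> i - 1 \<and> i - 1 \<le> row_blk r q}"
    by (rule card_mono) (use i in \<open>auto simp: letters_def\<close>)
  also have "\<dots> = r (i - 1) (i - 1)" using i by (intro card_ones) auto
  finally show ?thesis .
qed

lemma length_le_letters:
  assumes "i \<in> {1..n}" "sorted_wrt (<) c" "set c \<subseteq> letters 0 i i"
  shows "length c \<le> r (i - 1) (i - 1)"
proof -
  have "length c = card (set c)" using assms(2) by (simp add: strict_sorted_iff distinct_card)
  also have "\<dots> \<le> card (letters 0 i i)" using assms(3) by (intro card_mono) (auto simp: letters_def)
  finally show ?thesis using card_letters[OF assms(1)] by simp
qed

lemma length_key_col: "length (key_col i) = row_offset r (i - 1)"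
  by (simp add: key_col_def)

lemma length_stack:
  "m \<le> n \<Longrightarrow> \<forall>i\<in>{1..m}. length (G i) = r i i \<Longrightarrow> length (stack G m) + col_offset n r m = col_offset n r 0"
  by (induction m) (auto simp: col_offset_Suc)

text \<open>\<open>stack G m\<close> begins with block column \<open>m\<close>, so positions are
  counted relative to the offset of that block.\<close>

lemma stack_nth:
  "m \<le> n \<Longrightarrow> \<forall>i\<in>{1..m}. length (G i) = r i i \<Longrightarrow> i \<in> {1..m} \<Longrightarrow> k < r i i \<Longrightarrow>
    stack G m ! (col_offset n r i - col_offset n r m + k) = G i ! k"
proof (induction m)
  case (Suc m)
  show ?case
  proof (cases "i = Suc m")
    case True
    then show ?thesis using Suc.prems by (simp add: nth_append)
  next
    case False
    then have "i \<le> m" using Suc.prems by auto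
    then have "col_offset n r m \<le> col_offset n r i" by (rule col_offset_antimono)
    moreover have "col_offset n r m = col_offset n r (Suc m) + r (Suc m) (Suc m)"
      using Suc.prems by (intro col_offset_Suc) auto
    ultimately have "col_offset n r i - col_offset n r (Suc m) + k =
      length (G (Suc m)) + (col_offset n r i - col_offset n r m + k)"
      using Suc.prems by auto
    then have "stack G (Suc m) ! (col_offset n r i - col_offset n r (Suc m) + k) =
      stack G m ! (col_offset n r i - col_offset n r m + k)"
      by (simp only: stack.simps nth_append_length_plus)
    then show ?thesis using Suc.IH Suc.prems \<open>i \<le> m\<close> by simp
  qed
qed simp

lemma stack_cong: "\<forall>i\<in>{1..m}. G i = H i \<Longrightarrow> stack G m = stack H m"
  by (induction m) auto

lemma stack_cols:
  "m \<le> n \<Longrightarrow> stack (\<lambda>i. map f (cols i)) m = map f [Suc (col_offset n r m)..<Suc (col_offset n r 0)]"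
proof (induction m)
  case (Suc m)
  have c: "col_offset n r m = col_offset n r (Suc m) + r (Suc m) (Suc m)"
    using Suc.prems by (intro col_offset_Suc) auto
  have "col_offset n r m \<le> col_offset n r 0" by (rule col_offset_antimono) simp
  then have "[Suc (col_offset n r (Suc m))..<Suc (col_offset n r 0)] =
    cols (Suc m) @ [Suc (col_offset n r m)..<Suc (col_offset n r 0)]"
    unfolding cols_def c[symmetric] using c by (intro upt_split) auto
  then show ?case using Suc by (simp del: upt_Suc)
qed simp

text \<open>The range stops before block column \<open>0\<close>, whose columns have no boxes
  because no label is smaller.\<close>

lemma full_blks_eq:
  "full_blks n = map (\<lambda>p. sorted_list_of_set {q. (q, p) \<in> perm_diagram d v}) [1..<Suc (col_offset n r 0)]"
proof -
  have "col_offset n r n = 0" by (simp add: col_offset_def)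
  moreover have "full_blk = (\<lambda>m. map (\<lambda>p. sorted_list_of_set {q. (q, p) \<in> perm_diagram d v}) (cols m))"
    by (simp add: full_blk_def fun_eq_iff)
  ultimately show ?thesis
    using stack_cols[of n "\<lambda>p. sorted_list_of_set {q. (q, p) \<in> perm_diagram d v}"] by (simp del: upt_Suc)
qed

lemma peelable_iff: "peelable (D_rank n r) Q \<longleftrightarrow> tableau Q \<and> peels (full_blks n) (column_word Q) []"
proof -
  have fin: "finite (D_rank n r)"
    unfolding D_rank_eq by (rule finite_subset[of _ "{1..d} \<times> {1..d}"]) (auto simp: perm_diagram_def)
  have "snd ` D_rank n r \<subseteq> {1..<Suc (col_offset n r 0)}"
  proof
    fix p assume "p \<in> snd ` D_rank n r"
    then obtain q where "(q, p) \<in> perm_diagram d v" by (auto simp: D_rank_eq)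
    then have "p \<in> {1..d}" "\<not> col_blk n r p \<le> 0" by (auto simp: diagram_iff)
    then show "p \<in> {1..<Suc (col_offset n r 0)}" using col_blk_le_iff[of p n r 0] by auto
  qed
  then show ?thesis
    using peelable_iff_peels[OF fin, of 1 "Suc (col_offset n r 0)" Q] by (simp add: full_blks_eq D_rank_eq del: upt_Suc)
qed

lemma tabl_stack:
  assumes "m \<le> n" "\<forall>i\<in>{1..m}. tabl (W i) \<and> (\<forall>c\<in>set (W i). length c \<le> r (i - 1) (i - 1) \<and> set c \<subseteq> letters 0 i i)"
  shows "tabl (stack (\<lambda>i. map ((@) (key_col i)) (W i)) m) \<and>
    (\<forall>y\<in>set (stack (\<lambda>i. map ((@) (key_col i)) (W i)) m). length y \<le> row_offset r m \<and> (\<forall>z\<in>set y. 1 \<le> z))"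
  using assms
proof (induction m)
  case (Suc m)
  let ?G = "\<lambda>i. map ((@) (key_col i)) (W i)"
  let ?K = "key_col (Suc m)"
  have m: "Suc m \<in> {1..n}" using Suc.prems by auto
  have "tabl (stack ?G m) \<and> (\<forall>y\<in>set (stack ?G m). length y \<le> row_offset r m \<and> (\<forall>z\<in>set y. 1 \<le> z))"
    by (rule Suc.IH) (use Suc.prems in simp_all)
  then have IH: "tabl (stack ?G m)" "\<And>y. y \<in> set (stack ?G m) \<Longrightarrow> length y \<le> row_offset r m \<and> (\<forall>z\<in>set y. 1 \<le> z)"
    by blast+
  have W: "tabl (W (Suc m))" "\<And>c. c \<in> set (W (Suc m)) \<Longrightarrow> length c \<le> r m m \<and> set c \<subseteq> letters 0 (Suc m) (Suc m)"
    using bspec[OF Suc.prems(2), of "Suc m"] by auto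
  have lt: "k < z" if "k \<in> set ?K" "z \<in> letters 0 (Suc m) (Suc m)" for k z
    using that row_blk_mono[of z k n r] by (force simp: key_col_iff[OF m] letters_def)
  have srt: "sorted_wrt (<) y" if "y \<in> set (?G (Suc m))" for y
  proof -
    obtain c where c: "c \<in> set (W (Suc m))" "y = ?K @ c" using \<open>y \<in> set (?G (Suc m))\<close> by auto
    have "sorted_wrt (<) ?K" by (simp add: key_col_def del: upt_Suc)
    moreover have "\<forall>k\<in>set ?K. \<forall>z\<in>set c. k < z" using W(2)[OF c(1)] lt by blast
    ultimately show ?thesis unfolding c(2) sorted_wrt_append using tabl_sorted[OF W(1) c(1)] by blast
  qed
  \<comment> \<open>\<open>key_col\<close> begins \<open>1, 2, ...\<close>, the least possible
    entries in these rows, and columns further right are no longer than it.\<close>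
  have cross: "col_le x y" if "x \<in> set (?G (Suc m))" "y \<in> set (stack ?G m)" for x y
  proof -
    obtain c where c: "x = ?K @ c" using \<open>x \<in> set (?G (Suc m))\<close> by auto
    note y = IH(2)[OF that(2)]
    have ys: "sorted_wrt (<) y" using tabl_sorted[OF IH(1) that(2)] .
    have "x ! a \<le> y ! a" if a: "a < length y" for a
    proof -
      have "a < row_offset r m" using a y by auto
      then have "x ! a = Suc a" by (simp add: c key_col_def nth_append del: upt_Suc)
      also have "\<dots> \<le> y ! a" using sorted_nth_ge[OF ys, of 1 a] y a by auto
      finally show ?thesis .
    qed
    then show ?thesis using y by (auto simp: col_le_iff c length_key_col)
  qed
  have "sorted_wrt col_le (?G (Suc m))" using W(1) by (simp add: tabl_iff sorted_wrt_map)
  then have "tabl (stack ?G (Suc m))"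
    using srt cross IH(1) unfolding tabl_iff stack.simps sorted_wrt_append by auto
  moreover have "length y \<le> row_offset r (Suc m) \<and> (\<forall>z\<in>set y. 1 \<le> z)" if "y \<in> set (stack ?G (Suc m))" for y
  proof (cases "y \<in> set (stack ?G m)")
    case True
    then show ?thesis using IH(2) row_offset_Suc[of r m] by force
  next
    case False
    then obtain c where c: "c \<in> set (W (Suc m))" "y = ?K @ c" using \<open>y \<in> set (stack ?G (Suc m))\<close> by auto
    then show ?thesis using W(2)[OF c(1)] by (auto simp: length_key_col row_offset_Suc key_col_iff[OF m] letters_def)
  qed
  ultimately show ?case by blast
qed simp

lemma tabl_glue: "fits W \<Longrightarrow> tabl (glue W)"
  using tabl_stack[of n W] unfolding glue_def fits_def by auto

lemma peelable_glue: "fits W \<Longrightarrow> peelable (D_rank n r) (fill (glue W))"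
proof -
  assume f: "fits W"
  obtain Y where Y: "Y (Suc n) = []" "Y 1 = []"
    "\<And>m. m \<in> {1..n} \<Longrightarrow> peels (blk 0 m) (Y (Suc m) @ cword (W m)) (Y m) \<and> set (cword (W m)) \<subseteq> letters 0 m m"
    "\<And>m. m \<in> {1..n} \<Longrightarrow> set (Y m) \<subseteq> letters 0 m (m - 1)"
    using f unfolding fits_def good_def by auto
  have "set (Y (Suc i)) \<subseteq> letters 0 (Suc i) i" if "i \<in> {1..n}" for i
    using Y(1) Y(4)[of "Suc i"] that by (cases "i = n") auto
  moreover have "tabl (map ((@) (key_col i)) (W i))" if i: "i \<in> {1..n}" for i
  proof -
    have "set (map ((@) (key_col i)) (W i)) \<subseteq> set (glue W)" if "i \<le> m" "m \<le> n" for m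
      using that i unfolding glue_def
    proof -
      have "i \<in> {1..k} \<Longrightarrow> set (map ((@) (key_col i)) (W i)) \<subseteq> set (stack (\<lambda>i. map ((@) (key_col i)) (W i)) k)" for k
      proof (induction k)
        case (Suc k)
        then show ?case by (cases "i = Suc k") auto
      qed simp
      then show "set (map ((@) (key_col i)) (W i)) \<subseteq> set (stack (\<lambda>i. map ((@) (key_col i)) (W i)) n)" using i by auto
    qed
    then show ?thesis using i tabl_glue[OF f] f unfolding tabl_iff fits_def by (auto simp: sorted_wrt_map)
  qed
  ultimately have "peels (full_blks n) (Y (Suc n) @ cword (glue W)) []"
    using full_intro[of n Y W] Y f unfolding glue_def fits_def by auto
  then show ?thesis unfolding peelable_iff
    using Y(1) tableau_fill[OF tabl_glue[OF f]] by (simp add: column_word_fill)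
qed

lemma peelable_imp_glue:
  assumes "peelable (D_rank n r) Q"
  obtains W where "fits W" "Q = fill (glue W)"
proof -
  have Q: "tableau Q" "peels (full_blks n) (column_word Q) []" using assms by (auto simp: peelable_iff)
  let ?L = "col_offset n r 0"
  obtain N where N: "N \<ge> ?L" "snd ` dom Q \<subseteq> {1..<Suc N}" using tableau_bound[OF Q(1)] by blast
  define V where "V i = map (column Q) (cols i)" for i
  \<comment> \<open>The columns to the right of block column \<open>1\<close>; peeling forces them
    to be empty.\<close>
  define R where "R = map (column Q) [Suc ?L..<Suc N]"
  have "col_offset n r n = 0" by (simp add: col_offset_def)
  then have "stack V n = map (column Q) [1..<Suc ?L]"
    using stack_cols[of n "column Q"] by (simp add: V_def[abs_def] del: upt_Suc)
  moreover have "[1..<Suc N] = [1..<Suc ?L] @ [Suc ?L..<Suc N]"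
    using N(1) by (intro upt_split) auto
  ultimately have VR: "stack V n @ R = map (column Q) [1..<Suc N]" by (simp add: R_def del: upt_Suc)
  note t = tableau_tabl[OF Q(1) N(2)]
  have tVR: "tabl (stack V n @ R)" using t(1) unfolding VR .
  have lV: "\<forall>i\<in>{1..n}. length (V i) = r i i" by (simp add: V_def cols_def)
  have "\<exists>W Y. Y (Suc n) = [] \<and> Y 1 = [] \<and> cword R = [] \<and>
    (\<forall>i\<in>{1..n}. V i = map ((@) (key_col i)) (W i) \<and> peels (blk 0 i) (Y (Suc i) @ cword (W i)) (Y i) \<and>
      set (cword (W i)) \<subseteq> letters 0 i i \<and> set (Y i) \<subseteq> letters 0 i (i - 1))"
  proof (rule full_elim)
    show "peels (full_blks n) ([] @ cword (stack V n @ R)) []" using Q(2) t(3) VR by simp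
  qed (use tVR lV in auto)
  then obtain W Y where WY: "Y (Suc n) = []" "Y 1 = []" "cword R = []"
    "\<And>i. i \<in> {1..n} \<Longrightarrow> V i = map ((@) (key_col i)) (W i)"
    "\<And>i. i \<in> {1..n} \<Longrightarrow> peels (blk 0 i) (Y (Suc i) @ cword (W i)) (Y i)"
    "\<And>i. i \<in> {1..n} \<Longrightarrow> set (cword (W i)) \<subseteq> letters 0 i i"
    "\<And>i. i \<in> {1..n} \<Longrightarrow> set (Y i) \<subseteq> letters 0 i (i - 1)" by blast
  have "good 0 (\<lambda>i. cword (W i))"
    unfolding good_def using WY by (intro exI[of _ Y]) auto
  moreover have tV: "tabl (V i)" if i: "i \<in> {1..n}" for i
  proof -
    have "map (column Q) [1..<Suc N] = map (column Q) [1..<Suc (col_offset n r i)] @ V i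
      @ map (column Q) [Suc (col_offset n r i + r i i)..<Suc N]"
    proof -
      have "col_offset n r i + r i i \<le> ?L"
        using col_offset_Suc[of "i - 1" n r] i col_offset_antimono[of 0 "i - 1" n r] by auto
      then have "[1..<Suc N] = [1..<Suc (col_offset n r i)] @ cols i @ [Suc (col_offset n r i + r i i)..<Suc N]"
        using upt_split[of 1 "Suc (col_offset n r i)" "Suc N"]
          upt_split[of "Suc (col_offset n r i)" "Suc (col_offset n r i + r i i)" "Suc N"] N(1)
        by (simp add: cols_def del: upt_Suc)
      then show ?thesis by (simp add: V_def del: upt_Suc)
    qed
    with t(1) show ?thesis using tabl_appendD by metis
  qed
  moreover have "tabl (W i)" if i: "i \<in> {1..n}" for i
    using tV[OF i] unfolding WY(4)[OF i] tabl_iff by (auto simp: sorted_wrt_map sorted_wrt_append)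
  moreover have "length (W i) = r i i" if i: "i \<in> {1..n}" for i
    using lV i WY(4)[OF i] by (metis length_map)
  moreover have "set c \<subseteq> letters 0 i i" if i: "i \<in> {1..n}" "c \<in> set (W i)" for i c
    using WY(6)[OF i(1)] i(2) by (auto simp: set_cword)
  ultimately have f: "fits W" unfolding fits_def using length_le_letters tabl_sorted by blast
  have gV: "glue W = stack V n" unfolding glue_def by (rule stack_cong) (use WY(4) in auto)
  have "column_word Q = cword (glue W)" using t(3) WY(3) VR[symmetric] gV by simp
  then have "Q = fill (glue W)"
    using Q(1) tableau_fill[OF tabl_glue[OF f]] by (intro tableau_word_unique) (auto simp: column_word_fill)
  with f show ?thesis by (rule that)
qed

lemma Psi_glue:
  assumes "fits W"
  shows "Psi n r (fill (glue W)) = map (\<lambda>i. fill (W i)) [1..<n + 1]"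
  unfolding Psi_def
proof (rule map_cong)
  fix i assume "i \<in> set [1..<n + 1]"
  then have i: "i \<in> {1..n}" by auto
  let ?o = "row_offset r (i - 1)" and ?c = "col_offset n r i"
  have W: "length (W i) = r i i" "\<And>c. c \<in> set (W i) \<Longrightarrow> length c \<le> r (i - 1) (i - 1)"
    using assms i unfolding fits_def by auto
  let ?G = "\<lambda>i. map ((@) (key_col i)) (W i)"
  have lG: "\<forall>i\<in>{1..n}. length (?G i) = r i i" using assms unfolding fits_def by auto
  have c0: "col_offset n r n = 0" by (simp add: col_offset_def)
  have lglue: "length (glue W) = col_offset n r 0"
    using length_stack[of n ?G] lG c0 unfolding glue_def by simp
  have cr: "?c + r i i \<le> col_offset n r 0"
    using col_offset_Suc[of "i - 1" n r] i col_offset_antimono[of 0 "i - 1" n r] by auto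
  have nth: "glue W ! (?c + k) = key_col i @ W i ! k" if "k < r i i" for k
    using stack_nth[of n ?G i k] lG i that c0 W(1) unfolding glue_def by simp
  show "shift_nw ?o ?c (remove_sub (fill (glue W)) (key_Hom n r) |` (block_row r (i - 1) \<times> block_col n r i)) = fill (W i)"
  proof
    fix x :: box obtain a b where x: "x = (a, b)" by (cases x)
    show "shift_nw ?o ?c (remove_sub (fill (glue W)) (key_Hom n r) |` (block_row r (i - 1) \<times> block_col n r i)) x = fill (W i) x"
    proof (cases "a \<in> {1..r (i - 1) (i - 1)} \<and> b \<in> {1..r i i}")
      case True
      have blk: "?o + a \<in> block_row r (i - 1)" "?c + b \<in> block_col n r i"
        using True by (auto simp: block_row_def block_col_def)
      have in_d: "?o + a \<in> {1..d}" "?c + b \<in> {1..d}"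
        
        using subsetD[OF block_row_subset blk(1), of n] subsetD[OF block_col_subset blk(2)] i by auto
      \<comment> \<open>The label of the block column exceeds the block row by one, whereas
        \<open>D_Hom\<close> requires a difference of at least two.\<close>
      have "(?o + a, ?c + b) \<notin> D_Hom n r"
      proof
        assume "(?o + a, ?c + b) \<in> D_Hom n r"
        then obtain j i' where "j \<le> n" "i' \<in> {j + 2..n}" "?o + a \<in> block_row r j" "?c + b \<in> block_col n r i'"
          by (auto simp: D_Hom_def)
        moreover from this have "j = i - 1" "i' = i"
          using blk block_row_iff[OF in_d(1)] block_col_iff[OF in_d(2)] i by auto
        ultimately show False by auto
      qed
      then have nk: "(?o + a, ?c + b) \<notin> dom (key_Hom n r)" by (auto simp: key_Hom_def row_filling_def)
      have "b - 1 < r i i" using True by auto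
      from nth[OF this] have k: "glue W ! (?c + b - 1) = key_col i @ W i ! (b - 1)" using True by simp
      have "fill (glue W) (?o + a, ?c + b) = fill (W i) (a, b)"
        using True cr k unfolding fill_def lglue
        by (auto simp: length_key_col nth_append W(1))
      then show ?thesis using True blk nk by (auto simp: x shift_nw_def remove_sub_def)
    next
      case False
      have "fill (W i) x = None"
      proof (cases "b \<in> {1..r i i}")
        case True
        then have "W i ! (b - 1) \<in> set (W i)" using W(1) by auto
        then show ?thesis using False True W(2)[of "W i ! (b - 1)"] by (auto simp: x fill_def)
      qed (use W(1) in \<open>auto simp: x fill_def\<close>)
      moreover have "shift_nw ?o ?c (remove_sub (fill (glue W)) (key_Hom n r) |` (block_row r (i - 1) \<times> block_col n r i)) x = None"
        using False by (auto simp: x shift_nw_def block_row_def block_col_def)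
      ultimately show ?thesis by simp
    qed
  qed
qed simp

lemma fits_imp_factor_sequence:
  assumes "fits W" "n \<ge> 1"
  shows "factor_sequence n (T_rank n r) (map (\<lambda>i. fill (W i)) [1..<n + 1])"
proof -
  have nth: "map (\<lambda>i. fill (W i)) [1..<n + 1] ! (i - 1) = fill (W i)" if "i \<in> {1..n}" for i
    using that by (subst nth_map) (auto simp del: upt_Suc)
  have "factor_sequence (n - 0) (\<lambda>i j. T_rank n r i (j + 0)) (map (\<lambda>i. fill (W i)) [1..<n + 1])"
  proof (rule good_imp_factor_sequence)
    show "\<forall>i\<in>{1..n - 0}. tableau (map (\<lambda>i. fill (W i)) [1..<n + 1] ! (i - 1))"
      using nth assms(1) tableau_fill unfolding fits_def by auto
    have "good 0 (\<lambda>i. cword (W i))" using assms(1) unfolding fits_def by blast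
    then show "good 0 (\<lambda>i. column_word (map (\<lambda>i. fill (W i)) [1..<n + 1] ! (i - 1)))"
      by (rule good_knuth) (use nth in \<open>auto simp: column_word_fill\<close>)
  qed (use assms(2) in auto)
  then show ?thesis by simp
qed

lemma factor_sequence_imp_fits:
  assumes "factor_sequence n (T_rank n r) Ws" "n \<ge> 1"
  obtains W where "fits W" "Ws = map (\<lambda>i. fill (W i)) [1..<n + 1]"
proof -
  have W: "length Ws = n" "\<And>i. i \<in> {1..n} \<Longrightarrow> tableau (Ws ! (i - 1))" "good 0 (\<lambda>i. column_word (Ws ! (i - 1)))"
    using factor_sequence_imp_good[OF assms(1), of 0] assms(2) by auto
  obtain Y where Y: "\<And>m. m \<in> {1..n} \<Longrightarrow> set (column_word (Ws ! (m - 1))) \<subseteq> letters 0 m m"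
    using W(3) unfolding good_def by auto
  define C where "C i = map (column (Ws ! (i - 1))) [1..<Suc (r i i)]" for i
  have main: "tabl (C i) \<and> fill (C i) = Ws ! (i - 1) \<and> cword (C i) = column_word (Ws ! (i - 1))" if i: "i \<in> {1..n}" for i
  proof -
    let ?F = "Ws ! (i - 1)"
    \<comment> \<open>If column \<open>k\<close> is nonempty, the top entries of the first
      \<open>k\<close> columns are a weakly increasing subsequence of length \<open>k\<close>, which
      \<open>good_width\<close> bounds.\<close>
    have dom: "snd ` dom ?F \<subseteq> {1..<Suc (r i i)}"
    proof
      fix k assume "k \<in> snd ` dom ?F"
      then obtain a where a: "(a, k) \<in> dom ?F" by (metis imageE prod.collapse)
      have k1: "k \<ge> 1" "(1, j) \<in> dom ?F" if "j \<in> {1..k}" for j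
        using tableau_dom[OF W(2)[OF i] a] that by auto
      have k0: "k \<ge> 1" using tableau_dom(2)[OF W(2)[OF i] a] .
      obtain N where N: "N \<ge> k" "snd ` dom ?F \<subseteq> {1..<Suc N}" using tableau_bound[OF W(2)[OF i]] by blast
      note t = tableau_tabl[OF W(2)[OF i] N(2)]
      have split: "[1..<Suc N] = [1..<Suc k] @ [Suc k..<Suc N]"
        using N(1) by (intro upt_split) auto
      let ?ys = "map (column ?F) [1..<Suc k]"
      have ty: "tabl ?ys" using t(1) tabl_appendD unfolding split map_append by blast
      have ne: "\<forall>y\<in>set ?ys. y \<noteq> []"
      proof
        fix y assume "y \<in> set ?ys"
        then obtain j where j: "j \<in> {1..k}" "y = column ?F j" by (auto simp: less_Suc_eq_le simp del: upt_Suc)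
        have "(1, j) \<in> dom ?F" using k1(2)[OF j(1)] .
        then show "y \<noteq> []" using tableau_column(1)[OF W(2)[OF i], of 1 j] j(2) by auto
      qed
      have "subseq (map hd ?ys) (column_word ?F)"
        unfolding t(3) split map_append cword_simps
        using nonempty_columns_weakly_increasing[OF ty ne] by (intro subseq_rev_drop_many) simp
      from good_width[OF W(3) i this] have "length (map hd ?ys) \<le> r i i"
        using nonempty_columns_weakly_increasing[OF ty ne] by blast
      then show "k \<in> {1..<Suc (r i i)}" using k0 by simp
    qed
    show ?thesis unfolding C_def using tableau_tabl[OF W(2)[OF i] dom] by simp
  qed
  have "fits C"
    unfolding fits_def
  proof (intro conjI ballI)
    show "good 0 (\<lambda>i. cword (C i))" by (rule good_knuth[OF W(3)]) (use main in auto)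
    fix i assume i: "i \<in> {1..n}"
    show "length (C i) = r i i" by (simp add: C_def)
    show "tabl (C i)" using main[OF i] by simp
    fix c assume c: "c \<in> set (C i)"
    have "set c \<subseteq> set (cword (C i))" using c by (auto simp: set_cword)
    then show "set c \<subseteq> letters 0 i i" using main[OF i] Y[OF i] by auto
    then show "length c \<le> r (i - 1) (i - 1)"
      using length_le_letters[OF i] tabl_sorted[of "C i" c] main[OF i] c by simp
  qed
  moreover have "Ws = map (\<lambda>i. fill (C i)) [1..<n + 1]"
    by (rule nth_equalityI) (use W(1) main in \<open>auto simp del: upt_Suc\<close>)
  ultimately show ?thesis by (rule that)
qed

text \<open>Both sides are parametrised by the families \<open>W\<close> with \<open>fits W\<close>:
  peelable tableaux through \<open>glue\<close>, factor sequences through \<open>fill\<close> of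
  each member. \<open>Psi_glue\<close> says that \<open>Psi\<close> matches the two
  parametrisations.\<close>

theorem Psi_bij:
  assumes "n \<ge> 1"
  shows "bij_betw (Psi n r) (Peel (D_rank n r)) (rank_factor_sequences n r)"
  unfolding bij_betw_def
proof
  show "inj_on (Psi n r) (Peel (D_rank n r))"
  proof (rule inj_onI)
    fix Q Q' assume "Q \<in> Peel (D_rank n r)" "Q' \<in> Peel (D_rank n r)" and eq: "Psi n r Q = Psi n r Q'"
    then obtain W W' where W: "fits W" "Q = fill (glue W)" and W': "fits W'" "Q' = fill (glue W')"
      unfolding Peel_def using peelable_imp_glue by (metis mem_Collect_eq)
    have "W i = W' i" if i: "i \<in> {1..n}" for i
    proof -
      have "\<forall>j\<in>set [1..<n + 1]. fill (W j) = fill (W' j)"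
        using eq unfolding W(2) W'(2) Psi_glue[OF W(1)] Psi_glue[OF W'(1)] by (simp only: map_eq_conv)
      moreover have "i \<in> set [1..<n + 1]" using i by auto
      ultimately have "fill (W i) = fill (W' i)" by blast
      moreover have "length (W i) = length (W' i)" using W(1) W'(1) i unfolding fits_def by simp
      ultimately show ?thesis using map_column_fill by metis
    qed
    then have "glue W = glue W'" unfolding glue_def by (intro stack_cong) auto
    then show "Q = Q'" using W W' by simp
  qed
  show "Psi n r ` Peel (D_rank n r) = rank_factor_sequences n r"
  proof (intro equalityI subsetI)
    fix Ws assume "Ws \<in> Psi n r ` Peel (D_rank n r)"
    then obtain W where "fits W" "Ws = Psi n r (fill (glue W))"
      unfolding Peel_def using peelable_imp_glue by (metis imageE mem_Collect_eq)
    then show "Ws \<in> rank_factor_sequences n r"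
      using Psi_glue fits_imp_factor_sequence[OF _ assms] by (simp add: rank_factor_sequences_def)
  next
    fix Ws assume "Ws \<in> rank_factor_sequences n r"
    then obtain W where "fits W" "Ws = map (\<lambda>i. fill (W i)) [1..<n + 1]"
      using factor_sequence_imp_fits[OF _ assms] by (auto simp: rank_factor_sequences_def)
    then show "Ws \<in> Psi n r ` Peel (D_rank n r)"
      using Psi_glue peelable_glue by (intro image_eqI[of _ _ "fill (glue W)"]) (auto simp: Peel_def)
  qed
qed

end

theorem theorem22:
  fixes n :: nat and r :: "nat \<Rightarrow> nat \<Rightarrow> nat"
  assumes "n \<ge> 1"
    and "can_occur TYPE('k::field) n r"
  shows "bij_betw (Psi n r) (Peel (D_rank n r)) (rank_factor_sequences n r)"
proof -
  obtain v where "is_zelevinsky n r v"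
    using zelevinsky_exists[of n r] can_occur_lace_count[OF assms(2)] by blast
  then interpret zel n r v by unfold_locales
  show ?thesis using assms(1) by (rule Psi_bij)
qed

end
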